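(* Let $\Sigma$ be an LPV-SSA representation satisfying the regularity certificate. If $\Sigma$ is minimal with respect to the initial state $x_\mathrm{o}=0$, then $\Sigma$ is jointly state minimal, i.e. it is both structurally state-observable and structurally state-reachable.
   Context: Time is either continuous (CT: $\mathbb{T}=[0,\infty)$, $\xi=\frac{d}{dt}$) or discrete (DT: $\mathbb{T}=\mathbb{N}=\{0,1,\ldots\}$, $(\xi z)(t)=z(t+1)$); the statement is asserted in each of the two cases. The scheduling set $\mathbb{P}\subseteq\mathbb{R}^{n_\mathrm{p}}$ is fixed and its affine hull is $\mathbb{R}^{n_\mathrm{p}}$; $n_\mathrm{u},n_\mathrm{y}$ are fixed. In CT, $\mathcal{U},\mathcal{P},\mathcal{Y}$ are the sets of piecewise-continuous functions from $[0,\infty)$ to $\mathbb{R}^{n_\mathrm{u}}$, $\mathbb{P}$, $\mathbb{R}^{n_\mathrm{y}}$ respectively (finitely many discontinuities on each compact interval, with finite one-sided limits there); in DT they are the sets of all functions from $\mathbb{N}$ to these sets. An LPV-SSA representation $\Sigma=(\mathbb{P},\{A_i,B_i,C_i,0\}_{i=0}^{n_\mathrm{p}})$ of state dimension $\dim(\Sigma)=n_\mathrm{x}$ is the system $\xi x(t)=A(p(t))x(t)+B(p(t))u(t)$, $y(t)=C(p(t))x(t)$, where $A(\mathbf{p})=A_0+\sum_{i=1}^{n_\mathrm{p}}A_i\mathbf{p}_i$, and similarly $B(\mathbf{p})$, $C(\mathbf{p})$, with constant matrices $A_i\in\mathbb{R}^{n_\mathrm{x}\times n_\mathrm{x}}$,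 $B_i\in\mathbb{R}^{n_\mathrm{x}\times n_\mathrm{u}}$, $C_i\in\mathbb{R}^{n_\mathrm{y}\times n_\mathrm{x}}$. For $x_\mathrm{o}\in\mathbb{R}^{n_\mathrm{x}}$ and $(u,p)\in\mathcal{U}\times\mathcal{P}$, let $x$ be the unique state trajectory with $x(0)=x_\mathrm{o}$ (in CT: locally absolutely continuous, satisfying the state equation for almost all $t$), and put $\mathfrak{Y}_{\Sigma,x_\mathrm{o}}(u,p)(t)=C(p(t))x(t)$. $\Sigma$ is minimal with respect to $x_\mathrm{o}$ if $\dim(\Sigma)\le\dim(\Sigma')$ for every LPV-SSA representation $\Sigma'$ (with the same $\mathbb{P}$) and every initial state $x'_\mathrm{o}$ of $\Sigma'$ with $\mathfrak{Y}_{\Sigma',x'_\mathrm{o}}=\mathfrak{Y}_{\Sigma,x_\mathrm{o}}$. Regularity certificate: $\mathbb{P}$ is convex with non-empty interior, and, in DT, $A(\bar p)$ is invertible for all $\bar p\in\mathbb{P}$. Structural properties: regard the entries of $A(p),B(p),C(p)$ as functions in the field of meromorphic functions of the scheduling variable components and their time derivatives (CT), respectively their forward and backward time shifts (DT), all treated as independent variables. $\Sigma$ is structurally state-observable if the matrix $[o_1^\top\ \cdots\ o_{n_\mathrm{x}}^\top]^\top$ has rank $n_\mathrm{x}$ over this field, where $o_1=C(p)$ and $o_{j+1}=\dot o_j+o_jA(p)$ in CT, $o_{j+1}=(q\,o_j)A(p)$ in DT. $\Sigma$ is structurally state-reachable if $[r_1\ \cdots\ r_{n_\mathrm{x}}]$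 has rank $n_\mathrm{x}$ over this field, where $r_1=B(p)$ and $r_{j+1}=-\dot r_j+A(p)r_j$ in CT, $r_{j+1}=A(p)(q^{-1}r_j)$ in DT. Here the dot is formal time differentiation along $p$ and $q^{\pm1}$ is the formal forward/backward time shift of the scheduling variable. *)

theory Defs
  imports
    "HOL-Analysis.Analysis"
    "HOL-Computational_Algebra.Fraction_Field"
    "HOL-Complex_Analysis.Cauchy_Integral_Formula"
    "Jordan_Normal_Form.DL_Rank"
begin

unbundle no vec_syntax

section \<open>The field of meromorphic functions\<close>

subsection \<open>Real-analytic functions of finitely many among the variables of type \<open>'v\<close>\<close>

definition exponents :: "'v set \<Rightarrow> ('v \<Rightarrow> nat) set" where
  "exponents V = {\<alpha>. \<forall>v. v \<notin> V \<longrightarrow> \<alpha> v = 0}"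

definition monomial :: "'v set \<Rightarrow> ('v \<Rightarrow> real) \<Rightarrow> ('v \<Rightarrow> nat) \<Rightarrow> real" where
  "monomial V h \<alpha> = (\<Prod>v\<in>V. h v ^ \<alpha> v)"

text \<open>
  Around every point \<open>a\<close> the function \<open>f\<close> is the sum of an absolutely convergent power series in
  the variables from the finite set \<open>V\<close>. As the expansion is required to hold for every
  assignment \<open>x\<close> that is close to \<open>a\<close> on \<open>V\<close> only, \<open>f\<close> cannot depend on variables outside \<open>V\<close>.
\<close>

definition analytic_in :: "'v set \<Rightarrow> (('v \<Rightarrow> real) \<Rightarrow> real) \<Rightarrow> bool" where
  "analytic_in V f \<longleftrightarrow> finite V \<and>
     (\<forall>a. \<exists>r>0. \<exists>c. \<forall>x. (\<forall>v\<in>V. \<bar>x v - a v\<bar> < r) \<longrightarrow>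
        ((\<lambda>\<alpha>. c \<alpha> * monomial V (\<lambda>v. x v - a v) \<alpha>) has_sum f x) (exponents V))"

definition expansion :: "'v set \<Rightarrow> (('v \<Rightarrow> real) \<Rightarrow> real) \<Rightarrow> ('v \<Rightarrow> real) \<Rightarrow> real \<Rightarrow> (('v \<Rightarrow> nat) \<Rightarrow> real) \<Rightarrow> bool" where
  "expansion V f a r c \<longleftrightarrow> r > 0 \<and> (\<forall>h. (\<forall>v\<in>V. \<bar>h v\<bar> < r) \<longrightarrow>
     ((\<lambda>\<alpha>. c \<alpha> * monomial V h \<alpha>) has_sum f (\<lambda>v. a v + h v)) (exponents V))"

lemma expansionD:
  assumes "expansion V f a r c"
  shows "r > 0"
    and "(\<And>v. v \<in> V \<Longrightarrow> \<bar>h v\<bar> < r) \<Longrightarrow>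
      ((\<lambda>\<alpha>. c \<alpha> * monomial V h \<alpha>) has_sum f (\<lambda>v. a v + h v)) (exponents V)"
  using assms by (simp_all add: expansion_def)

lemma analytic_inE:
  assumes "analytic_in V f"
  obtains r c where "expansion V f a r c"
proof -
  from assms obtain r c where r: "r > 0" and c: "\<forall>x. (\<forall>v\<in>V. \<bar>x v - a v\<bar> < r) \<longrightarrow>
        ((\<lambda>\<alpha>. c \<alpha> * monomial V (\<lambda>v. x v - a v) \<alpha>) has_sum f x) (exponents V)"
    unfolding analytic_in_def by blast
  have "expansion V f a r c"
    unfolding expansion_def
  proof (intro conjI r allI impI)
    fix h :: "'a \<Rightarrow> real" assume "\<forall>v\<in>V. \<bar>h v\<bar> < r"
    then show "((\<lambda>\<alpha>. c \<alpha> * monomial V h \<alpha>) has_sum f (\<lambda>v. a v + h v)) (exponents V)"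
      using c[rule_format, of "\<lambda>v. a v + h v"] by simp
  qed
  then show ?thesis by (rule that)
qed

lemma analytic_inI:
  assumes "finite V"
    and "\<And>a. \<exists>r>0. \<exists>c. \<forall>h. (\<forall>v\<in>V. \<bar>h v\<bar> < r) \<longrightarrow>
        ((\<lambda>\<alpha>. c \<alpha> * monomial V h \<alpha>) has_sum f (\<lambda>v. a v + h v)) (exponents V)"
  shows "analytic_in V f"
  unfolding analytic_in_def
proof (intro conjI assms(1) allI)
  fix a
  obtain r c where r: "r > 0" and c: "\<forall>h. (\<forall>v\<in>V. \<bar>h v\<bar> < r) \<longrightarrow>
        ((\<lambda>\<alpha>. c \<alpha> * monomial V h \<alpha>) has_sum f (\<lambda>v. a v + h v)) (exponents V)"
    using assms(2)[of a] by blast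
  have "((\<lambda>\<alpha>. c \<alpha> * monomial V (\<lambda>v. x v - a v) \<alpha>) has_sum f x) (exponents V)"
    if "\<forall>v\<in>V. \<bar>x v - a v\<bar> < r" for x
    using c[rule_format, of "\<lambda>v. x v - a v"] that by simp
  with r show "\<exists>r>0. \<exists>c. \<forall>x. (\<forall>v\<in>V. \<bar>x v - a v\<bar> < r) \<longrightarrow>
        ((\<lambda>\<alpha>. c \<alpha> * monomial V (\<lambda>v. x v - a v) \<alpha>) has_sum f x) (exponents V)"
    by blast
qed

lemma analytic_in_finite: "analytic_in V f \<Longrightarrow> finite V"
  by (simp add: analytic_in_def)

lemma monomial_cong: "(\<And>v. v \<in> V \<Longrightarrow> h v = h' v) \<Longrightarrow> monomial V h \<alpha> = monomial V h' \<alpha>"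
  by (simp add: monomial_def)

lemma analytic_in_cong:
  assumes "analytic_in V f" "\<And>v. v \<in> V \<Longrightarrow> x v = y v"
  shows "f x = f y"
proof -
  obtain r c where exr: "expansion V f x r c"
    by (rule analytic_inE[OF assms(1), of x])
  note r = expansionD(1)[OF exr] and c = expansionD(2)[OF exr]
  have "((\<lambda>\<alpha>. c \<alpha> * monomial V (\<lambda>v. 0) \<alpha>) has_sum f x) (exponents V)"
    using c[of "\<lambda>v. 0"] r by simp
  moreover have "((\<lambda>\<alpha>. c \<alpha> * monomial V (\<lambda>v. y v - x v) \<alpha>) has_sum f y) (exponents V)"
    using c[of "\<lambda>v. y v - x v"] r assms(2) by simp
  moreover have "monomial V (\<lambda>v. y v - x v) \<alpha> = monomial V (\<lambda>v. 0) \<alpha>" for \<alpha>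
    by (rule monomial_cong) (simp add: assms(2))
  ultimately show ?thesis by (simp add: has_sum_unique)
qed

lemma analytic_in_mono:
  assumes "analytic_in V f" "V \<subseteq> W" "finite W"
  shows "analytic_in W f"
proof (rule analytic_inI[OF assms(3)])
  fix a
  obtain r c where exr: "expansion V f a r c"
    by (rule analytic_inE[OF assms(1), of a])
  note r = expansionD(1)[OF exr] and c = expansionD(2)[OF exr]
  define d where "d \<alpha> = (if \<alpha> \<in> exponents V then c \<alpha> else 0)" for \<alpha>
  have "((\<lambda>\<alpha>. d \<alpha> * monomial W h \<alpha>) has_sum f (\<lambda>v. a v + h v)) (exponents W)"
    if h: "\<forall>v\<in>W. \<bar>h v\<bar> < r" for h
  proof -
    have eq: "monomial V h \<alpha> = monomial W h \<alpha>" if "\<alpha> \<in> exponents V" for \<alpha>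
      unfolding monomial_def using that assms
      by (intro prod.mono_neutral_left) (auto simp: exponents_def)
    have "((\<lambda>\<alpha>. c \<alpha> * monomial V h \<alpha>) has_sum f (\<lambda>v. a v + h v)) (exponents V)"
      using c h assms(2) by blast
    also have "?this \<longleftrightarrow> ?thesis"
      using assms(2) by (intro has_sum_cong_neutral) (auto simp: d_def eq exponents_def)
    finally show ?thesis .
  qed
  with r show "\<exists>r>0. \<exists>c. \<forall>h. (\<forall>v\<in>W. \<bar>h v\<bar> < r) \<longrightarrow>
        ((\<lambda>\<alpha>. c \<alpha> * monomial W h \<alpha>) has_sum f (\<lambda>v. a v + h v)) (exponents W)" by blast
qed

lemma analytic_in_const: "analytic_in {} (\<lambda>x. k)"
proof (rule analytic_inI)
  have *: "exponents {} = {\<lambda>v. 0::nat}" by (auto simp: exponents_def)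
  show "\<exists>r>0. \<exists>c. \<forall>h. (\<forall>v\<in>{}. \<bar>h v\<bar> < r) \<longrightarrow>
        ((\<lambda>\<alpha>. c \<alpha> * monomial {} h \<alpha>) has_sum k) (exponents {})" 
    by (intro exI[of _ 1] conjI exI[of _ "\<lambda>_. k"]) (auto simp: monomial_def * intro!: has_sum_finiteI)
qed simp

lemma analytic_in_var: "analytic_in {v} (\<lambda>x. x v)"
proof (rule analytic_inI)
  fix a :: "'a \<Rightarrow> real"
  define e where "e = (\<lambda>_. 0)(v := 1::nat)"
  define c where "c \<alpha> = (if \<alpha> = (\<lambda>_. 0) then a v else if \<alpha> = e then 1 else 0)" for \<alpha>
  have ne: "e \<noteq> (\<lambda>_. 0)" by (auto simp: e_def fun_eq_iff)
  have "((\<lambda>\<alpha>. c \<alpha> * monomial {v} h \<alpha>) has_sum a v + h v) (exponents {v})" for h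
  proof -
    have "((\<lambda>\<alpha>. c \<alpha> * monomial {v} h \<alpha>) has_sum a v + h v) {(\<lambda>_. 0), e}"
      using ne by (intro has_sum_finiteI) (auto simp: c_def monomial_def e_def)
    also have "?this \<longleftrightarrow> ?thesis"
      by (intro has_sum_cong_neutral) (auto simp: c_def exponents_def e_def)
    finally show ?thesis .
  qed
  then show "\<exists>r>0. \<exists>c. \<forall>h. (\<forall>w\<in>{v}. \<bar>h w\<bar> < r) \<longrightarrow>
        ((\<lambda>\<alpha>. c \<alpha> * monomial {v} h \<alpha>) has_sum a v + h v) (exponents {v})" 
    by (intro exI[of _ 1] conjI exI[of _ c]) auto
qed simp

lemma analytic_in_add:
  assumes "analytic_in V f" "analytic_in V g"
  shows "analytic_in V (\<lambda>x. f x + g x)"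
proof (rule analytic_inI[OF analytic_in_finite[OF assms(1)]])
  fix a
  obtain r c where exr: "expansion V f a r c"
    by (rule analytic_inE[OF assms(1), of a])
  note r = expansionD(1)[OF exr] and c = expansionD(2)[OF exr]
  obtain s d where exs: "expansion V g a s d"
    by (rule analytic_inE[OF assms(2), of a])
  note s = expansionD(1)[OF exs] and d = expansionD(2)[OF exs]
  have "((\<lambda>\<alpha>. (c \<alpha> + d \<alpha>) * monomial V h \<alpha>) has_sum f (\<lambda>v. a v + h v) + g (\<lambda>v. a v + h v)) (exponents V)"
    if "\<forall>v\<in>V. \<bar>h v\<bar> < min r s" for h
    unfolding ring_distribs using that by (intro has_sum_add c d) auto
  then show "\<exists>r>0. \<exists>c. \<forall>h. (\<forall>v\<in>V. \<bar>h v\<bar> < r) \<longrightarrow>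
        ((\<lambda>\<alpha>. c \<alpha> * monomial V h \<alpha>) has_sum f (\<lambda>v. a v + h v) + g (\<lambda>v. a v + h v)) (exponents V)"
    using r s by (intro exI[of _ "min r s"] conjI exI[of _ "\<lambda>\<alpha>. c \<alpha> + d \<alpha>"]) auto
qed

lemma has_sum_group:
  fixes g :: "'i \<Rightarrow> real"
  assumes g: "(g has_sum s) M" and sub: "\<phi> ` M \<subseteq> K"
  shows "((\<lambda>k. infsum g {\<alpha>\<in>M. \<phi> \<alpha> = k}) has_sum s) K"
proof (rule has_sum_SigmaD)
  have "bij_betw snd (Sigma K (\<lambda>k. {\<alpha>\<in>M. \<phi> \<alpha> = k})) M"
    by (rule bij_betwI[where g = "\<lambda>\<alpha>. (\<phi> \<alpha>, \<alpha>)"]) (use sub in auto)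
  from has_sum_reindex_bij_betw[OF this, of g s] g
  show "((\<lambda>p. g (snd p)) has_sum s) (Sigma K (\<lambda>k. {\<alpha>\<in>M. \<phi> \<alpha> = k}))" by simp
  show "((\<lambda>y. g (snd (k, y))) has_sum infsum g {\<alpha>\<in>M. \<phi> \<alpha> = k}) {\<alpha>\<in>M. \<phi> \<alpha> = k}" for k
    using has_sum_imp_summable[OF g] summable_on_subset_banach by fastforce
qed

lemma has_sum_times:
  fixes f :: "'i \<Rightarrow> real" and g :: "'j \<Rightarrow> real"
  assumes f: "(f has_sum s) M" and g: "(g has_sum t) N"
  shows "((\<lambda>p. f (fst p) * g (snd p)) has_sum s * t) (M \<times> N)"
proof (rule has_sum_SigmaI)
  show "((\<lambda>y. f (fst (x, y)) * g (snd (x, y))) has_sum f x * t) N" for x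
    using g by (simp add: has_sum_cmult_right)
  show "((\<lambda>x. f x * t) has_sum s * t) M"
    using f by (rule has_sum_cmult_left)
  have f': "(\<lambda>x. norm (f x)) summable_on M" and g': "(\<lambda>x. norm (g x)) summable_on N"
    using f g has_sum_imp_summable summable_on_iff_abs_summable_on_real by blast+
  have "(\<lambda>p. norm (f (fst p) * g (snd p))) summable_on (M \<times> N)"
    unfolding Infinite_Sum.abs_summable_on_Sigma_iff
  proof (intro conjI ballI)
    show "(\<lambda>y. norm (f (fst (x, y)) * g (snd (x, y)))) summable_on N" for x
      using g' by (simp add: abs_mult summable_on_cmult_right)
    show "(\<lambda>x. norm (\<Sum>\<^sub>\<infinity>y\<in>N. norm (f (fst (x, y)) * g (snd (x, y))))) summable_on M"
      using f' by (simp add: abs_mult infsum_cmult_right' summable_on_cmult_left)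
  qed
  then show "(\<lambda>p. f (fst p) * g (snd p)) summable_on (M \<times> N)"
    by (rule abs_summable_summable)
qed

lemma analytic_in_mult:
  assumes "analytic_in V f" "analytic_in V g"
  shows "analytic_in V (\<lambda>x. f x * g x)"
proof (rule analytic_inI[OF analytic_in_finite[OF assms(1)]])
  fix a
  obtain r c where exr: "expansion V f a r c"
    by (rule analytic_inE[OF assms(1), of a])
  note r = expansionD(1)[OF exr] and c = expansionD(2)[OF exr]
  obtain s d where exs: "expansion V g a s d"
    by (rule analytic_inE[OF assms(2), of a])
  note s = expansionD(1)[OF exs] and d = expansionD(2)[OF exs]
  define \<phi> where "\<phi> p = (\<lambda>v. fst p v + snd p v)" for p :: "('a \<Rightarrow> nat) \<times> ('a \<Rightarrow> nat)"
  define F where "F \<gamma> = {p \<in> exponents V \<times> exponents V. \<phi> p = \<gamma>}" for \<gamma>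
  define e where "e \<gamma> = infsum (\<lambda>p. c (fst p) * d (snd p)) (F \<gamma>)" for \<gamma>
  have mono: "monomial V h (\<phi> p) = monomial V h (fst p) * monomial V h (snd p)" for h p
    by (simp add: monomial_def \<phi>_def power_add prod.distrib)
  have "((\<lambda>\<alpha>. e \<alpha> * monomial V h \<alpha>) has_sum f (\<lambda>v. a v + h v) * g (\<lambda>v. a v + h v)) (exponents V)"
    if "\<forall>v\<in>V. \<bar>h v\<bar> < min r s" for h
  proof -
    let ?G = "\<lambda>p. (c (fst p) * monomial V h (fst p)) * (d (snd p) * monomial V h (snd p))"
    have "(?G has_sum f (\<lambda>v. a v + h v) * g (\<lambda>v. a v + h v)) (exponents V \<times> exponents V)"
      using that by (intro has_sum_times c d) auto
    then have "((\<lambda>\<gamma>. infsum ?G (F \<gamma>)) has_sum f (\<lambda>v. a v + h v) * g (\<lambda>v. a v + h v)) (exponents V)"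
      unfolding F_def by (rule has_sum_group) (auto simp: exponents_def \<phi>_def)
    moreover have "infsum ?G (F \<gamma>) = e \<gamma> * monomial V h \<gamma>" for \<gamma>
    proof -
      have "infsum ?G (F \<gamma>) = infsum (\<lambda>p. c (fst p) * d (snd p) * monomial V h \<gamma>) (F \<gamma>)"
        by (rule infsum_cong) (auto simp: F_def mono)
      also have "\<dots> = e \<gamma> * monomial V h \<gamma>"
        unfolding e_def by (rule infsum_cmult_left')
      finally show ?thesis .
    qed
    ultimately show ?thesis by simp
  qed
  then show "\<exists>r>0. \<exists>c. \<forall>h. (\<forall>v\<in>V. \<bar>h v\<bar> < r) \<longrightarrow>
        ((\<lambda>\<alpha>. c \<alpha> * monomial V h \<alpha>) has_sum f (\<lambda>v. a v + h v) * g (\<lambda>v. a v + h v)) (exponents V)"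
    using r s by (intro exI[of _ "min r s"] conjI exI[of _ e]) auto
qed

lemma analytic_in_relabel:
  assumes "analytic_in V f" "bij \<sigma>"
  shows "analytic_in (\<sigma> ` V) (\<lambda>x. f (x \<circ> \<sigma>))"
proof (rule analytic_inI)
  have inj: "inj_on \<sigma> V" using assms(2) by (meson bij_is_inj inj_on_subset subset_UNIV)
  have inv: "\<sigma> (inv_into UNIV \<sigma> w) = w" "inv_into UNIV \<sigma> (\<sigma> v) = v" for v w
    using assms(2) by (simp_all add: bij_is_surj surj_f_inv_f bij_is_inj)
  have mem: "\<sigma> v \<in> \<sigma> ` V \<longleftrightarrow> v \<in> V" for v
    using assms(2) by (simp add: bij_is_inj inj_image_mem_iff)
  have bij: "bij_betw (\<lambda>\<beta>. \<beta> \<circ> \<sigma>) (exponents (\<sigma> ` V)) (exponents V)"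
  proof (rule bij_betwI[where g = "\<lambda>\<alpha>. \<alpha> \<circ> inv_into UNIV \<sigma>"])
    show "(\<lambda>\<beta>. \<beta> \<circ> \<sigma>) \<in> exponents (\<sigma> ` V) \<rightarrow> exponents V"
      by (simp add: Pi_def exponents_def mem)
    have "inv_into UNIV \<sigma> w \<notin> V" if "w \<notin> \<sigma> ` V" for w
      using that mem[of "inv_into UNIV \<sigma> w"] by (simp add: inv)
    then show "(\<lambda>\<alpha>. \<alpha> \<circ> inv_into UNIV \<sigma>) \<in> exponents V \<rightarrow> exponents (\<sigma> ` V)"
      by (simp add: Pi_def exponents_def)
  qed (simp_all add: fun_eq_iff inv)
  fix a :: "'b \<Rightarrow> real"
  obtain r c where exr: "expansion V f (a \<circ> \<sigma>) r c"
    by (rule analytic_inE[OF assms(1), of "a \<circ> \<sigma>"])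
  note r = expansionD(1)[OF exr] and c = expansionD(2)[OF exr]
  have "((\<lambda>\<beta>. c (\<beta> \<circ> \<sigma>) * monomial (\<sigma> ` V) h \<beta>) has_sum f ((\<lambda>v. a v + h v) \<circ> \<sigma>)) (exponents (\<sigma> ` V))"
    if h: "\<forall>v\<in>\<sigma> ` V. \<bar>h v\<bar> < r" for h
  proof -
    have "monomial (\<sigma> ` V) h \<beta> = monomial V (h \<circ> \<sigma>) (\<beta> \<circ> \<sigma>)" for \<beta>
      by (simp add: monomial_def prod.reindex[OF inj])
    moreover have "((\<lambda>\<alpha>. c \<alpha> * monomial V (h \<circ> \<sigma>) \<alpha>) has_sum f (\<lambda>v. (a \<circ> \<sigma>) v + (h \<circ> \<sigma>) v)) (exponents V)"
      by (rule c) (use h in auto)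
    then have "((\<lambda>\<beta>. c (\<beta> \<circ> \<sigma>) * monomial V (h \<circ> \<sigma>) (\<beta> \<circ> \<sigma>)) has_sum
        f (\<lambda>v. (a \<circ> \<sigma>) v + (h \<circ> \<sigma>) v)) (exponents (\<sigma> ` V))"
      by (subst has_sum_reindex_bij_betw[OF bij, of "\<lambda>\<alpha>. c \<alpha> * monomial V (h \<circ> \<sigma>) \<alpha>"])
    moreover have "(\<lambda>v. (a \<circ> \<sigma>) v + (h \<circ> \<sigma>) v) = (\<lambda>v. a v + h v) \<circ> \<sigma>"
      by (simp add: fun_eq_iff)
    ultimately show ?thesis by (simp only:)
  qed
  then show "\<exists>r>0. \<exists>c. \<forall>h. (\<forall>v\<in>\<sigma> ` V. \<bar>h v\<bar> < r) \<longrightarrow>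
        ((\<lambda>\<alpha>. c \<alpha> * monomial (\<sigma> ` V) h \<alpha>) has_sum f ((\<lambda>v. a v + h v) \<circ> \<sigma>)) (exponents (\<sigma> ` V))"
    using r by (intro exI[of _ r] conjI exI[of _ "\<lambda>\<beta>. c (\<beta> \<circ> \<sigma>)"] allI impI)
qed (use analytic_in_finite[OF assms(1)] in simp)

subsection \<open>Restriction to lines\<close>

lemma monomial_scale:
  assumes "finite V"
  shows "monomial V (\<lambda>v. t * b v) \<alpha> = monomial V b \<alpha> * t ^ (\<Sum>v\<in>V. \<alpha> v)"
  using assms by (simp add: monomial_def power_mult_distrib prod.distrib power_sum mult.commute)

lemma analytic_in_line:
  assumes "analytic_in V f"
  obtains r d where "r > 0"
    "\<And>t. \<bar>t - t0\<bar> < r \<Longrightarrow> (\<lambda>n. d n * (t - t0) ^ n) sums f (\<lambda>v. a v + t * b v)"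
proof -
  note fin = analytic_in_finite[OF assms]
  obtain r c where exr: "expansion V f (\<lambda>v. a v + t0 * b v) r c"
    by (rule analytic_inE[OF assms, of "\<lambda>v. a v + t0 * b v"])
  note r = expansionD(1)[OF exr] and c = expansionD(2)[OF exr]
  define B where "B = 1 + (\<Sum>v\<in>V. \<bar>b v\<bar>)"
  have B: "B > 0" "\<And>v. v \<in> V \<Longrightarrow> \<bar>b v\<bar> < B"
  proof -
    show "B > 0" unfolding B_def by (intro add_pos_nonneg sum_nonneg) auto
    fix v assume "v \<in> V"
    then have "\<bar>b v\<bar> \<le> (\<Sum>v\<in>V. \<bar>b v\<bar>)" by (intro member_le_sum) (auto simp: fin)
    then show "\<bar>b v\<bar> < B" by (simp add: B_def)
  qed
  define \<phi> where "\<phi> \<alpha> = (\<Sum>v\<in>V. \<alpha> v)" for \<alpha> :: "'a \<Rightarrow> nat"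
  define d where "d n = infsum (\<lambda>\<alpha>. c \<alpha> * monomial V b \<alpha>) {\<alpha>\<in>exponents V. \<phi> \<alpha> = n}" for n
  show thesis
  proof
    show "r / B > 0" using r B by simp
    fix t assume t: "\<bar>t - t0\<bar> < r / B"
    have h: "\<bar>(t - t0) * b v\<bar> < r" if "v \<in> V" for v
    proof -
      have "\<bar>(t - t0) * b v\<bar> \<le> \<bar>t - t0\<bar> * B"
        using B(2)[OF that] by (simp add: abs_mult mult_left_mono)
      also have "\<dots> < r" using t B(1) by (simp add: field_simps)
      finally show ?thesis .
    qed
    have "((\<lambda>\<alpha>. c \<alpha> * monomial V (\<lambda>v. (t - t0) * b v) \<alpha>) has_sum
        f (\<lambda>v. (a v + t0 * b v) + (t - t0) * b v)) (exponents V)"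
      by (rule c) (rule h)
    also have "(\<lambda>v. (a v + t0 * b v) + (t - t0) * b v) = (\<lambda>v. a v + t * b v)"
      by (simp add: algebra_simps)
    finally have "((\<lambda>n. infsum (\<lambda>\<alpha>. c \<alpha> * monomial V (\<lambda>v. (t - t0) * b v) \<alpha>) {\<alpha>\<in>exponents V. \<phi> \<alpha> = n}) has_sum
        f (\<lambda>v. a v + t * b v)) UNIV"
      by (rule has_sum_group) simp
    moreover have "infsum (\<lambda>\<alpha>. c \<alpha> * monomial V (\<lambda>v. (t - t0) * b v) \<alpha>) {\<alpha>\<in>exponents V. \<phi> \<alpha> = n}
        = d n * (t - t0) ^ n" for n
    proof -
      have "infsum (\<lambda>\<alpha>. c \<alpha> * monomial V (\<lambda>v. (t - t0) * b v) \<alpha>) {\<alpha>\<in>exponents V. \<phi> \<alpha> = n}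
          = infsum (\<lambda>\<alpha>. c \<alpha> * monomial V b \<alpha> * (t - t0) ^ n) {\<alpha>\<in>exponents V. \<phi> \<alpha> = n}"
        by (rule infsum_cong) (auto simp: monomial_scale[OF fin, of "t - t0" b] \<phi>_def)
      also have "\<dots> = d n * (t - t0) ^ n"
        unfolding d_def by (rule infsum_cmult_left')
      finally show ?thesis .
    qed
    ultimately have "((\<lambda>n. d n * (t - t0) ^ n) has_sum f (\<lambda>v. a v + t * b v)) UNIV"
      by (simp only:)
    then show "(\<lambda>n. d n * (t - t0) ^ n) sums f (\<lambda>v. a v + t * b v)"
      by (rule has_sum_imp_sums)
  qed
qed

lemma power_series_identity:
  fixes \<phi> :: "real \<Rightarrow> real"
  assumes ps: "\<And>t0. \<exists>r>0. \<exists>d. \<forall>t. \<bar>t - t0\<bar> < r \<longrightarrow> (\<lambda>n. d n * (t - t0) ^ n) sums \<phi> t"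
    and z: "\<forall>\<^sub>F t in nhds t1. \<phi> t = 0"
  shows "\<phi> t = 0"
proof -
  define S where "S = {s. \<forall>\<^sub>F t in nhds s. \<phi> t = 0}"
  have "open S"
    unfolding open_subopen[of S]
  proof
    fix s assume "s \<in> S"
    then obtain T where "open T" "s \<in> T" "\<forall>t\<in>T. \<phi> t = 0"
      unfolding S_def eventually_nhds by blast
    then show "\<exists>T. open T \<and> s \<in> T \<and> T \<subseteq> S"
      unfolding S_def eventually_nhds by blast
  qed
  moreover have "open (- S)"
    unfolding open_dist
  proof (intro ballI)
    fix s assume "s \<in> - S"
    then have sS: "s \<notin> S" by simp
    obtain r d where r: "r > 0" and d: "\<And>t. \<bar>t - s\<bar> < r \<Longrightarrow> (\<lambda>n. d n * (t - s) ^ n) sums \<phi> t"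
      using ps[of s] by blast
    have "\<exists>m. d m \<noteq> 0"
    proof (rule ccontr)
      assume "\<not> ?thesis"
      then have "(\<lambda>n. 0) sums \<phi> t" if "\<bar>t - s\<bar> < r" for t
        using d[OF that] by simp
      then have "\<phi> t = 0" if "\<bar>t - s\<bar> < r" for t
        using that sums_unique2[OF _ sums_zero] by blast
      then have "\<forall>\<^sub>F t in nhds s. \<phi> t = 0"
        unfolding eventually_nhds_metric using r by (intro exI[of _ r]) (auto simp: dist_real_def)
      with sS show False by (simp add: S_def)
    qed
    then obtain m where m: "d m \<noteq> 0" by blast
    define e where "e n = (case n of 0 \<Rightarrow> 0 | Suc k \<Rightarrow> d k)" for n
    obtain \<rho> where \<rho>: "\<rho> > 0" and nz: "\<And>t. t \<in> cball s \<rho> - {s} \<Longrightarrow> (t - s) * \<phi> t \<noteq> 0"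
    proof (rule powser_0_nonzero[of r s e "\<lambda>t. (t - s) * \<phi> t" "Suc m"])
      fix t :: real assume "norm (t - s) < r"
      then have "(\<lambda>n. (t - s) * (d n * (t - s) ^ n)) sums ((t - s) * \<phi> t)"
        by (intro sums_mult d) simp
      then have "(\<lambda>n. e (Suc n) * (t - s) ^ Suc n) sums ((t - s) * \<phi> t)"
        by (simp add: e_def mult_ac)
      then show "(\<lambda>n. e n * (t - s) ^ n) sums ((t - s) * \<phi> t)"
        by (subst (asm) sums_Suc_iff) (simp add: e_def)
    qed (use r m in \<open>auto simp: e_def\<close>)
    have nz': "\<phi> t \<noteq> 0" if "dist t s < \<rho>" "t \<noteq> s" for t
      using nz[of t] that by (auto simp: dist_commute)
    have "t \<notin> S" if "dist t s < \<rho>" for t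
    proof (cases "t = s")
      case False
      with nz'[OF that] show ?thesis by (auto simp: S_def dest: eventually_nhds_x_imp_x)
    qed (use sS in simp)
    then show "\<exists>\<rho>>0. \<forall>t. dist t s < \<rho> \<longrightarrow> t \<in> - S" using \<rho> by blast
  qed
  then have "closed S" by (simp add: closed_def)
  ultimately have "S = {} \<or> S = UNIV" using clopen[of S] \<open>open S\<close> by blast
  moreover have "t1 \<in> S" using z by (simp add: S_def)
  ultimately have "t \<in> S" by blast
  then show ?thesis by (auto simp: S_def dest: eventually_nhds_x_imp_x)
qed

subsection \<open>Partial derivatives\<close>

lemma polynomial_geometric_bound:
  fixes q \<rho> :: real
  assumes "0 \<le> q" "q < \<rho>"
  shows "\<exists>K\<ge>0. \<forall>k. real (Suc k) * q ^ k \<le> K * \<rho> ^ Suc k"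
proof -
  have \<rho>: "\<rho> > 0" using assms by simp
  define p where "p = q / \<rho>"
  have p: "0 \<le> p" "p < 1" using assms \<rho> by (auto simp: p_def)
  have "(\<lambda>n. of_nat n * p ^ n) \<longlonglongrightarrow> 0"
    using p by (intro powser_times_n_limit_0) auto
  then have "Bseq (\<lambda>n. of_nat n * p ^ n)" by (intro convergent_imp_Bseq convergentI)
  then obtain B where B: "\<And>n. norm (of_nat n * p ^ n) \<le> B" by (auto simp: Bseq_def)
  have B': "of_nat n * p ^ n \<le> B" for n
    using B[of n] by (metis abs_le_D1 real_norm_def)
  have "B \<ge> 0" using B'[of 0] by simp
  have "real (Suc k) * q ^ k \<le> ((B + 1) / \<rho>) * \<rho> ^ Suc k" for k
  proof -
    have "real (Suc k) * p ^ k = of_nat k * p ^ k + p ^ k" by (simp add: algebra_simps)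
    also have "\<dots> \<le> B + 1" using p by (intro add_mono B' power_le_one) auto
    finally have "real (Suc k) * p ^ k * \<rho> ^ k \<le> (B + 1) * \<rho> ^ k"
      using \<rho> by (intro mult_right_mono) auto
    moreover have "real (Suc k) * p ^ k * \<rho> ^ k = real (Suc k) * q ^ k"
      using \<rho> by (simp add: p_def power_divide)
    moreover have "(B + 1) * \<rho> ^ k = ((B + 1) / \<rho>) * \<rho> ^ Suc k" using \<rho> by simp
    ultimately show ?thesis by (simp only:)
  qed
  moreover have "(B + 1) / \<rho> \<ge> 0" using \<open>B \<ge> 0\<close> \<rho> by simp
  ultimately show ?thesis by blast
qed

lemma monomial_split:
  assumes "finite V" "v \<in> V"
  shows "monomial V h \<alpha> = h v ^ \<alpha> v * monomial (V - {v}) h \<alpha>"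
  using assms by (simp add: monomial_def prod.remove)

lemma analytic_in_partial:
  assumes f: "analytic_in V f" and v: "v \<in> V"
  shows "analytic_in V (\<lambda>x. deriv (\<lambda>t. f (x(v := t))) (x v))"
proof (rule analytic_inI[OF analytic_in_finite[OF f]])
  note fin = analytic_in_finite[OF f]
  fix a
  obtain r c where exr: "expansion V f a r c"
    by (rule analytic_inE[OF f, of a])
  note r = expansionD(1)[OF exr] and c = expansionD(2)[OF exr]
  define sh where "sh \<beta> = \<beta>(v := Suc (\<beta> v))" for \<beta> :: "'a \<Rightarrow> nat"
  define d where "d \<beta> = real (Suc (\<beta> v)) * c (sh \<beta>)" for \<beta>
  define lev where "lev k = {\<alpha> \<in> exponents V. \<alpha> v = k}" for k
  have sh_mem: "sh \<beta> \<in> exponents V" if "\<beta> \<in> exponents V" for \<beta>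
    using that v by (auto simp: exponents_def sh_def)
  have sh_inj: "inj sh"
  proof (rule injI)
    fix \<alpha> \<beta> assume *: "sh \<alpha> = sh \<beta>"
    show "\<alpha> = \<beta>"
    proof
      fix w show "\<alpha> w = \<beta> w"
        using fun_cong[OF *, of w] by (cases "w = v") (auto simp: sh_def)
    qed
  qed
  have sh_lev: "bij_betw sh (lev k) (lev (Suc k))" for k
  proof (rule bij_betwI[where g = "\<lambda>\<alpha>. \<alpha>(v := \<alpha> v - 1)"])
    show "sh \<in> lev k \<rightarrow> lev (Suc k)"
      using sh_mem by (auto simp: lev_def) (simp add: sh_def)
    show "(\<lambda>\<alpha>. \<alpha>(v := \<alpha> v - 1)) \<in> lev (Suc k) \<rightarrow> lev k"
      by (auto simp: lev_def exponents_def)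
    show "(sh \<beta>)(v := sh \<beta> v - 1) = \<beta>" for \<beta> by (simp add: sh_def)
    show "sh (\<alpha>(v := \<alpha> v - 1)) = \<alpha>" if "\<alpha> \<in> lev (Suc k)" for \<alpha>
      using that by (auto simp: sh_def lev_def)
  qed
  have main: "((\<lambda>\<beta>. d \<beta> * monomial V h \<beta>) has_sum
      deriv (\<lambda>t. f ((\<lambda>w. a w + h w)(v := t))) (a v + h v)) (exponents V)"
    if h: "\<forall>w\<in>V. \<bar>h w\<bar> < r" for h
  proof -
    define x where "x = (\<lambda>w. a w + h w)"
    define m where "m \<alpha> = monomial (V - {v}) h \<alpha>" for \<alpha>
    define D where "D k = infsum (\<lambda>\<alpha>. c \<alpha> * m \<alpha>) (lev k)" for k
    have m_sh: "m (sh \<beta>) = m \<beta>" for \<beta>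
      unfolding m_def monomial_def by (rule prod.cong) (auto simp: sh_def)
    have mon: "monomial V (h(v := t)) \<alpha> = t ^ \<alpha> v * m \<alpha>" for t \<alpha>
    proof -
      have "monomial (V - {v}) (h(v := t)) \<alpha> = m \<alpha>"
        unfolding m_def by (rule monomial_cong) auto
      then show ?thesis by (simp add: monomial_split[OF fin v])
    qed
    have slice: "((\<lambda>\<alpha>. c \<alpha> * (t ^ \<alpha> v * m \<alpha>)) has_sum f (x(v := a v + t))) (exponents V)"
      if "\<bar>t\<bar> < r" for t
    proof -
      have "(\<lambda>w. a w + (h(v := t)) w) = x(v := a v + t)" by (auto simp: x_def)
      moreover have "((\<lambda>\<alpha>. c \<alpha> * monomial V (h(v := t)) \<alpha>) has_sum f (\<lambda>w. a w + (h(v := t)) w)) (exponents V)"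
        by (rule c) (use h that in auto)
      ultimately show ?thesis by (simp only: mon)
    qed
    have ps: "(\<lambda>k. D k * t ^ k) sums f (x(v := a v + t))" if "\<bar>t\<bar> < r" for t
    proof -
      have "((\<lambda>k. infsum (\<lambda>\<alpha>. c \<alpha> * (t ^ \<alpha> v * m \<alpha>)) (lev k)) has_sum f (x(v := a v + t))) UNIV"
        unfolding lev_def by (rule has_sum_group[OF slice[OF that]]) simp
      moreover have "infsum (\<lambda>\<alpha>. c \<alpha> * (t ^ \<alpha> v * m \<alpha>)) (lev k) = D k * t ^ k" for k
      proof -
        have "infsum (\<lambda>\<alpha>. c \<alpha> * (t ^ \<alpha> v * m \<alpha>)) (lev k) = infsum (\<lambda>\<alpha>. c \<alpha> * m \<alpha> * t ^ k) (lev k)"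
          by (rule infsum_cong) (simp add: lev_def)
        also have "\<dots> = D k * t ^ k" unfolding D_def by (rule infsum_cmult_left')
        finally show ?thesis .
      qed
      ultimately have "((\<lambda>k. D k * t ^ k) has_sum f (x(v := a v + t))) UNIV" by (simp only:)
      then show ?thesis by (rule has_sum_imp_sums)
    qed
    have hv: "\<bar>h v\<bar> < r" using h v by blast
    define S where "S = (\<Sum>n. diffs D n * h v ^ n)"
    have "((\<lambda>t. \<Sum>n. D n * t ^ n) has_real_derivative S) (at (h v))"
      unfolding S_def by (rule termdiffs_strong'[of r]) (use ps hv in \<open>auto simp: sums_iff\<close>)
    then have der: "((\<lambda>t. f (x(v := a v + t))) has_real_derivative S) (at (h v))"
    proof (rule has_field_derivative_transform_within_open)
      show "open (ball 0 r)" "h v \<in> ball (0::real) r" using hv by auto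
      show "(\<Sum>n. D n * t ^ n) = f (x(v := a v + t))" if "t \<in> ball 0 r" for t
        using ps[of t] that by (simp add: sums_iff)
    qed
    have S: "(\<lambda>n. diffs D n * h v ^ n) sums S"
      by (rule termdiffs_sums_strong[OF _ der, of r]) (use ps hv in auto)
    have "((\<lambda>t. f (x(v := t))) has_real_derivative S) (at (a v + h v))"
      using der DERIV_shift[of "\<lambda>t. f (x(v := t))" S "h v" "a v"] by (simp add: add.commute)
    then have dS: "deriv (\<lambda>t. f (x(v := t))) (a v + h v) = S" by (rule DERIV_imp_deriv)

    define E where "E \<beta> = d \<beta> * monomial V h \<beta>" for \<beta>
    have E: "E \<beta> = real (Suc (\<beta> v)) * h v ^ \<beta> v * (c (sh \<beta>) * m \<beta>)" for \<beta>
      by (simp add: E_def d_def monomial_split[OF fin v] m_def)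
    define \<rho> where "\<rho> = (\<bar>h v\<bar> + r) / 2"
    have \<rho>: "\<bar>h v\<bar> < \<rho>" "\<rho> < r" "\<rho> > 0" using hv r by (auto simp: \<rho>_def)
    have "\<exists>K\<ge>0. \<forall>k. real (Suc k) * \<bar>h v\<bar> ^ k \<le> K * \<rho> ^ Suc k"
      by (rule polynomial_geometric_bound[OF abs_ge_zero \<rho>(1)])
    then obtain K where K: "\<forall>k. real (Suc k) * \<bar>h v\<bar> ^ k \<le> K * \<rho> ^ Suc k" by (elim exE conjE)
    have "(\<lambda>\<alpha>. c \<alpha> * (\<rho> ^ \<alpha> v * m \<alpha>)) summable_on exponents V"
      by (rule has_sum_imp_summable[OF slice]) (use \<rho> in auto)
    then have "(\<lambda>\<alpha>. norm (c \<alpha> * (\<rho> ^ \<alpha> v * m \<alpha>))) summable_on exponents V"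
      by (subst (asm) summable_on_iff_abs_summable_on_real)
    then have "(\<lambda>\<alpha>. norm (c \<alpha> * (\<rho> ^ \<alpha> v * m \<alpha>))) summable_on (sh ` exponents V)"
      by (rule summable_on_subset_banach) (use sh_mem in blast)
    then have "((\<lambda>\<alpha>. norm (c \<alpha> * (\<rho> ^ \<alpha> v * m \<alpha>))) \<circ> sh) summable_on exponents V"
      using sh_inj by (subst (asm) summable_on_reindex) (auto intro: inj_on_subset)
    moreover have "sh \<beta> v = Suc (\<beta> v)" for \<beta> by (simp add: sh_def)
    ultimately have "(\<lambda>\<beta>. norm (c (sh \<beta>) * (\<rho> ^ Suc (\<beta> v) * m \<beta>))) summable_on exponents V"
      by (simp only: comp_def m_sh)
    then have sm: "(\<lambda>\<beta>. K * norm (c (sh \<beta>) * (\<rho> ^ Suc (\<beta> v) * m \<beta>))) summable_on exponents V"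
      by (rule summable_on_cmult_right)
    have le: "norm (E \<beta>) \<le> K * norm (c (sh \<beta>) * (\<rho> ^ Suc (\<beta> v) * m \<beta>))" for \<beta>
    proof -
      have "norm (E \<beta>) = (real (Suc (\<beta> v)) * \<bar>h v\<bar> ^ \<beta> v) * \<bar>c (sh \<beta>) * m \<beta>\<bar>"
        by (simp add: E abs_mult power_abs)
      also have "\<dots> \<le> (K * \<rho> ^ Suc (\<beta> v)) * \<bar>c (sh \<beta>) * m \<beta>\<bar>"
        by (intro mult_right_mono K[rule_format]) auto
      also have "\<dots> = K * norm (c (sh \<beta>) * (\<rho> ^ Suc (\<beta> v) * m \<beta>))"
        using \<rho>(3) by (simp add: abs_mult power_abs)
      finally show ?thesis .
    qed
    have "(\<lambda>\<beta>. norm (E \<beta>)) summable_on exponents V"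
      by (rule summable_on_comparison_test[OF sm]) (use le in auto)
    then have "E summable_on exponents V" by (rule abs_summable_summable)
    then have T: "(E has_sum infsum E (exponents V)) (exponents V)" by (rule has_sum_infsum)
    have "((\<lambda>k. infsum E (lev k)) has_sum infsum E (exponents V)) UNIV"
      unfolding lev_def by (rule has_sum_group[OF T]) simp
    moreover have "infsum E (lev k) = diffs D k * h v ^ k" for k
    proof -
      have "infsum E (lev k) = infsum (\<lambda>\<beta>. real (Suc k) * h v ^ k * (c (sh \<beta>) * m (sh \<beta>))) (lev k)"
        by (rule infsum_cong) (simp add: E m_sh lev_def)
      also have "\<dots> = real (Suc k) * h v ^ k * infsum (\<lambda>\<beta>. c (sh \<beta>) * m (sh \<beta>)) (lev k)"
        by (rule infsum_cmult_right')
      also have "infsum (\<lambda>\<beta>. c (sh \<beta>) * m (sh \<beta>)) (lev k) = D (Suc k)"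
        unfolding D_def by (rule infsum_reindex_bij_betw[OF sh_lev])
      finally show ?thesis by (simp add: diffs_def)
    qed
    ultimately have "((\<lambda>k. diffs D k * h v ^ k) has_sum infsum E (exponents V)) UNIV" by (simp only:)
    then have "(\<lambda>k. diffs D k * h v ^ k) sums infsum E (exponents V)" by (rule has_sum_imp_sums)
    with S have "infsum E (exponents V) = S" by (rule sums_unique2[symmetric])
    with T show ?thesis by (simp only: dS[symmetric] x_def E_def[abs_def])
  qed
  show "\<exists>r>0. \<exists>c. \<forall>h. (\<forall>w\<in>V. \<bar>h w\<bar> < r) \<longrightarrow>
        ((\<lambda>\<alpha>. c \<alpha> * monomial V h \<alpha>) has_sum
          deriv (\<lambda>t. f ((\<lambda>w. a w + h w)(v := t))) (a v + h v)) (exponents V)"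
    by (intro exI[of _ r] conjI r exI[of _ d] allI impI main)
qed

subsection \<open>The integral domain of analytic functions and its quotient field\<close>

definition real_analytic :: "(('v \<Rightarrow> real) \<Rightarrow> real) \<Rightarrow> bool" where
  "real_analytic f \<longleftrightarrow> (\<exists>V. analytic_in V f)"

lemma real_analytic_common:
  assumes "real_analytic f" "real_analytic g"
  obtains V where "analytic_in V f" "analytic_in V g"
proof -
  from assms obtain V W where VW: "analytic_in V f" "analytic_in W g"
    by (auto simp: real_analytic_def)
  then have fin: "finite (V \<union> W)" by (simp add: analytic_in_finite)
  show ?thesis
    by (rule that[of "V \<union> W"]) (auto intro!: analytic_in_mono[OF VW(1)] analytic_in_mono[OF VW(2)] fin[simplified])
qed

lemma real_analytic_const: "real_analytic (\<lambda>x. k)"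
  unfolding real_analytic_def by (rule exI, rule analytic_in_const)

lemma real_analytic_var: "real_analytic (\<lambda>x. x v)"
  unfolding real_analytic_def by (rule exI, rule analytic_in_var)

lemma real_analytic_add: "real_analytic f \<Longrightarrow> real_analytic g \<Longrightarrow> real_analytic (\<lambda>x. f x + g x)"
  by (erule (1) real_analytic_common) (auto simp: real_analytic_def intro: analytic_in_add)

lemma real_analytic_mult: "real_analytic f \<Longrightarrow> real_analytic g \<Longrightarrow> real_analytic (\<lambda>x. f x * g x)"
  by (erule (1) real_analytic_common) (auto simp: real_analytic_def intro: analytic_in_mult)

lemma real_analytic_uminus: "real_analytic f \<Longrightarrow> real_analytic (\<lambda>x. - f x)"
  using real_analytic_mult[OF real_analytic_const[of "-1"]] by simp

lemma real_analytic_diff: "real_analytic f \<Longrightarrow> real_analytic g \<Longrightarrow> real_analytic (\<lambda>x. f x - g x)"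
  using real_analytic_add[OF _ real_analytic_uminus] by simp

lemma real_analytic_relabel: "real_analytic f \<Longrightarrow> bij \<sigma> \<Longrightarrow> real_analytic (\<lambda>x. f (x \<circ> \<sigma>))"
  unfolding real_analytic_def by (erule exE, rule exI, rule analytic_in_relabel)

lemma real_analytic_partial:
  assumes "real_analytic f"
  shows "real_analytic (\<lambda>x. deriv (\<lambda>t. f (x(v := t))) (x v))"
proof -
  from assms obtain V where V: "analytic_in V f" by (auto simp: real_analytic_def)
  then have "analytic_in (insert v V) f"
    by (rule analytic_in_mono) (use analytic_in_finite[OF V] in auto)
  from analytic_in_partial[OF this, of v] show ?thesis
    unfolding real_analytic_def by (intro exI) simp
qed

lemma real_analytic_no_zero_divisors:
  assumes "real_analytic f" "real_analytic g" and fg: "\<And>x. f x * g x = 0" and a: "f a \<noteq> 0"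
  shows "g b = 0"
proof -
  obtain V where V: "analytic_in V f" "analytic_in V g"
    using real_analytic_common[OF assms(1,2)] .
  define \<phi> where "\<phi> t = f (\<lambda>v. a v + t * (b v - a v))" for t
  define \<psi> where "\<psi> t = g (\<lambda>v. a v + t * (b v - a v))" for t
  have ps: "\<exists>r>0. \<exists>d. \<forall>t. \<bar>t - t0\<bar> < r \<longrightarrow> (\<lambda>n. d n * (t - t0) ^ n) sums F (\<lambda>v. a v + t * (b v - a v))"
    if "analytic_in V F" for F t0
    using analytic_in_line[OF that, of t0 a "\<lambda>v. b v - a v"] by metis
  obtain r d where r: "r > 0" and d: "\<forall>t. \<bar>t - 0\<bar> < r \<longrightarrow> (\<lambda>n. d n * (t - 0) ^ n) sums \<phi> t"
    using ps[OF V(1), of 0] unfolding \<phi>_def by blast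
  have "isCont (\<lambda>t. \<Sum>n. d n * t ^ n) 0"
  proof (rule isCont_powser)
    show "summable (\<lambda>n. d n * (r / 2) ^ n)" using d[rule_format, of "r / 2"] r by (auto simp: sums_iff)
  qed (use r in auto)
  then have lim: "((\<lambda>t. \<Sum>n. d n * t ^ n) \<longlongrightarrow> (\<Sum>n. d n * 0 ^ n)) (at 0)"
    by (simp only: isCont_def)
  have ne: "(\<Sum>n. d n * 0 ^ n) \<noteq> 0"
    using d[rule_format, of 0] r a by (auto simp: sums_iff \<phi>_def)
  have "\<forall>\<^sub>F t in nhds 0. (\<Sum>n. d n * t ^ n) \<noteq> 0"
    unfolding eventually_nhds_conv_at
    using tendsto_imp_eventually_ne[OF lim ne] ne by (rule conjI)
  moreover have "\<forall>\<^sub>F t in nhds 0. \<bar>t\<bar> < r"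
    unfolding eventually_nhds_metric using r by (intro exI[of _ r]) (auto simp: dist_real_def)
  ultimately have "\<forall>\<^sub>F t in nhds 0. \<psi> t = 0"
  proof eventually_elim
    case (elim t)
    then have "\<phi> t \<noteq> 0" using d[rule_format, of t] by (auto simp: sums_iff)
    then show "\<psi> t = 0" using fg unfolding \<phi>_def \<psi>_def by (metis mult_eq_0_iff)
  qed
  moreover have "\<And>t0. \<exists>r>0. \<exists>d. \<forall>t. \<bar>t - t0\<bar> < r \<longrightarrow> (\<lambda>n. d n * (t - t0) ^ n) sums \<psi> t"
    using ps[OF V(2)] unfolding \<psi>_def .
  ultimately have "\<psi> 1 = 0" by (rule power_series_identity[rotated])
  then show ?thesis by (simp add: \<psi>_def)
qed

typedef 'v analytic_fun = "{f :: ('v \<Rightarrow> real) \<Rightarrow> real. real_analytic f}"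
  morphisms evaluate Analytic_Fun
  using real_analytic_const[of 0] by blast

setup_lifting type_definition_analytic_fun

instantiation analytic_fun :: (type) idom
begin

lift_definition zero_analytic_fun :: "'a analytic_fun" is "\<lambda>x. 0" by (rule real_analytic_const)
lift_definition one_analytic_fun :: "'a analytic_fun" is "\<lambda>x. 1" by (rule real_analytic_const)
lift_definition plus_analytic_fun :: "'a analytic_fun \<Rightarrow> 'a analytic_fun \<Rightarrow> 'a analytic_fun"
  is "\<lambda>f g x. f x + g x" by (rule real_analytic_add)
lift_definition times_analytic_fun :: "'a analytic_fun \<Rightarrow> 'a analytic_fun \<Rightarrow> 'a analytic_fun"
  is "\<lambda>f g x. f x * g x" by (rule real_analytic_mult)
lift_definition uminus_analytic_fun :: "'a analytic_fun \<Rightarrow> 'a analytic_fun"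
  is "\<lambda>f x. - f x" by (rule real_analytic_uminus)
lift_definition minus_analytic_fun :: "'a analytic_fun \<Rightarrow> 'a analytic_fun \<Rightarrow> 'a analytic_fun"
  is "\<lambda>f g x. f x - g x" by (rule real_analytic_diff)

instance
proof
  fix F G :: "'a analytic_fun"
  show "F * G \<noteq> 0" if "F \<noteq> 0" "G \<noteq> 0"
    using that
  proof transfer
    fix f g :: "('a \<Rightarrow> real) \<Rightarrow> real"
    assume an: "real_analytic f" "real_analytic g" and f: "f \<noteq> (\<lambda>x. 0)" and g: "g \<noteq> (\<lambda>x. 0)"
    from f obtain a where a: "f a \<noteq> 0" by (auto simp: fun_eq_iff)
    show "(\<lambda>x. f x * g x) \<noteq> (\<lambda>x. 0)"
    proof
      assume "(\<lambda>x. f x * g x) = (\<lambda>x. 0)"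
      then have "g b = 0" for b
        using real_analytic_no_zero_divisors[OF an _ a] by (auto simp: fun_eq_iff)
      with g show False by (auto simp: fun_eq_iff)
    qed
  qed
qed (transfer; simp add: algebra_simps fun_eq_iff)+

end

lift_definition const_fn :: "real \<Rightarrow> 'v analytic_fun" is "\<lambda>k x. k"
  by (rule real_analytic_const)

lift_definition coord_fn :: "'v \<Rightarrow> 'v analytic_fun" is "\<lambda>v x. x v"
  by (rule real_analytic_var)

lift_definition partial_deriv :: "'v \<Rightarrow> 'v analytic_fun \<Rightarrow> 'v analytic_fun"
  is "\<lambda>v f x. deriv (\<lambda>t. f (x(v := t))) (x v)"
  by (rule real_analytic_partial)

lemma finite_partial_deriv_nonzero: "finite {v. partial_deriv v F \<noteq> 0}"
proof (transfer)
  fix f :: "('a \<Rightarrow> real) \<Rightarrow> real" assume "real_analytic f"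
  then obtain V where V: "analytic_in V f" by (auto simp: real_analytic_def)
  have "(\<lambda>x. deriv (\<lambda>t. f (x(v := t))) (x v)) = (\<lambda>x. 0)" if "v \<notin> V" for v
  proof
    fix x
    have "f (x(v := t)) = f x" for t
      by (rule analytic_in_cong[OF V]) (use that in auto)
    then show "deriv (\<lambda>t. f (x(v := t))) (x v) = 0" by simp
  qed
  then have "{v. (\<lambda>x. deriv (\<lambda>t. f (x(v := t))) (x v)) \<noteq> (\<lambda>x. 0)} \<subseteq> V" by blast
  then show "finite {v. (\<lambda>x. deriv (\<lambda>t. f (x(v := t))) (x v)) \<noteq> (\<lambda>x. 0)}"
    using analytic_in_finite[OF V] finite_subset by blast
qed

text \<open>
  Variables \<open>(i, k)\<close> stand for the \<open>k\<close>-th derivative of the scheduling component \<open>p\<^sub>i\<close> in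
  continuous time (\<open>k :: nat\<close>), and for its \<open>k\<close>-step shift, i.e. \<open>p\<^sub>i(t + k)\<close>, in discrete time
  (\<open>k :: int\<close>). The operators below are only needed on analytic functions, because all matrices
  they are applied to have analytic (in fact polynomial) entries.

  In \<open>time_deriv\<close>, \<open>d/dt F = (\<Sum>v. \<partial>F/\<partial>v * dv/dt)\<close>; by \<open>finite_partial_deriv_nonzero\<close>
  only finitely many terms are non-zero.
\<close>

definition time_deriv :: "('i \<times> nat) analytic_fun \<Rightarrow> ('i \<times> nat) analytic_fun" where
  "time_deriv F = (\<Sum>v | partial_deriv v F \<noteq> 0. partial_deriv v F * coord_fn (fst v, Suc (snd v)))"

lift_definition time_shift :: "int \<Rightarrow> ('i \<times> int) analytic_fun \<Rightarrow> ('i \<times> int) analytic_fun"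
  is "\<lambda>s f x. f (x \<circ> (\<lambda>(i, k). (i, k + s)))"
proof (rule real_analytic_relabel)
  show "bij (\<lambda>(i, k). (i, k + s))" for s :: int
    by (rule o_bij[where g = "\<lambda>(i, k). (i, k - s)"]) (auto simp: fun_eq_iff)
qed

type_synonym 'v meromorphic = "'v analytic_fun fract"

definition meromorphic_rank :: "'v analytic_fun mat \<Rightarrow> nat" where
  "meromorphic_rank M = vec_space.rank (dim_row M) (map_mat (\<lambda>F. Fract F 1 :: 'v meromorphic) M)"


section \<open>LPV-SSA representations\<close>

text \<open>
  The index \<open>None\<close> plays the role of 0 and \<open>Some i\<close> that of the \<open>i\<close>-th scheduling component.
  The scheduling set is the same for all representations under consideration and is passed separately.
\<close>

record 'p lpv_ssa =
  state_dim :: nat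
  A_coeff :: "'p option \<Rightarrow> real mat"
  B_coeff :: "'p option \<Rightarrow> real mat"
  C_coeff :: "'p option \<Rightarrow> real mat"

definition is_lpv_ssa :: "nat \<Rightarrow> nat \<Rightarrow> 'p::finite lpv_ssa \<Rightarrow> bool" where
  "is_lpv_ssa nu ny \<Sigma> \<longleftrightarrow>
     (\<forall>i. A_coeff \<Sigma> i \<in> carrier_mat (state_dim \<Sigma>) (state_dim \<Sigma>) \<and>
          B_coeff \<Sigma> i \<in> carrier_mat (state_dim \<Sigma>) nu \<and>
          C_coeff \<Sigma> i \<in> carrier_mat ny (state_dim \<Sigma>))"

definition affine_mat :: "('p::finite option \<Rightarrow> real mat) \<Rightarrow> real ^ 'p \<Rightarrow> real mat" where
  "affine_mat M q = Matrix.mat (dim_row (M None)) (dim_col (M None))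
     (\<lambda>(j, k). M None $$ (j, k) + (\<Sum>i\<in>UNIV. M (Some i) $$ (j, k) * vec_nth q i))"

definition symbolic_mat :: "('p::finite option \<Rightarrow> real mat) \<Rightarrow> ('p \<times> 'k::zero) analytic_fun mat" where
  "symbolic_mat M = Matrix.mat (dim_row (M None)) (dim_col (M None))
     (\<lambda>(j, k). const_fn (M None $$ (j, k)) +
        (\<Sum>i\<in>UNIV. const_fn (M (Some i) $$ (j, k)) * coord_fn (i, 0)))"


section \<open>Continuous time\<close>

definition piecewise_continuous :: "(real \<Rightarrow> 'a::topological_space) \<Rightarrow> bool" where
  "piecewise_continuous f \<longleftrightarrow>
     (\<forall>T\<ge>0. finite {t \<in> {0..T}. \<not> continuous (at t within {0..}) f}) \<and>
     (\<forall>t\<ge>0. \<not> continuous (at t within {0..}) f \<longrightarrow>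
        (\<exists>l. (f \<longlongrightarrow> l) (at_right t)) \<and> (t > 0 \<longrightarrow> (\<exists>l. (f \<longlongrightarrow> l) (at_left t))))"

definition ct_inputs :: "nat \<Rightarrow> (real \<Rightarrow> real Matrix.vec) set" where
  "ct_inputs nu = {u. (\<forall>t\<ge>0. u t \<in> carrier_vec nu) \<and> (\<forall>i<nu. piecewise_continuous (\<lambda>t. vec_index (u t) i))}"

definition ct_schedulings :: "(real ^ 'p::finite) set \<Rightarrow> (real \<Rightarrow> real ^ 'p) set" where
  "ct_schedulings P = {p. (\<forall>t\<ge>0. p t \<in> P) \<and> piecewise_continuous p}"

definition absolutely_continuous_on :: "real \<Rightarrow> real \<Rightarrow> (real \<Rightarrow> real) \<Rightarrow> bool" where
  "absolutely_continuous_on a b f \<longleftrightarrow>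
     (\<forall>\<epsilon>>0. \<exists>\<delta>>0. \<forall>D. finite D \<and> (\<forall>(s, t)\<in>D. a \<le> s \<and> s \<le> t \<and> t \<le> b) \<and>
        (\<forall>I\<in>D. \<forall>J\<in>D. I \<noteq> J \<longrightarrow> {fst I<..<snd I} \<inter> {fst J<..<snd J} = {}) \<and>
        (\<Sum>(s, t)\<in>D. t - s) < \<delta> \<longrightarrow> (\<Sum>(s, t)\<in>D. \<bar>f t - f s\<bar>) < \<epsilon>)"

text \<open>
  Trajectories are functions on \<open>[0,\<infinity>)\<close>; membership in \<open>extensional {0..}\<close> fixes the irrelevant
  values at negative times, so that the trajectory is unique.
\<close>

definition ct_is_trajectory ::
    "'p::finite lpv_ssa \<Rightarrow> real Matrix.vec \<Rightarrow> (real \<Rightarrow> real Matrix.vec) \<Rightarrow> (real \<Rightarrow> real ^ 'p) \<Rightarrow>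
     (real \<Rightarrow> real Matrix.vec) \<Rightarrow> bool" where
  "ct_is_trajectory \<Sigma> x\<^sub>0 u p x \<longleftrightarrow>
     x \<in> extensional {0..} \<and> (\<forall>t\<ge>0. x t \<in> carrier_vec (state_dim \<Sigma>)) \<and> x 0 = x\<^sub>0 \<and>
     (\<forall>i<state_dim \<Sigma>.
        (\<forall>T\<ge>0. absolutely_continuous_on 0 T (\<lambda>t. vec_index (x t) i)) \<and>
        (AE t in lebesgue. t > 0 \<longrightarrow>
           ((\<lambda>s. vec_index (x s) i) has_real_derivative
              vec_index (affine_mat (A_coeff \<Sigma>) (p t) *\<^sub>v x t + affine_mat (B_coeff \<Sigma>) (p t) *\<^sub>v u t) i) (at t)))"

definition ct_state ::
    "'p::finite lpv_ssa \<Rightarrow> real Matrix.vec \<Rightarrow> (real \<Rightarrow> real Matrix.vec) \<Rightarrow> (real \<Rightarrow> real ^ 'p) \<Rightarrow>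
     real \<Rightarrow> real Matrix.vec" where
  "ct_state \<Sigma> x\<^sub>0 u p = (THE x. ct_is_trajectory \<Sigma> x\<^sub>0 u p x)"

definition ct_io_map ::
    "nat \<Rightarrow> (real ^ 'p::finite) set \<Rightarrow> 'p lpv_ssa \<Rightarrow> real Matrix.vec \<Rightarrow>
     (real \<Rightarrow> real Matrix.vec) \<times> (real \<Rightarrow> real ^ 'p) \<Rightarrow> real \<Rightarrow> real Matrix.vec" where
  "ct_io_map nu P \<Sigma> x\<^sub>0 =
     (\<lambda>(u, p) \<in> ct_inputs nu \<times> ct_schedulings P.
        \<lambda>t \<in> {0..}. affine_mat (C_coeff \<Sigma>) (p t) *\<^sub>v ct_state \<Sigma> x\<^sub>0 u p t)"

definition ct_minimal ::
    "nat \<Rightarrow> nat \<Rightarrow> (real ^ 'p::finite) set \<Rightarrow> 'p lpv_ssa \<Rightarrow> real Matrix.vec \<Rightarrow> bool" where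
  "ct_minimal nu ny P \<Sigma> x\<^sub>0 \<longleftrightarrow>
     (\<forall>\<Sigma>' x\<^sub>0'. is_lpv_ssa nu ny \<Sigma>' \<and> x\<^sub>0' \<in> carrier_vec (state_dim \<Sigma>') \<and>
        ct_io_map nu P \<Sigma>' x\<^sub>0' = ct_io_map nu P \<Sigma> x\<^sub>0 \<longrightarrow> state_dim \<Sigma> \<le> state_dim \<Sigma>')"

definition ct_regularity_certificate :: "(real ^ 'p::finite) set \<Rightarrow> bool" where
  "ct_regularity_certificate P \<longleftrightarrow> convex P \<and> interior P \<noteq> {}"

text \<open>The blocks \<open>o\<^sub>j\<close> and \<open>r\<^sub>j\<close> are counted from 0.\<close>

primrec ct_obs_block :: "'p::finite lpv_ssa \<Rightarrow> nat \<Rightarrow> ('p \<times> nat) analytic_fun mat" where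
  "ct_obs_block \<Sigma> 0 = symbolic_mat (C_coeff \<Sigma>)"
| "ct_obs_block \<Sigma> (Suc j) =
     map_mat time_deriv (ct_obs_block \<Sigma> j) + ct_obs_block \<Sigma> j * symbolic_mat (A_coeff \<Sigma>)"

primrec ct_reach_block :: "'p::finite lpv_ssa \<Rightarrow> nat \<Rightarrow> ('p \<times> nat) analytic_fun mat" where
  "ct_reach_block \<Sigma> 0 = symbolic_mat (B_coeff \<Sigma>)"
| "ct_reach_block \<Sigma> (Suc j) =
     - map_mat time_deriv (ct_reach_block \<Sigma> j) + symbolic_mat (A_coeff \<Sigma>) * ct_reach_block \<Sigma> j"

definition ct_structurally_observable :: "'p::finite lpv_ssa \<Rightarrow> bool" where
  "ct_structurally_observable \<Sigma> \<longleftrightarrow>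
     meromorphic_rank (mat_of_rows (state_dim \<Sigma>)
       (concat (map (\<lambda>j. Matrix.rows (ct_obs_block \<Sigma> j)) [0..<state_dim \<Sigma>]))) = state_dim \<Sigma>"

definition ct_structurally_reachable :: "'p::finite lpv_ssa \<Rightarrow> bool" where
  "ct_structurally_reachable \<Sigma> \<longleftrightarrow>
     meromorphic_rank (mat_of_cols (state_dim \<Sigma>)
       (concat (map (\<lambda>j. cols (ct_reach_block \<Sigma> j)) [0..<state_dim \<Sigma>]))) = state_dim \<Sigma>"

definition ct_jointly_state_minimal :: "'p::finite lpv_ssa \<Rightarrow> bool" where
  "ct_jointly_state_minimal \<Sigma> \<longleftrightarrow> ct_structurally_observable \<Sigma> \<and> ct_structurally_reachable \<Sigma>"


section \<open>Discrete time\<close>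

definition dt_inputs :: "nat \<Rightarrow> (nat \<Rightarrow> real Matrix.vec) set" where
  "dt_inputs nu = {u. \<forall>t. u t \<in> carrier_vec nu}"

definition dt_schedulings :: "(real ^ 'p::finite) set \<Rightarrow> (nat \<Rightarrow> real ^ 'p) set" where
  "dt_schedulings P = {p. \<forall>t. p t \<in> P}"

primrec dt_state ::
    "'p::finite lpv_ssa \<Rightarrow> real Matrix.vec \<Rightarrow> (nat \<Rightarrow> real Matrix.vec) \<Rightarrow> (nat \<Rightarrow> real ^ 'p) \<Rightarrow>
     nat \<Rightarrow> real Matrix.vec" where
  "dt_state \<Sigma> x\<^sub>0 u p 0 = x\<^sub>0"
| "dt_state \<Sigma> x\<^sub>0 u p (Suc t) =
     affine_mat (A_coeff \<Sigma>) (p t) *\<^sub>v dt_state \<Sigma> x\<^sub>0 u p t + affine_mat (B_coeff \<Sigma>) (p t) *\<^sub>v u t"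

definition dt_io_map ::
    "nat \<Rightarrow> (real ^ 'p::finite) set \<Rightarrow> 'p lpv_ssa \<Rightarrow> real Matrix.vec \<Rightarrow>
     (nat \<Rightarrow> real Matrix.vec) \<times> (nat \<Rightarrow> real ^ 'p) \<Rightarrow> nat \<Rightarrow> real Matrix.vec" where
  "dt_io_map nu P \<Sigma> x\<^sub>0 =
     (\<lambda>(u, p) \<in> dt_inputs nu \<times> dt_schedulings P.
        \<lambda>t. affine_mat (C_coeff \<Sigma>) (p t) *\<^sub>v dt_state \<Sigma> x\<^sub>0 u p t)"

definition dt_minimal ::
    "nat \<Rightarrow> nat \<Rightarrow> (real ^ 'p::finite) set \<Rightarrow> 'p lpv_ssa \<Rightarrow> real Matrix.vec \<Rightarrow> bool" where
  "dt_minimal nu ny P \<Sigma> x\<^sub>0 \<longleftrightarrow>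
     (\<forall>\<Sigma>' x\<^sub>0'. is_lpv_ssa nu ny \<Sigma>' \<and> x\<^sub>0' \<in> carrier_vec (state_dim \<Sigma>') \<and>
        dt_io_map nu P \<Sigma>' x\<^sub>0' = dt_io_map nu P \<Sigma> x\<^sub>0 \<longrightarrow> state_dim \<Sigma> \<le> state_dim \<Sigma>')"

definition dt_regularity_certificate :: "(real ^ 'p::finite) set \<Rightarrow> 'p lpv_ssa \<Rightarrow> bool" where
  "dt_regularity_certificate P \<Sigma> \<longleftrightarrow> convex P \<and> interior P \<noteq> {} \<and>
     (\<forall>q\<in>P. invertible_mat (affine_mat (A_coeff \<Sigma>) q))"

primrec dt_obs_block :: "'p::finite lpv_ssa \<Rightarrow> nat \<Rightarrow> ('p \<times> int) analytic_fun mat" where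
  "dt_obs_block \<Sigma> 0 = symbolic_mat (C_coeff \<Sigma>)"
| "dt_obs_block \<Sigma> (Suc j) = map_mat (time_shift 1) (dt_obs_block \<Sigma> j) * symbolic_mat (A_coeff \<Sigma>)"

primrec dt_reach_block :: "'p::finite lpv_ssa \<Rightarrow> nat \<Rightarrow> ('p \<times> int) analytic_fun mat" where
  "dt_reach_block \<Sigma> 0 = symbolic_mat (B_coeff \<Sigma>)"
| "dt_reach_block \<Sigma> (Suc j) = symbolic_mat (A_coeff \<Sigma>) * map_mat (time_shift (- 1)) (dt_reach_block \<Sigma> j)"

definition dt_structurally_observable :: "'p::finite lpv_ssa \<Rightarrow> bool" where
  "dt_structurally_observable \<Sigma> \<longleftrightarrow>
     meromorphic_rank (mat_of_rows (state_dim \<Sigma>)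
       (concat (map (\<lambda>j. Matrix.rows (dt_obs_block \<Sigma> j)) [0..<state_dim \<Sigma>]))) = state_dim \<Sigma>"

definition dt_structurally_reachable :: "'p::finite lpv_ssa \<Rightarrow> bool" where
  "dt_structurally_reachable \<Sigma> \<longleftrightarrow>
     meromorphic_rank (mat_of_cols (state_dim \<Sigma>)
       (concat (map (\<lambda>j. cols (dt_reach_block \<Sigma> j)) [0..<state_dim \<Sigma>]))) = state_dim \<Sigma>"

definition dt_jointly_state_minimal :: "'p::finite lpv_ssa \<Rightarrow> bool" where
  "dt_jointly_state_minimal \<Sigma> \<longleftrightarrow> dt_structurally_observable \<Sigma> \<and> dt_structurally_reachable \<Sigma>"

end

theory Submission
  imports Defs
begin

text \<open>
  Let \<open>R\<close> be the ring of analytic functions and \<open>W\<close> the set of all \<open>v \<in> R\<^sup>n\<close> with \<open>o\<^sub>j v = 0\<close> for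
  all \<open>j\<close>; it is non-zero if \<open>\<Sigma>\<close> is not structurally observable, because a chain of kernels in
  \<open>R\<^sup>n\<close> stabilises after at most \<open>n\<close> steps. In continuous time \<open>W\<close> is stable under
  \<open>\<nabla> = d/dt - A(p)\<close> and under \<open>\<partial>/\<partial>p\<^sub>i\<^sup>(\<^sup>k\<^sup>)\<close> for large \<open>k\<close>; commutators with \<open>\<nabla>\<close> lower \<open>k\<close>, and the last
  one is \<open>- A\<^sub>i\<close>, so that \<open>A\<^sub>i W \<subseteq> W\<close> and \<open>C\<^sub>i W = 0\<close>. In discrete time the same works with
  \<open>\<nabla> v = q\<^sup>-\<^sup>1(A(p) v)\<close>, where invertibility of \<open>A(p)\<close> guarantees that \<open>\<nabla> W\<close> spans \<open>W\<close>. Evaluating the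
  elements of \<open>W\<close> at points yields a non-zero constant subspace that is invariant under all \<open>A\<^sub>i\<close> and is
  killed by all \<open>C\<^sub>i\<close>; factoring it out gives a smaller representation with the same input-output map.
  Reachability is dual: transposition turns \<open>r\<^sub>j\<close> into \<open>o\<^sub>j\<close> with time reversed.
\<close>

section \<open>Differential operators on analytic functions\<close>

text \<open>A kernel vector whose entries depend on the scheduling does not by itself shrink the
  state space, because the smaller representation must again have constant coefficient matrices.
  Hence the search for a constant subspace that every \<open>A_coeff \<Sigma> i\<close> preserves
  separately, not only their affine combination. Kernels live in the ring and not in its quotient
  field because their elements are differentiated and evaluated at points; division is replaced by
  clearing denominators and by cancelling non-zero factors. In discrete time the commutation rule
  only describes derivatives of elements of the form \<open>nab u\<close>, which is why such
  elements have to span the kernel. The zero initial state is fixed by every linear map, so it is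
  respected by a factor map as well as by the inclusion of a subspace; another initial state need
  not lie in that subspace. In continuous time \<open>ct_state\<close> is a definite description:
  before a matrix can be moved through it, absolutely continuous solutions for piecewise continuous
  data must be shown to exist and to be unique.\<close>

lemma power_series_derivative_at_0:
  fixes d :: "nat \<Rightarrow> real"
  assumes "r > 0" and ps: "\<And>t. \<bar>t\<bar> < r \<Longrightarrow> (\<lambda>n. d n * t ^ n) sums \<phi> t"
  shows "(\<phi> has_real_derivative d 1) (at 0)"
proof (rule has_field_derivative_transform_within_open)
  have "((\<lambda>t. \<Sum>n. d n * t ^ n) has_real_derivative (\<Sum>n. diffs d n * 0 ^ n)) (at 0)"
    by (rule termdiffs_strong'[of r]) (use ps assms(1) in \<open>auto simp: sums_iff\<close>)
  then show "((\<lambda>t. \<Sum>n. d n * t ^ n) has_real_derivative d 1) (at 0)"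
    by (simp add: diffs_def)
  show "open (ball (0::real) r)" "(0::real) \<in> ball 0 r" using assms(1) by auto
  show "(\<Sum>n. d n * t ^ n) = \<phi> t" if "t \<in> ball 0 r" for t
    using ps[of t] that by (simp add: sums_iff)
qed

text \<open>Unconditional summability allows summation row by row; the derivative in
  \<open>s\<close> at 0 keeps row 1, and the derivative in \<open>t\<close> at 0 keeps entry 1 of
  that row.\<close>

lemma double_series_mixed_derivative:
  fixes \<gamma> :: "nat \<times> nat \<Rightarrow> real"
  assumes r: "r > 0"
    and G: "\<And>s t. \<bar>s\<bar> < r \<Longrightarrow> \<bar>t\<bar> < r \<Longrightarrow>
      ((\<lambda>p. \<gamma> p * (s ^ fst p * t ^ snd p)) has_sum G s t) UNIV"
  shows "deriv (\<lambda>t. deriv (\<lambda>s. G s t) 0) 0 = \<gamma> (1, 1)"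
proof -
  define g where "g m t = infsum (\<lambda>n. \<gamma> (m, n) * t ^ n) UNIV" for m t
  \<comment> \<open>The double series is used at \<open>s = r/2\<close>, where the factor
    \<open>(r/2) ^ m\<close> of row \<open>m\<close> is non-zero and can be divided out.\<close>
  have sm: "(\<lambda>n. \<gamma> (m, n) * t ^ n) summable_on UNIV" if t: "\<bar>t\<bar> < r" for m t
  proof -
    have "(\<lambda>p. \<gamma> p * ((r/2) ^ fst p * t ^ snd p)) summable_on UNIV \<times> UNIV"
      using has_sum_imp_summable[OF G[of "r/2" t]] r t by simp
    then have "(\<lambda>(m, n). (r/2) ^ m * (\<gamma> (m, n) * t ^ n)) summable_on UNIV \<times> UNIV"
      by (simp add: case_prod_unfold mult_ac)
    from summable_on_SigmaD1[OF this, of m]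
    have "(\<lambda>n. (r/2) ^ m * (\<gamma> (m, n) * t ^ n)) summable_on UNIV" by simp
    then show ?thesis
      by (subst (asm) summable_on_cmult_right') (use r in auto)
  qed
  have S: "(\<lambda>m. g m t * s ^ m) sums G s t" if st: "\<bar>s\<bar> < r" "\<bar>t\<bar> < r" for s t
  proof -
    have "((\<lambda>m. g m t * s ^ m) has_sum G s t) UNIV"
    proof (rule has_sum_SigmaD)
      show "((\<lambda>p. \<gamma> p * (s ^ fst p * t ^ snd p)) has_sum G s t) (Sigma UNIV (\<lambda>_. UNIV))"
        using G[OF st] by simp
      fix m :: nat
      have "((\<lambda>n. \<gamma> (m, n) * t ^ n * s ^ m) has_sum g m t * s ^ m) UNIV"
        unfolding g_def by (intro has_sum_cmult_left has_sum_infsum sm st)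
      then show "((\<lambda>n. \<gamma> (m, n) * (s ^ fst (m, n) * t ^ snd (m, n))) has_sum g m t * s ^ m) UNIV"
        by (simp add: mult_ac)
    qed
    then show ?thesis by (rule has_sum_imp_sums)
  qed
  have D1: "deriv (\<lambda>s. G s t) 0 = g 1 t" if "\<bar>t\<bar> < r" for t
    by (rule DERIV_imp_deriv, rule power_series_derivative_at_0[OF r S]) (use that in auto)
  have "((\<lambda>t. g 1 t) has_real_derivative \<gamma> (1, 1)) (at 0)"
  proof (rule power_series_derivative_at_0[OF r, where d = "\<lambda>n. \<gamma> (1, n)"])
    show "(\<lambda>n. \<gamma> (1, n) * t ^ n) sums g 1 t" if "\<bar>t\<bar> < r" for t
      unfolding g_def by (intro has_sum_imp_sums has_sum_infsum sm that)
  qed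
  then have "((\<lambda>t. deriv (\<lambda>s. G s t) 0) has_real_derivative \<gamma> (1, 1)) (at 0)"
    by (rule has_field_derivative_transform_within_open[where S = "ball 0 r"]) (use r D1 in auto)
  then show ?thesis by (rule DERIV_imp_deriv)
qed

text \<open>Swapping the indices exchanges the order of differentiation, and both orders read off
  the coefficient \<open>\<gamma> (1, 1)\<close>.\<close>

lemma double_series_mixed_derivatives_commute:
  fixes \<gamma> :: "nat \<times> nat \<Rightarrow> real"
  assumes r: "r > 0"
    and G: "\<And>s t. \<bar>s\<bar> < r \<Longrightarrow> \<bar>t\<bar> < r \<Longrightarrow>
      ((\<lambda>p. \<gamma> p * (s ^ fst p * t ^ snd p)) has_sum G s t) UNIV"
  shows "deriv (\<lambda>t. deriv (\<lambda>s. G s t) 0) 0 = deriv (\<lambda>s. deriv (\<lambda>t. G s t) 0) 0"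
proof -
  have "((\<lambda>p. (\<gamma> \<circ> prod.swap) p * (t ^ fst p * s ^ snd p)) has_sum G s t) UNIV"
    if st: "\<bar>t\<bar> < r" "\<bar>s\<bar> < r" for s t
  proof -
    have "((\<lambda>p. \<gamma> (prod.swap p) * (s ^ fst (prod.swap p) * t ^ snd (prod.swap p))) has_sum G s t) UNIV"
      using has_sum_reindex_bij_betw[OF bij_swap, of "\<lambda>p. \<gamma> p * (s ^ fst p * t ^ snd p)" "G s t"] G[of s t] st
      by simp
    then show ?thesis by (simp add: mult_ac)
  qed
  from double_series_mixed_derivative[OF r, of "\<gamma> \<circ> prod.swap" "\<lambda>t s. G s t", OF this]
    double_series_mixed_derivative[OF r G]
  show ?thesis by simp
qed

text \<open>No differentiability is required: \<open>deriv\<close> selects from a predicate that the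
  translation leaves unchanged.\<close>

lemma deriv_translate: "deriv (\<lambda>s. f (c + s)) 0 = deriv f (c::real)"
  unfolding deriv_def using DERIV_shift[of f _ 0 c] by (simp add: add.commute)

text \<open>Restricting the expansion at \<open>a\<close> to the plane of \<open>v\<close> and
  \<open>w\<close> and grouping it by the exponents \<open>(\<alpha> v, \<alpha> w)\<close> gives a
  double series.\<close>

lemma analytic_in_partials_commute:
  assumes f: "analytic_in V f" and vw: "v \<in> V" "w \<in> V" "v \<noteq> w"
  shows "deriv (\<lambda>t. deriv (\<lambda>s. f (a(w := t, v := s))) (a v)) (a w)
       = deriv (\<lambda>s. deriv (\<lambda>t. f (a(v := s, w := t))) (a w)) (a v)"
proof -
  note fin = analytic_in_finite[OF f]
  obtain r c where ex: "expansion V f a r c" by (rule analytic_inE[OF f])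
  note r = expansionD(1)[OF ex] and c = expansionD(2)[OF ex]
  define G where "G s t = f (a(w := a w + t, v := a v + s))" for s t
  \<comment> \<open>The increment is zero off \<open>v\<close> and \<open>w\<close>; since
    \<open>0 ^ 0 = 1\<close>, the product keeps exactly the multi-indices supported on these two
    variables.\<close>
  define \<kappa> where "\<kappa> \<alpha> = c \<alpha> * (\<Prod>u\<in>V - {v, w}. 0 ^ \<alpha> u)" for \<alpha>
  define \<phi> where "\<phi> \<alpha> = (\<alpha> v, \<alpha> w)" for \<alpha> :: "'a \<Rightarrow> nat"
  define \<gamma> where "\<gamma> p = infsum \<kappa> {\<alpha> \<in> exponents V. \<phi> \<alpha> = p}" for p
  have "((\<lambda>p. \<gamma> p * (s ^ fst p * t ^ snd p)) has_sum G s t) UNIV" if st: "\<bar>s\<bar> < r" "\<bar>t\<bar> < r" for s t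
  proof -
    define h where "h = (\<lambda>_. 0)(v := s, w := t)"
    have "(\<lambda>u. a u + h u) = a(w := a w + t, v := a v + s)"
      using vw by (auto simp: h_def fun_eq_iff)
    moreover have "((\<lambda>\<alpha>. c \<alpha> * monomial V h \<alpha>) has_sum f (\<lambda>u. a u + h u)) (exponents V)"
      by (rule c) (use st r in \<open>auto simp: h_def\<close>)
    moreover have "c \<alpha> * monomial V h \<alpha> = \<kappa> \<alpha> * (s ^ \<alpha> v * t ^ \<alpha> w)" for \<alpha>
    proof -
      have "monomial V h \<alpha> = (\<Prod>u\<in>{v, w}. h u ^ \<alpha> u) * (\<Prod>u\<in>V - {v, w}. h u ^ \<alpha> u)"
        unfolding monomial_def using prod.subset_diff[of "{v, w}" V] fin vw by (simp add: mult.commute)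
      also have "(\<Prod>u\<in>V - {v, w}. h u ^ \<alpha> u) = (\<Prod>u\<in>V - {v, w}. 0 ^ \<alpha> u)"
        by (rule prod.cong) (auto simp: h_def)
      also have "(\<Prod>u\<in>{v, w}. h u ^ \<alpha> u) = s ^ \<alpha> v * t ^ \<alpha> w"
        using vw by (simp add: h_def)
      finally show ?thesis by (simp add: \<kappa>_def)
    qed
    ultimately have "((\<lambda>\<alpha>. \<kappa> \<alpha> * (s ^ \<alpha> v * t ^ \<alpha> w)) has_sum G s t) (exponents V)"
      by (simp add: G_def)
    from has_sum_group[OF this, of \<phi> UNIV]
    have "((\<lambda>p. infsum (\<lambda>\<alpha>. \<kappa> \<alpha> * (s ^ \<alpha> v * t ^ \<alpha> w)) {\<alpha> \<in> exponents V. \<phi> \<alpha> = p}) has_sum G s t) UNIV"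
      by simp
    moreover have "infsum (\<lambda>\<alpha>. \<kappa> \<alpha> * (s ^ \<alpha> v * t ^ \<alpha> w)) {\<alpha> \<in> exponents V. \<phi> \<alpha> = p}
        = \<gamma> p * (s ^ fst p * t ^ snd p)" for p
    proof -
      have "infsum (\<lambda>\<alpha>. \<kappa> \<alpha> * (s ^ \<alpha> v * t ^ \<alpha> w)) {\<alpha> \<in> exponents V. \<phi> \<alpha> = p}
        = infsum (\<lambda>\<alpha>. \<kappa> \<alpha> * (s ^ fst p * t ^ snd p)) {\<alpha> \<in> exponents V. \<phi> \<alpha> = p}"
        by (rule infsum_cong) (auto simp: \<phi>_def)
      then show ?thesis unfolding \<gamma>_def by (simp add: infsum_cmult_left')
    qed
    ultimately show ?thesis by simp
  qed
  from double_series_mixed_derivatives_commute[OF r this]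
  have "deriv (\<lambda>t. deriv (\<lambda>s. G s t) 0) 0 = deriv (\<lambda>s. deriv (\<lambda>t. G s t) 0) 0" .
  moreover have "deriv (\<lambda>s. G s t) 0 = deriv (\<lambda>s. f (a(w := a w + t, v := s))) (a v)" for t
    unfolding G_def by (rule deriv_translate)
  moreover have "deriv (\<lambda>t. G s t) 0 = deriv (\<lambda>t. f (a(v := a v + s, w := t))) (a w)" for s
    unfolding G_def using deriv_translate[of "\<lambda>t. f (a(v := a v + s, w := t))" "a w"] vw
    by (simp add: fun_upd_twist)
  ultimately show ?thesis
    using deriv_translate[of "\<lambda>t. deriv (\<lambda>s. f (a(w := t, v := s))) (a v)" "a w"]
      deriv_translate[of "\<lambda>s. deriv (\<lambda>t. f (a(v := s, w := t))) (a w)" "a v"] by simp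
qed

lemma real_analytic_in_superset:
  assumes "real_analytic f" "finite W"
  obtains V where "analytic_in V f" "W \<subseteq> V"
proof -
  obtain V where V: "analytic_in V f" using assms(1) by (auto simp: real_analytic_def)
  show ?thesis
    by (rule that[of "V \<union> W"], rule analytic_in_mono[OF V]) (use assms(2) analytic_in_finite[OF V] in auto)
qed

lemma partial_deriv_commute:
  "partial_deriv v (partial_deriv w F) = partial_deriv w (partial_deriv v F)"
proof (cases "v = w")
  case False
  then show ?thesis
  proof (transfer, intro ext)
    fix v w :: 'a and f :: "('a \<Rightarrow> real) \<Rightarrow> real" and a :: "'a \<Rightarrow> real"
    assume vw: "v \<noteq> w" and "real_analytic f"
    then obtain V where "analytic_in V f" "{v, w} \<subseteq> V" by (meson real_analytic_in_superset finite.emptyI finite_insert)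
    then show "deriv (\<lambda>t. deriv (\<lambda>s. f ((a(v := t))(w := s))) ((a(v := t)) w)) (a v) =
        deriv (\<lambda>t. deriv (\<lambda>s. f ((a(w := t))(v := s))) ((a(w := t)) v)) (a w)"
      using analytic_in_partials_commute[of V f v w a] vw by simp
  qed
qed simp

text \<open>As \<open>deriv\<close> is total, its value alone proves nothing; the rules for sums and
  products need genuine differentiability, which the expansion along a coordinate line
  provides.\<close>

lemma real_analytic_coordinate_derivative:
  assumes "real_analytic f"
  shows "((\<lambda>t. f (x(v := t))) has_real_derivative deriv (\<lambda>t. f (x(v := t))) (x v)) (at (x v))"
proof -
  obtain V where V: "analytic_in V f" using assms by (auto simp: real_analytic_def)
  obtain r d where r: "r > 0" and
    d: "\<And>t. \<bar>t - x v\<bar> < r \<Longrightarrow> (\<lambda>n. d n * (t - x v) ^ n) sums f (\<lambda>u. (x(v := 0)) u + t * ((\<lambda>_. 0)(v := 1)) u)"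
    by (rule analytic_in_line[OF V, of "x v" "x(v := 0)" "(\<lambda>_. 0)(v := 1)"]) blast
  have upd: "(\<lambda>u. (x(v := 0)) u + t * ((\<lambda>_. 0)(v := 1)) u) = x(v := t)" for t
    by (auto simp: fun_eq_iff)
  have "((\<lambda>s. f (x(v := x v + s))) has_real_derivative d 1) (at 0)"
    by (rule power_series_derivative_at_0[OF r]) (use d[of "x v + _", unfolded upd] in simp)
  then have "((\<lambda>t. f (x(v := t))) has_real_derivative d 1) (at (x v))"
    using DERIV_shift[of "\<lambda>t. f (x(v := t))" "d 1" 0 "x v"] by (simp add: add.commute)
  then show ?thesis using DERIV_imp_deriv by fastforce
qed

section \<open>Derivation rules and the commutator with the total time derivative\<close>

lemma partial_deriv_add: "partial_deriv v (F + G) = partial_deriv v F + partial_deriv v G"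
proof (transfer, intro ext)
  fix v :: 'a and f g :: "('a \<Rightarrow> real) \<Rightarrow> real" and x :: "'a \<Rightarrow> real" assume fg: "real_analytic f" "real_analytic g"
  show "deriv (\<lambda>t. f (x(v := t)) + g (x(v := t))) (x v) =
    deriv (\<lambda>t. f (x(v := t))) (x v) + deriv (\<lambda>t. g (x(v := t))) (x v)"
    by (rule DERIV_imp_deriv) (intro DERIV_add real_analytic_coordinate_derivative fg)
qed

lemma partial_deriv_mult:
  "partial_deriv v (F * G) = partial_deriv v F * G + F * partial_deriv v G"
proof (transfer, intro ext)
  fix v :: 'a and f g :: "('a \<Rightarrow> real) \<Rightarrow> real" and x :: "'a \<Rightarrow> real" assume fg: "real_analytic f" "real_analytic g"
  show "deriv (\<lambda>t. f (x(v := t)) * g (x(v := t))) (x v) =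
    deriv (\<lambda>t. f (x(v := t))) (x v) * g x + f x * deriv (\<lambda>t. g (x(v := t))) (x v)"
    using DERIV_imp_deriv[OF DERIV_mult[OF real_analytic_coordinate_derivative[OF fg(1), of x v]
      real_analytic_coordinate_derivative[OF fg(2), of x v]]] by simp
qed

lemma partial_deriv_const [simp]: "partial_deriv v (const_fn k) = 0"
  by transfer simp

lemma partial_deriv_coord: "partial_deriv v (coord_fn w) = (if v = w then 1 else 0)"
  by transfer (auto simp: fun_eq_iff)

lemma partial_deriv_0 [simp]: "partial_deriv v 0 = 0"
  by transfer simp

lemma partial_deriv_sum: "partial_deriv v (sum F S) = (\<Sum>s\<in>S. partial_deriv v (F s))"
  by (induction S rule: infinite_finite_induct) (simp_all add: partial_deriv_add)

text \<open>The index set in \<open>time_deriv\<close> varies with the function; with a larger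
  finite set several functions can share one sum.\<close>

lemma time_deriv_eq:
  assumes "finite S" "\<And>v. v \<notin> S \<Longrightarrow> partial_deriv v F = 0"
  shows "time_deriv F = (\<Sum>v\<in>S. partial_deriv v F * coord_fn (fst v, Suc (snd v)))"
  unfolding time_deriv_def using assms by (intro sum.mono_neutral_left) auto

lemma common_support:
  assumes "finite \<F>"
  obtains S where "finite S" "\<And>F v. F \<in> \<F> \<Longrightarrow> v \<notin> S \<Longrightarrow> partial_deriv v F = 0"
proof (rule that)
  show "finite (\<Union>F\<in>\<F>. {v. partial_deriv v F \<noteq> 0})"
    using assms by (simp add: finite_partial_deriv_nonzero)
qed auto

lemma time_deriv_add: "time_deriv (F + G) = time_deriv F + time_deriv G"
proof -
  obtain S where "finite S" "\<And>H v. H \<in> {F, G} \<Longrightarrow> v \<notin> S \<Longrightarrow> partial_deriv v H = 0"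
    by (rule common_support[of "{F, G}"]) auto
  then show ?thesis
    by (simp add: time_deriv_eq[of S] partial_deriv_add sum.distrib algebra_simps)
qed

lemma time_deriv_mult: "time_deriv (F * G) = time_deriv F * G + F * time_deriv G"
proof -
  obtain S where "finite S" "\<And>H v. H \<in> {F, G} \<Longrightarrow> v \<notin> S \<Longrightarrow> partial_deriv v H = 0"
    by (rule common_support[of "{F, G}"]) auto
  then show ?thesis
    by (simp add: time_deriv_eq[of S] partial_deriv_mult sum.distrib sum_distrib_left sum_distrib_right algebra_simps)
qed

lemma time_deriv_0 [simp]: "time_deriv 0 = 0"
  by (simp add: time_deriv_def)

lemma time_deriv_sum: "time_deriv (sum F S) = (\<Sum>s\<in>S. time_deriv (F s))"
  by (induction S rule: infinite_finite_induct) (simp_all add: time_deriv_add)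

text \<open>In \<open>time_deriv\<close> the derivative along \<open>(i, k)\<close> carries the
  factor \<open>coord_fn (i, Suc k)\<close>, and differentiating this factor produces the extra
  term. No factor has order 0, hence the second equation.\<close>

lemma partial_time_deriv:
  "partial_deriv (i, Suc k) (time_deriv F) = time_deriv (partial_deriv (i, Suc k) F) + partial_deriv (i, k) F"
  "partial_deriv (i, 0) (time_deriv F) = time_deriv (partial_deriv (i, 0) F)"
proof -
  obtain S where S: "finite S" "\<And>v. v \<notin> S \<Longrightarrow> partial_deriv v F = 0"
    by (rule common_support[of "{F}"]) auto
  \<comment> \<open>By symmetry, partial derivatives of \<open>F\<close> are supported in
    \<open>S\<close> too, so the same sum represents their time derivatives.\<close>
  have S': "partial_deriv v (partial_deriv w F) = 0" if "v \<notin> S" for v w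
    using S(2)[OF that] by (simp add: partial_deriv_commute[of v])
  have *: "partial_deriv w (time_deriv F) = time_deriv (partial_deriv w F)
    + (\<Sum>v\<in>S. partial_deriv v F * (if w = (fst v, Suc (snd v)) then 1 else 0))" for w
    using S' by (simp add: time_deriv_eq[OF S] time_deriv_eq[of S "partial_deriv w F"] S(1) partial_deriv_sum partial_deriv_mult
      sum.distrib partial_deriv_coord partial_deriv_commute[of w])
  have "(\<Sum>v\<in>S. partial_deriv v F * (if (i, Suc k) = (fst v, Suc (snd v)) then 1 else 0))
    = (\<Sum>v\<in>S. if v = (i, k) then partial_deriv (i, k) F else 0)"
    by (rule sum.cong) auto
  also have "\<dots> = partial_deriv (i, k) F"
    using S by (simp add: sum.delta)
  finally show "partial_deriv (i, Suc k) (time_deriv F) = time_deriv (partial_deriv (i, Suc k) F) + partial_deriv (i, k) F"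
    using *[of "(i, Suc k)"] by simp
  show "partial_deriv (i, 0) (time_deriv F) = time_deriv (partial_deriv (i, 0) F)"
    using *[of "(i, 0)"] by simp
qed

section \<open>Kernels over the ring of analytic functions: continuous time\<close>

text \<open>Fractions are avoided by determinants: the vectors become the columns of a square matrix
  padded with zero rows, and a singular matrix over an integral domain has a non-zero kernel
  vector.\<close>

lemma idom_dependent:
  fixes V :: "nat \<Rightarrow> nat \<Rightarrow> 'a::idom"
  assumes "n < m"
  shows "\<exists>d. (\<exists>j<m. d j \<noteq> 0) \<and> (\<forall>c<n. (\<Sum>j<m. d j * V j c) = 0)"
proof -
  define M where "M = Matrix.mat m m (\<lambda>(c, j). if c < n then V j c else 0)"
  have M: "M \<in> carrier_mat m m" by (simp add: M_def)
  \<comment> \<open>Row \<open>n\<close> of \<open>M\<close> is one of the zero rows, as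
    \<open>n < m\<close>.\<close>
  have "transpose_mat M *\<^sub>v unit_vec m n = 0\<^sub>v m"
  proof (rule eq_vecI)
    fix i assume "i < dim_vec (0\<^sub>v m :: 'a Matrix.vec)"
    then show "(transpose_mat M *\<^sub>v unit_vec m n) $ i = 0\<^sub>v m $ i"
      using assms by (simp add: M_def)
  qed (simp add: M_def)
  moreover have "unit_vec m n \<noteq> (0\<^sub>v m :: 'a Matrix.vec)"
  proof
    assume "unit_vec m n = (0\<^sub>v m :: 'a Matrix.vec)"
    then have "unit_vec m n $ n = (0\<^sub>v m :: 'a Matrix.vec) $ n" by simp
    with assms show False by simp
  qed
  ultimately have "det (transpose_mat M) = 0"
    using M by (subst det_0_iff_vec_prod_zero[of _ m]) (auto intro!: exI[of _ "unit_vec m n"])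
  then have "det M = 0" using det_transpose[OF M] by simp
  then obtain v where v: "v \<in> carrier_vec m" "v \<noteq> 0\<^sub>v m" "M *\<^sub>v v = 0\<^sub>v m"
    using det_0_iff_vec_prod_zero[OF M] by blast
  then obtain j where j: "j < m" "v $ j \<noteq> 0"
    using eq_vecI[of v "0\<^sub>v m"] by auto
  have "(\<Sum>j<m. v $ j * V j c) = 0" if c: "c < n" for c
  proof -
    have "(M *\<^sub>v v) $ c = (\<Sum>j<m. v $ j * V j c)"
      using c v(1) assms by (auto simp: M_def scalar_prod_def atLeast0LessThan mult.commute intro!: sum.cong)
    then show ?thesis using v(3) c assms by simp
  qed
  with j show ?thesis by (intro exI[of _ "\<lambda>j. v $ j"]) auto
qed

text \<open>Vectors are functions on all naturals with unconstrained entries from index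
  \<open>n\<close> on, so non-vanishing must be witnessed below \<open>n\<close>. Level 0 is the
  whole space.\<close>

definition kernel_upto :: "nat \<Rightarrow> nat \<Rightarrow> (nat \<Rightarrow> nat \<Rightarrow> nat \<Rightarrow> 'a::idom) \<Rightarrow> nat \<Rightarrow> (nat \<Rightarrow> 'a) set" where
  "kernel_upto n ny ob k = {v. \<forall>j<k. \<forall>r<ny. (\<Sum>c<n. ob j r c * v c) = 0}"

lemma kernel_upto_add: "v \<in> kernel_upto n ny ob k \<Longrightarrow> w \<in> kernel_upto n ny ob k \<Longrightarrow> (\<lambda>c. v c + w c) \<in> kernel_upto n ny ob k"
  by (simp add: kernel_upto_def algebra_simps sum.distrib)

lemma kernel_upto_scale_eq: "(\<Sum>c<n. ob c * (d * v c)) = d * (\<Sum>c<n. ob c * v c)" for d :: "'a::idom"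
  by (simp add: sum_distrib_left mult_ac)

lemma kernel_upto_scale: "v \<in> kernel_upto n ny ob k \<Longrightarrow> (\<lambda>c. d * v c) \<in> kernel_upto n ny ob k"
  by (simp add: kernel_upto_def kernel_upto_scale_eq)

text \<open>Cancelling a non-zero factor, possible without zero divisors, is the substitute for
  dividing by it.\<close>

lemma kernel_upto_scaleD: "(\<lambda>c. d * v c) \<in> kernel_upto n ny ob k \<Longrightarrow> d \<noteq> 0 \<Longrightarrow> v \<in> kernel_upto n ny ob k"
  by (simp add: kernel_upto_def kernel_upto_scale_eq)

lemma kernel_upto_uminus: "v \<in> kernel_upto n ny ob k \<Longrightarrow> (\<lambda>c. - v c) \<in> kernel_upto n ny ob k"
  by (simp add: kernel_upto_def sum_negf)

lemma kernel_upto_diff: "v \<in> kernel_upto n ny ob k \<Longrightarrow> w \<in> kernel_upto n ny ob k \<Longrightarrow> (\<lambda>c. v c - w c) \<in> kernel_upto n ny ob k"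
  by (simp add: kernel_upto_def algebra_simps sum_subtractf)

lemma kernel_upto_sum:
  assumes "\<And>s. s \<in> S \<Longrightarrow> w s \<in> kernel_upto n ny ob k"
  shows "(\<lambda>c. \<Sum>s\<in>S. d s * w s c) \<in> kernel_upto n ny ob k"
  using assms
proof (induction S rule: infinite_finite_induct)
  case (insert s S)
  then show ?case
    using kernel_upto_add[OF kernel_upto_scale[of "w s" n ny ob k "d s"], of "\<lambda>c. \<Sum>s\<in>S. d s * w s c"] by simp
qed (simp_all add: kernel_upto_def)

lemma kernel_upto_cong:
  assumes "\<And>c. c < n \<Longrightarrow> v c = w c"
  shows "v \<in> kernel_upto n ny ob k \<longleftrightarrow> w \<in> kernel_upto n ny ob k"
  using assms by (simp add: kernel_upto_def)

lemma kernel_upto_antimono: "k \<le> l \<Longrightarrow> kernel_upto n ny ob l \<subseteq> kernel_upto n ny ob k"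
  by (auto simp: kernel_upto_def)

lemma kernel_upto_Suc:
  "v \<in> kernel_upto n ny ob (Suc k) \<longleftrightarrow> v \<in> kernel_upto n ny ob k \<and> (\<forall>r<ny. (\<Sum>c<n. ob k r c * v c) = 0)"
  by (auto simp: kernel_upto_def less_Suc_eq)

text \<open>
  A strictly decreasing chain of \<open>n + 1\<close> kernels ending in a non-zero one would yield \<open>n + 1\<close>
  independent vectors of length \<open>n\<close>.
\<close>

lemma kernel_upto_stabilises:
  fixes ob :: "nat \<Rightarrow> nat \<Rightarrow> nat \<Rightarrow> 'a::idom"
  assumes down: "\<And>k v. v \<in> kernel_upto n ny ob (Suc k) \<Longrightarrow> nab v \<in> kernel_upto n ny ob k"
    and up: "\<And>k v. v \<in> kernel_upto n ny ob (Suc k) \<Longrightarrow> nab v \<in> kernel_upto n ny ob (Suc k) \<Longrightarrow>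
      v \<in> kernel_upto n ny ob (Suc (Suc k))"
    and v: "v \<in> kernel_upto n ny ob n" "c < n" "v c \<noteq> 0"
  obtains m where "\<And>k. kernel_upto n ny ob m \<subseteq> kernel_upto n ny ob k" "v \<in> kernel_upto n ny ob m"
proof -
  have "\<exists>k<n. kernel_upto n ny ob k \<subseteq> kernel_upto n ny ob (Suc k)"
  proof (rule ccontr)
    assume "\<not> ?thesis"
    then have "\<forall>k. \<exists>w. k < n \<longrightarrow> w \<in> kernel_upto n ny ob k \<and> w \<notin> kernel_upto n ny ob (Suc k)" by blast
    then obtain w where w: "\<And>k. k < n \<Longrightarrow> w k \<in> kernel_upto n ny ob k \<and> w k \<notin> kernel_upto n ny ob (Suc k)"
      by metis
    \<comment> \<open>Each level below \<open>n\<close> at which the chain drops supplies a vector,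
      and \<open>v\<close> is added at level \<open>n\<close>.\<close>
    define u where "u j = (if j < n then w j else v)" for j
    have u: "u j \<in> kernel_upto n ny ob j" if "j \<le> n" for j
    proof (cases "j < n")
      case True
      then show ?thesis using w by (simp add: u_def)
    next
      case False
      with that have "j = n" by simp
      with v(1) show ?thesis by (simp add: u_def)
    qed
    obtain d i where d: "i < Suc n" "d i \<noteq> 0" "\<And>c. c < n \<Longrightarrow> (\<Sum>j<Suc n. d j * u j c) = 0"
      using idom_dependent[of n "Suc n" u] by auto
    \<comment> \<open>With the least index of a non-zero coefficient, all other terms lie in
      \<open>kernel_upto n ny ob (Suc j)\<close>. For \<open>j < n\<close> this forces
      \<open>u j\<close> one level deeper than it was chosen; for \<open>j = n\<close> the remaining
      sum is empty and \<open>v c\<close> would vanish.\<close>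
    define j where "j = (LEAST j. d j \<noteq> 0)"
    have j: "d j \<noteq> 0" "\<And>i. i < j \<Longrightarrow> d i = 0"
      unfolding j_def using LeastI[of "\<lambda>j. d j \<noteq> 0" i] d(2) not_less_Least by blast+
    have jn: "j \<le> n"
      unfolding j_def using Least_le[of "\<lambda>j. d j \<noteq> 0" i] d(1,2) by linarith
    have eq: "d j * u j c = - (\<Sum>l\<in>{j<..n}. d l * u l c)" if "c < n" for c
    proof -
      have "(\<Sum>l<Suc n. d l * u l c) = (\<Sum>l\<in>{j..n}. d l * u l c)"
        by (rule sum.mono_neutral_right) (use j jn in auto)
      also have "\<dots> = d j * u j c + (\<Sum>l\<in>{j<..n}. d l * u l c)"
        using jn by (subst sum.head) auto
      finally show ?thesis using d(3)[OF that] by (simp add: eq_neg_iff_add_eq_0)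
    qed
    have "(\<lambda>c. \<Sum>l\<in>{j<..n}. d l * u l c) \<in> kernel_upto n ny ob (Suc j)"
    proof (rule kernel_upto_sum)
      fix l assume "l \<in> {j<..n}"
      then show "u l \<in> kernel_upto n ny ob (Suc j)"
        using u[of l] kernel_upto_antimono[of "Suc j" l n ny ob] by auto
    qed
    then have "(\<lambda>c. d j * u j c) \<in> kernel_upto n ny ob (Suc j)"
      using kernel_upto_uminus kernel_upto_cong[of n "\<lambda>c. d j * u j c", OF eq] by blast
    then have uj: "u j \<in> kernel_upto n ny ob (Suc j)" by (rule kernel_upto_scaleD[OF _ j(1)])
    show False
    proof (cases "j < n")
      case True
      with uj w show False by (simp add: u_def)
    next
      case False
      with jn have "j = n" by simp
      with eq[OF v(2)] j(1) v(3) show False by (simp add: u_def)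
    qed
  qed
  then obtain m where m: "m < n" "kernel_upto n ny ob m \<subseteq> kernel_upto n ny ob (Suc m)" by blast
  \<comment> \<open>One coincidence of levels propagates: \<open>nab\<close> sends level
    \<open>Suc m\<close> to level \<open>m\<close>, the induction hypothesis lifts the image, and
    \<open>up\<close> returns. As \<open>up\<close> starts at a positive level, \<open>l = 0\<close>
    is separate.\<close>
  have step: "kernel_upto n ny ob m \<subseteq> kernel_upto n ny ob (m + l)" for l
  proof (induction l)
    case (Suc l)
    show ?case
    proof
      fix v assume v: "v \<in> kernel_upto n ny ob m"
      show "v \<in> kernel_upto n ny ob (m + Suc l)"
      proof (cases l)
        case 0
        with m v show ?thesis by auto
      next
        case (Suc l')
        have 1: "v \<in> kernel_upto n ny ob (Suc (m + l'))"
          using Suc.IH v by (auto simp: Suc)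
        have "v \<in> kernel_upto n ny ob (Suc m)" using m v by blast
        then have "nab v \<in> kernel_upto n ny ob m" by (rule down)
        then have "nab v \<in> kernel_upto n ny ob (Suc (m + l'))"
          using Suc.IH by (auto simp: Suc)
        from up[OF 1 this] show ?thesis by (simp add: Suc)
      qed
    qed
  qed simp
  show ?thesis
  proof (rule that[of m])
    show "kernel_upto n ny ob m \<subseteq> kernel_upto n ny ob k" for k
      using step[of k] kernel_upto_antimono[of k "m + k" n ny ob] by simp
    show "v \<in> kernel_upto n ny ob m"
      using v(1) kernel_upto_antimono[of m n n ny ob] m(1) by auto
  qed
qed

section \<open>Affine matrices acting on vectors of analytic functions\<close>

text \<open>Matches an entry of \<open>symbolic_mat\<close>, but takes plain functions as
  coefficients, so that original and transposed data can be inserted alike.\<close>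

definition symbolic_entry :: "('p::finite option \<Rightarrow> nat \<Rightarrow> nat \<Rightarrow> real) \<Rightarrow> nat \<Rightarrow> nat \<Rightarrow> ('p \<times> 'k::zero) analytic_fun" where
  "symbolic_entry m j k = const_fn (m None j k) + (\<Sum>i\<in>UNIV. const_fn (m (Some i) j k) * coord_fn (i, 0))"

lemma partial_symbolic_entry:
  "partial_deriv (i, k) (symbolic_entry m j l) = (if k = 0 then const_fn (m (Some i) j l) else 0)"
proof -
  have "partial_deriv (i, k) (symbolic_entry m j l)
    = (\<Sum>i'\<in>UNIV. const_fn (m (Some i') j l) * (if (i, k) = (i', 0) then 1 else 0))"
    by (simp add: symbolic_entry_def partial_deriv_add partial_deriv_sum partial_deriv_mult partial_deriv_coord)
  also have "\<dots> = (\<Sum>i'\<in>UNIV. if i' = i then (if k = 0 then const_fn (m (Some i) j l) else 0) else 0)"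
    by (rule sum.cong) auto
  finally show ?thesis by simp
qed

lemma partial_deriv_uminus: "partial_deriv v (- F) = - partial_deriv v F"
  using partial_deriv_add[of v F "- F"] by (simp add: eq_neg_iff_add_eq_0 add.commute)

lemma partial_deriv_diff: "partial_deriv v (F - G) = partial_deriv v F - partial_deriv v G"
  using partial_deriv_add[of v F "- G"] by (simp add: partial_deriv_uminus)

lemma const_fn_eq_0_iff: "const_fn k = 0 \<longleftrightarrow> k = 0"
  by transfer (auto simp: fun_eq_iff)

lemma evaluate_simps [simp]:
  "evaluate (F + G) y = evaluate F y + evaluate G y"
  "evaluate (F * G) y = evaluate F y * evaluate G y"
  "evaluate (const_fn k) y = k" "evaluate 0 y = 0" "evaluate 1 y = 1" "evaluate (coord_fn v) y = y v"
  by (simp_all add: plus_analytic_fun.rep_eq times_analytic_fun.rep_eq const_fn.rep_eq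
    zero_analytic_fun.rep_eq one_analytic_fun.rep_eq coord_fn.rep_eq)

lemma evaluate_sum [simp]: "evaluate (sum F S) y = (\<Sum>s\<in>S. evaluate (F s) y)"
  by (induction S rule: infinite_finite_induct) simp_all

definition const_apply :: "nat \<Rightarrow> (nat \<Rightarrow> nat \<Rightarrow> real) \<Rightarrow> (nat \<Rightarrow> 'v analytic_fun) \<Rightarrow> nat \<Rightarrow> 'v analytic_fun" where
  "const_apply n a v j = (\<Sum>l<n. const_fn (a j l) * v l)"

lemma symbolic_entry_apply:
  "(\<Sum>l<n. symbolic_entry m j l * v l) =
     const_apply n (m None) v j + (\<Sum>i\<in>UNIV. coord_fn (i, 0) * const_apply n (m (Some i)) v j)"
proof -
  have "symbolic_entry m j l * v l = const_fn (m None j l) * v l +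
     (\<Sum>i\<in>UNIV. coord_fn (i, 0) * (const_fn (m (Some i) j l) * v l))" for l
    unfolding symbolic_entry_def distrib_right sum_distrib_right
    by (simp add: mult.left_commute mult.assoc)
  then have "(\<Sum>l<n. symbolic_entry m j l * v l) = (\<Sum>l<n. const_fn (m None j l) * v l) +
     (\<Sum>l<n. \<Sum>i\<in>UNIV. coord_fn (i, 0) * (const_fn (m (Some i) j l) * v l))"
    by (simp only: sum.distrib)
  also have "(\<Sum>l<n. \<Sum>i\<in>UNIV. coord_fn (i, 0) * (const_fn (m (Some i) j l) * v l))
    = (\<Sum>i\<in>UNIV. \<Sum>l<n. coord_fn (i, 0) * (const_fn (m (Some i) j l) * v l))"
    by (rule sum.swap)
  finally show ?thesis by (simp add: const_apply_def sum_distrib_left)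
qed

text \<open>Since \<open>(i, 0)\<close> is the only variable through which the component
  \<open>i\<close> enters, the product rule for it isolates the single constant matrix
  \<open>m (Some i)\<close>.\<close>

lemma partial_symbolic_entry_apply:
  "partial_deriv (i, k) (\<Sum>l<n. symbolic_entry m j l * v l) =
     (if k = 0 then const_apply n (m (Some i)) v j else 0)
     + (\<Sum>l<n. symbolic_entry m j l * partial_deriv (i, k) (v l))"
  by (simp add: partial_deriv_sum partial_deriv_mult partial_symbolic_entry sum.distrib const_apply_def)

text \<open>
  \<open>nab = e d/dt - A\<close> preserves the kernel, and so does \<open>\<partial>/\<partial>p\<^sup>(\<^sup>k\<^sup>)\<close> for large \<open>k\<close>. As the
  commutator of \<open>\<partial>/\<partial>p\<^sup>(\<^sup>k\<^sup>+\<^sup>1\<^sup>)\<close> and \<open>nab\<close> is \<open>e \<partial>/\<partial>p\<^sup>(\<^sup>k\<^sup>)\<close>, all partial derivatives preserve the kernel;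
  the commutator for \<open>k = 0\<close> is \<open>- A\<^sub>i\<close>.
\<close>

lemma ct_kernel_invariant:
  fixes ob :: "nat \<Rightarrow> nat \<Rightarrow> nat \<Rightarrow> ('p::finite \<times> nat) analytic_fun" and a c :: "'p option \<Rightarrow> nat \<Rightarrow> nat \<Rightarrow> real"
  assumes ob_0: "\<And>r k. r < ny \<Longrightarrow> k < n \<Longrightarrow> ob 0 r k = symbolic_entry c r k"
    and ob_Suc: "\<And>j r k. r < ny \<Longrightarrow> k < n \<Longrightarrow>
      ob (Suc j) r k = const_fn e * time_deriv (ob j r k) + (\<Sum>l<n. ob j r l * symbolic_entry a l k)"
    and e: "e \<noteq> 0"
    and v: "v \<in> kernel_upto n ny ob n" "l < n" "v l \<noteq> 0"
  obtains W where "v \<in> W" "\<And>w i. w \<in> W \<Longrightarrow> const_apply n (a i) w \<in> W"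
    "\<And>w i r. w \<in> W \<Longrightarrow> r < ny \<Longrightarrow> const_apply n (c i) w r = 0"
proof -
  define nab where "nab w k = const_fn e * time_deriv (w k) - (\<Sum>l<n. symbolic_entry a k l * w l)" for w :: "nat \<Rightarrow> ('p \<times> nat) analytic_fun" and k
  \<comment> \<open>By the product rule \<open>nab\<close> is the negative adjoint of the row
    recursion, up to the time derivative of a pairing that vanishes on the kernel.\<close>
  have key: "(\<Sum>k<n. ob (Suc j) r k * w k) = const_fn e * time_deriv (\<Sum>k<n. ob j r k * w k) - (\<Sum>k<n. ob j r k * nab w k)"
    if "r < ny" for j r w
  proof -
    have "(\<Sum>k<n. \<Sum>l<n. ob j r l * symbolic_entry a l k * w k) = (\<Sum>k<n. ob j r k * (\<Sum>l<n. symbolic_entry a k l * w l))"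
      by (subst sum.swap) (simp add: sum_distrib_left mult_ac)
    moreover have "(\<Sum>k<n. ob (Suc j) r k * w k) = const_fn e * (\<Sum>k<n. time_deriv (ob j r k) * w k)
        + (\<Sum>k<n. \<Sum>l<n. ob j r l * symbolic_entry a l k * w k)"
      using that by (simp add: ob_Suc distrib_right sum.distrib sum_distrib_left sum_distrib_right mult.assoc)
    moreover have "(\<Sum>k<n. ob j r k * nab w k) = const_fn e * (\<Sum>k<n. ob j r k * time_deriv (w k))
        - (\<Sum>k<n. ob j r k * (\<Sum>l<n. symbolic_entry a k l * w l))"
      by (simp add: nab_def right_diff_distrib sum_subtractf sum_distrib_left mult.left_commute)
    moreover have "time_deriv (\<Sum>k<n. ob j r k * w k) =
        (\<Sum>k<n. time_deriv (ob j r k) * w k) + (\<Sum>k<n. ob j r k * time_deriv (w k))"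
      by (simp add: time_deriv_sum time_deriv_mult sum.distrib)
    ultimately show ?thesis by (simp add: distrib_left)
  qed
  have key': "(\<Sum>k<n. ob j r k * nab w k) = - (\<Sum>k<n. ob (Suc j) r k * w k)"
    if "w \<in> kernel_upto n ny ob (Suc j)" "r < ny" for j r w
    using key[OF that(2), of j w] that by (simp add: kernel_upto_def)
  have down: "nab w \<in> kernel_upto n ny ob k" if "w \<in> kernel_upto n ny ob (Suc k)" for k w
    unfolding kernel_upto_def
  proof (intro CollectI allI impI)
    fix j r assume jr: "j < k" "r < ny"
    then have "w \<in> kernel_upto n ny ob (Suc j)"
      using that kernel_upto_antimono[of "Suc j" "Suc k" n ny ob] by auto
    from key'[OF this jr(2)] show "(\<Sum>c<n. ob j r c * nab w c) = 0"
      using that jr by (simp add: kernel_upto_def)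
  qed
  have up: "w \<in> kernel_upto n ny ob (Suc (Suc k))"
    if "w \<in> kernel_upto n ny ob (Suc k)" "nab w \<in> kernel_upto n ny ob (Suc k)" for k w
    unfolding kernel_upto_Suc[of w n ny ob "Suc k"] using key'[OF that(1)] that by (simp add: kernel_upto_def)
  obtain m where m: "\<And>k. kernel_upto n ny ob m \<subseteq> kernel_upto n ny ob k" "v \<in> kernel_upto n ny ob m"
    using kernel_upto_stabilises[of n ny ob nab v l] down up v by blast
  define W where "W = kernel_upto n ny ob m"
  have W_all: "(\<Sum>c<n. ob j r c * w c) = 0" if "w \<in> W" "r < ny" for j r w
    using that m(1)[of "Suc j"] by (auto simp: W_def kernel_upto_def)
  have W_nabla: "nab w \<in> W" if "w \<in> W" for w
    using that m(1)[of "Suc m"] down by (auto simp: W_def)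
  \<comment> \<open>Row \<open>0\<close> involves order 0 only, and each step of the recursion
    raises the order of the derivatives of \<open>p\<close> by at most one.\<close>
  have supp: "partial_deriv (i, k) (ob j r c) = 0" if "j < k" "r < ny" "c < n" for i k j r c
    using that
  proof (induction j arbitrary: k c)
    case 0
    then show ?case by (simp add: ob_0 partial_symbolic_entry)
  next
    case (Suc j)
    then obtain k' where k: "k = Suc k'" "j < k'" by (cases k) auto
    have "partial_deriv (i, k) (ob j r l) = 0" if "l < n" for l
      using Suc.IH[of k l] Suc.prems that by simp
    moreover have "partial_deriv (i, k') (ob j r c) = 0"
      using Suc.IH[of k' c] Suc.prems k by simp
    ultimately show ?case
      using Suc.prems k(1)
      by (simp add: ob_Suc partial_deriv_add partial_deriv_mult partial_deriv_sum partial_time_deriv partial_symbolic_entry)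
  qed
  \<comment> \<open>The rows that define \<open>W\<close> have indices below \<open>m\<close> and do
    not involve the variable \<open>(i, k)\<close>, so the differentiation falls on \<open>w\<close>
    alone.\<close>
  have partial_large: "(\<lambda>c. partial_deriv (i, k) (w c)) \<in> W" if "w \<in> W" "m \<le> k" for w i k
    unfolding W_def kernel_upto_def
  proof (intro CollectI allI impI)
    fix j r assume jr: "j < m" "r < ny"
    have "0 = partial_deriv (i, k) (\<Sum>c<n. ob j r c * w c)" using W_all[OF that(1) jr(2)] by simp
    also have "\<dots> = (\<Sum>c<n. ob j r c * partial_deriv (i, k) (w c))"
      using jr that supp[of j k r _ i] by (simp add: partial_deriv_sum partial_deriv_mult)
    finally show "(\<Sum>c<n. ob j r c * partial_deriv (i, k) (w c)) = 0" by simp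
  qed
  have comm: "partial_deriv (i, k) (nab w j) = nab (\<lambda>c. partial_deriv (i, k) (w c)) j +
      (case k of 0 \<Rightarrow> - const_apply n (a (Some i)) w j | Suc k' \<Rightarrow> const_fn e * partial_deriv (i, k') (w j))" for i k w j
    unfolding nab_def partial_deriv_diff partial_symbolic_entry_apply
    by (cases k) (simp_all add: partial_deriv_mult partial_time_deriv algebra_simps)
  \<comment> \<open>Downward in \<open>k\<close>: the commutator of \<open>nab\<close> with the
    derivative along \<open>(i, Suc k)\<close> is the derivative along \<open>(i, k)\<close> times
    \<open>e\<close>, and \<open>e\<close> is cancelled.\<close>
  have partial_all: "\<forall>w\<in>W. (\<lambda>c. partial_deriv (i, k) (w c)) \<in> W" for i k
  proof (induction "m - k" arbitrary: k)
    case 0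
    then show ?case using partial_large by simp
  next
    case (Suc d)
    then have IH: "\<forall>w\<in>W. (\<lambda>c. partial_deriv (i, Suc k) (w c)) \<in> W" by (metis Suc_diff_Suc diff_Suc_1 zero_less_Suc zero_less_diff)
    show ?case
    proof
      fix w assume w: "w \<in> W"
      have "(\<lambda>c. partial_deriv (i, Suc k) (nab w c) - nab (\<lambda>c. partial_deriv (i, Suc k) (w c)) c) \<in> W"
        using IH w W_nabla unfolding W_def by (intro kernel_upto_diff) auto
      then have "(\<lambda>c. const_fn e * partial_deriv (i, k) (w c)) \<in> W" by (simp add: comm)
      then show "(\<lambda>c. partial_deriv (i, k) (w c)) \<in> W"
        unfolding W_def by (rule kernel_upto_scaleD) (simp add: e const_fn_eq_0_iff)
    qed
  qed
  have A_i: "const_apply n (a (Some i)) w \<in> W" if w: "w \<in> W" for w i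
  proof -
    have "(\<lambda>c. nab (\<lambda>c. partial_deriv (i, 0) (w c)) c - partial_deriv (i, 0) (nab w c)) \<in> W"
      using partial_all w W_nabla unfolding W_def by (intro kernel_upto_diff) auto
    then show ?thesis by (simp add: comm)
  qed
  \<comment> \<open>The time derivative of \<open>w\<close> is a combination of partial derivatives
    with ring coefficients; a common finite support for all \<open>n\<close> entries makes it one
    sum of vectors.\<close>
  have D: "(\<lambda>c. time_deriv (w c)) \<in> W" if w: "w \<in> W" for w
  proof -
    obtain S where S: "finite S" "\<And>F u. F \<in> w ` {..<n} \<Longrightarrow> u \<notin> S \<Longrightarrow> partial_deriv u F = 0"
      by (rule common_support[of "w ` {..<n}"]) auto
    have "(\<lambda>c. \<Sum>u\<in>S. coord_fn (fst u, Suc (snd u)) * partial_deriv u (w c)) \<in> W"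
      unfolding W_def by (rule kernel_upto_sum) (use partial_all w in \<open>auto simp: W_def\<close>)
    then show ?thesis
      unfolding W_def by (subst kernel_upto_cong) (simp_all add: time_deriv_eq[OF S] mult.commute)
  qed
  \<comment> \<open>With \<open>d/dt\<close> and the matrices \<open>a (Some i)\<close> under
    control, subtracting their contributions from \<open>nab\<close> leaves
    \<open>a None\<close>.\<close>
  have A_0: "const_apply n (a None) w \<in> W" if w: "w \<in> W" for w
  proof -
    have "(\<lambda>k. const_fn e * time_deriv (w k) - nab w k - (\<Sum>i\<in>UNIV. coord_fn (i, 0) * const_apply n (a (Some i)) w k)) \<in> W"
      using w D W_nabla A_i unfolding W_def
      by (intro kernel_upto_diff kernel_upto_sum kernel_upto_scale) auto
    then show ?thesis by (simp add: nab_def symbolic_entry_apply)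
  qed
  \<comment> \<open>Differentiating the relation of row 0 along \<open>(i, 0)\<close> leaves only
    the constant matrix, because the derivative of \<open>w\<close> satisfies the relation as
    well.\<close>
  have C_i: "const_apply n (c (Some i)) w r = 0" if w: "w \<in> W" and r: "r < ny" for w r i
  proof -
    have eq: "(\<Sum>l<n. symbolic_entry c r l * u l) = 0" if "u \<in> W" for u
      using W_all[OF that r, of 0] r by (simp add: ob_0)
    show ?thesis
      using partial_symbolic_entry_apply[of i 0 c r w n] eq[OF w] eq[OF partial_all[rule_format, OF w, of i 0]] by simp
  qed
  have C_0: "const_apply n (c None) w r = 0" if w: "w \<in> W" and r: "r < ny" for w r
    using W_all[OF w r, of 0] r C_i[OF w r] by (simp add: ob_0 symbolic_entry_apply)
  show ?thesis
  proof (rule that[of W])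
    show "v \<in> W" using m by (simp add: W_def)
    show "const_apply n (a i) w \<in> W" if "w \<in> W" for w i
      using A_0 A_i that by (cases i) auto
    show "const_apply n (c i) w r = 0" if "w \<in> W" "r < ny" for w i r
      using C_0 C_i that by (cases i) auto
  qed
qed

section \<open>Kernels over the ring of analytic functions: discrete time\<close>

lemma time_shift_add: "time_shift s (F + G) = time_shift s F + time_shift s G"
  by transfer simp

lemma time_shift_mult: "time_shift s (F * G) = time_shift s F * time_shift s G"
  by transfer simp

lemma time_shift_0 [simp]: "time_shift s 0 = 0"
  by transfer simp

lemma time_shift_coord: "time_shift s (coord_fn (i, k)) = coord_fn (i, k + s)"
  by transfer (simp add: fun_eq_iff)

lemma time_shift_sum: "time_shift s (sum F S) = (\<Sum>x\<in>S. time_shift s (F x))"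
  by (induction S rule: infinite_finite_induct) (simp_all add: time_shift_add)

lemma time_shift_inverse: "time_shift s (time_shift (- s) F) = F" "time_shift (- s) (time_shift s F) = F"
  by (transfer; simp add: o_def case_prod_unfold)+

lemma time_shift_eq_0_iff: "time_shift s F = 0 \<longleftrightarrow> F = 0"
  by (metis time_shift_0 time_shift_inverse(2))

text \<open>The variable \<open>(i, k)\<close> enters the shifted function in the place of the
  variable \<open>(i, k - s)\<close> of \<open>F\<close>.\<close>

lemma partial_time_shift: "partial_deriv (i, k) (time_shift s F) = time_shift s (partial_deriv (i, k - s) F)"
proof (transfer, rule ext)
  fix i :: 'a and k s :: int and f :: "('a \<times> int \<Rightarrow> real) \<Rightarrow> real" and x :: "'a \<times> int \<Rightarrow> real"
  have "x(((i, k)) := t) \<circ> (\<lambda>(i, k). (i, k + s)) = (x \<circ> (\<lambda>(i, k). (i, k + s)))((i, k - s) := t)" for t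
    by (auto simp: fun_eq_iff)
  then show "deriv (\<lambda>t. f (x((i, k) := t) \<circ> (\<lambda>(i, k). (i, k + s)))) (x (i, k)) =
      deriv (\<lambda>t. f ((x \<circ> (\<lambda>(i, k). (i, k + s)))((i, k - s) := t))) ((x \<circ> (\<lambda>(i, k). (i, k + s))) (i, k - s))"
    by simp
qed

text \<open>
  A linearly independent family of maximal size in the kernel spans it up to denominators, and so
  does its image under the injective map \<open>nab\<close>.
\<close>

lemma semilinear_image_spans:
  fixes W :: "(nat \<Rightarrow> 'a::idom) set"
  assumes W: "\<And>w. w \<in> W \<Longrightarrow> nab w \<in> W"
    and inj: "\<And>d u (m::nat). (\<And>c. c < n \<Longrightarrow> (\<Sum>j<m. d j * nab (u j) c) = 0) \<Longrightarrow>
      \<exists>d'. (\<forall>c<n. (\<Sum>j<m. d' j * u j c) = 0) \<and> (\<forall>j<m. d' j = 0 \<longrightarrow> d j = 0)"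
    and v: "v \<in> W"
  shows "\<exists>k d u (m::nat). k \<noteq> 0 \<and> (\<forall>j<m. u j \<in> W) \<and> (\<forall>c<n. k * v c = (\<Sum>j<m. d j * nab (u j) c))"
proof -
  define indep :: "nat \<Rightarrow> (nat \<Rightarrow> nat \<Rightarrow> 'a) \<Rightarrow> bool" where
    "indep m u \<longleftrightarrow> (\<forall>d. (\<forall>c<n. (\<Sum>j<m. d j * u j c) = 0) \<longrightarrow> (\<forall>j<m. d j = 0))" for m u
  define Q where "Q m \<longleftrightarrow> (\<exists>u. (\<forall>j<m. u j \<in> W) \<and> indep m u)" for m
  have "Q 0" by (simp add: Q_def indep_def)
  \<comment> \<open>Bounds the sizes of independent families, so that a greatest one exists.\<close>
  have bd: "m \<le> n" if Qm: "Q m" for m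
  proof (rule ccontr)
    assume "\<not> m \<le> n"
    then have nm: "n < m" by simp
    obtain u where u: "indep m u" using Qm by (auto simp: Q_def)
    obtain d where d: "(\<exists>j<m. d j \<noteq> 0) \<and> (\<forall>c<n. (\<Sum>j<m. d j * u j c) = 0)"
      using idom_dependent[OF nm, of u] by (rule exE)
    then obtain j where j: "j < m" "d j \<noteq> 0" by blast
    have "d j = 0"
      by (rule u[unfolded indep_def, rule_format, of d j, OF _ j(1)]) (simp add: d)
    with j(2) show False by simp
  qed
  define m where "m = (GREATEST m. Q m)"
  have m: "Q m" "\<And>l. Q l \<Longrightarrow> l \<le> m"
    unfolding m_def by (rule GreatestI_nat[of Q 0 n, OF \<open>Q 0\<close> bd], assumption) (rule Greatest_le_nat[of Q _ n, OF _ bd], assumption+)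
  obtain u where u: "\<And>j. j < m \<Longrightarrow> u j \<in> W" "indep m u" using m(1) by (auto simp: Q_def)
  have ind: "indep m (\<lambda>j. nab (u j))"
    unfolding indep_def
  proof (intro allI impI)
    fix d j assume d: "\<forall>c<n. (\<Sum>j<m. d j * nab (u j) c) = 0" and j: "j < m"
    have "\<exists>d'. (\<forall>c<n. (\<Sum>j<m. d' j * u j c) = 0) \<and> (\<forall>j<m. d' j = 0 \<longrightarrow> d j = 0)"
      by (rule inj) (use d in simp)
    then obtain d' where d': "\<forall>c<n. (\<Sum>j<m. d' j * u j c) = 0" "\<forall>j<m. d' j = 0 \<longrightarrow> d j = 0"
      by (elim exE conjE)
    have "d' j = 0"
      by (rule u(2)[unfolded indep_def, rule_format, of d' j, OF _ j]) (simp add: d'(1))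
    with d'(2) j show "d j = 0" by simp
  qed
  \<comment> \<open>Adjoining \<open>v\<close> to the \<open>m\<close> images exceeds the maximal
    size and forces a relation; since the images alone are independent, \<open>v\<close> has a
    non-zero coefficient in it.\<close>
  define w where "w j = (if j < m then nab (u j) else v)" for j
  have "\<not> indep (Suc m) w"
  proof
    assume "indep (Suc m) w"
    moreover have "w j \<in> W" for j
      by (cases "j < m") (simp_all add: w_def W u(1) v)
    ultimately have "Q (Suc m)" unfolding Q_def by blast
    from m(2)[OF this] show False by simp
  qed
  then obtain d i where d: "\<And>c. c < n \<Longrightarrow> (\<Sum>j<Suc m. d j * w j c) = 0" and i: "i < Suc m" "d i \<noteq> 0"
    unfolding indep_def by blast
  have eq: "(\<Sum>j<m. d j * nab (u j) c) + d m * v c = 0" if "c < n" for c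
    using d[OF that] by (simp add: w_def)
  have "d m \<noteq> 0"
  proof
    assume "d m = 0"
    have "d j = 0" if "j < m" for j
      by (rule ind[unfolded indep_def, rule_format, of d j, OF _ that]) (use eq \<open>d m = 0\<close> in simp)
    with \<open>d m = 0\<close> i show False by (auto simp: less_Suc_eq)
  qed
  moreover have "d m * v c = (\<Sum>j<m. - d j * nab (u j) c)" if "c < n" for c
    using eq[OF that] by (simp add: sum_negf eq_neg_iff_add_eq_0 add.commute)
  ultimately show ?thesis
    using u(1) by (intro exI[of _ "d m"] exI[of _ "\<lambda>j. - d j"] exI[of _ u] exI[of _ m]) simp
qed

text \<open>
  Here \<open>nab v = q\<^sup>-\<^sup>s (A v)\<close> preserves the kernel, which is invariant under all \<open>\<partial>/\<partial>p\<^sub>s\<^sub>l\<close>, \<open>l \<ge> 0\<close>,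
  by downward induction on \<open>l\<close>, as \<open>\<partial>/\<partial>p\<^sub>s\<^sub>l nab = nab \<partial>/\<partial>p\<^sub>s\<^sub>(\<^sub>l\<^sub>+\<^sub>1\<^sub>)\<close> for \<open>l \<ge> 0\<close>. For \<open>l = - 1\<close> there is
  the additional summand \<open>q\<^sup>-\<^sup>s (A\<^sub>i v)\<close>.
\<close>

lemma dt_kernel_invariant:
  fixes ob :: "nat \<Rightarrow> nat \<Rightarrow> nat \<Rightarrow> ('p::finite \<times> int) analytic_fun" and a c :: "'p option \<Rightarrow> nat \<Rightarrow> nat \<Rightarrow> real"
  assumes ob_0: "\<And>r k. r < ny \<Longrightarrow> k < n \<Longrightarrow> ob 0 r k = symbolic_entry c r k"
    and ob_Suc: "\<And>j r k. r < ny \<Longrightarrow> k < n \<Longrightarrow>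
      ob (Suc j) r k = (\<Sum>l<n. time_shift s (ob j r l) * symbolic_entry a l k)"
    and s: "s = 1 \<or> s = - 1"
    and inj: "\<forall>u :: nat \<Rightarrow> ('p \<times> int) analytic_fun.
      (\<forall>k<n. (\<Sum>l<n. symbolic_entry a k l * u l) = 0) \<longrightarrow> (\<forall>l<n. u l = 0)"
    and v: "v \<in> kernel_upto n ny ob n" "l < n" "v l \<noteq> 0"
  obtains W where "v \<in> W" "\<And>w i. w \<in> W \<Longrightarrow> (\<lambda>k. time_shift (- s) (const_apply n (a i) w k)) \<in> W"
    "\<And>w i r. w \<in> W \<Longrightarrow> r < ny \<Longrightarrow> const_apply n (c i) w r = 0"
proof -
  define nab where "nab w k = time_shift (- s) (\<Sum>l<n. symbolic_entry a k l * w l)"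
    for w :: "nat \<Rightarrow> ('p \<times> int) analytic_fun" and k
  \<comment> \<open>The shift in \<open>nab\<close> undoes the one in the recursion. As shifting is
    injective, vanishing of one pairing is equivalent to vanishing of the other, which gives both
    \<open>down\<close> and \<open>up\<close>.\<close>
  have key: "(\<Sum>k<n. ob j r k * nab w k) = time_shift (- s) (\<Sum>k<n. ob (Suc j) r k * w k)"
    if "r < ny" for j r w
  proof -
    have "(\<Sum>k<n. ob (Suc j) r k * w k) = (\<Sum>k<n. \<Sum>l<n. time_shift s (ob j r l) * symbolic_entry a l k * w k)"
      using that by (simp add: ob_Suc sum_distrib_right)
    also have "\<dots> = (\<Sum>l<n. time_shift s (ob j r l) * (\<Sum>k<n. symbolic_entry a l k * w k))"
      by (subst sum.swap) (simp add: sum_distrib_left mult.assoc)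
    finally show ?thesis
      by (simp add: nab_def time_shift_sum time_shift_mult time_shift_inverse)
  qed
  have down: "nab w \<in> kernel_upto n ny ob k" if "w \<in> kernel_upto n ny ob (Suc k)" for k w
    using that by (auto simp: kernel_upto_def key)
  have up: "w \<in> kernel_upto n ny ob (Suc (Suc k))"
    if "w \<in> kernel_upto n ny ob (Suc k)" "nab w \<in> kernel_upto n ny ob (Suc k)" for k w
    unfolding kernel_upto_Suc[of w n ny ob "Suc k"]
    using that by (auto simp: kernel_upto_def key time_shift_eq_0_iff)
  obtain m where m: "\<And>k. kernel_upto n ny ob m \<subseteq> kernel_upto n ny ob k" "v \<in> kernel_upto n ny ob m"
    using kernel_upto_stabilises[of n ny ob nab v l] down up v by blast
  define W where "W = kernel_upto n ny ob m"
  have W_all: "(\<Sum>c<n. ob j r c * w c) = 0" if "w \<in> W" "r < ny" for j r w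
    using that m(1)[of "Suc j"] by (auto simp: W_def kernel_upto_def)
  have W_nab: "nab w \<in> W" if "w \<in> W" for w
    using that m(1)[of "Suc m"] down by (auto simp: W_def)
  have ss: "s * s = 1" "s \<noteq> 0" using s by auto
  \<comment> \<open>Writing the shift as \<open>s * k\<close> treats both time directions alike: row
    \<open>j\<close> only involves \<open>0 \<le> k \<le> j\<close>.\<close>
  have supp: "partial_deriv (i, s * k) (ob j r c) = 0" if "int j < k \<or> k < 0" "r < ny" "c < n" for i k j r c
    using that
  proof (induction j arbitrary: k c)
    case 0
    then show ?case using ss by (auto simp add: ob_0 partial_symbolic_entry)
  next
    case (Suc j)
    have "partial_deriv (i, s * (k - 1)) (ob j r l) = 0" if "l < n" for l
      using Suc.IH[of "k - 1" l] Suc.prems that by auto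
    then show ?case
      using Suc.prems ss
      by (auto simp add: ob_Suc partial_deriv_mult partial_deriv_sum partial_time_shift partial_symbolic_entry
        right_diff_distrib)
  qed
  have partial_large: "(\<lambda>c. partial_deriv (i, s * k) (w c)) \<in> W" if "w \<in> W" "int m \<le> k \<or> k < 0" for w i k
    unfolding W_def kernel_upto_def
  proof (intro CollectI allI impI)
    fix j r assume jr: "j < m" "r < ny"
    have "0 = partial_deriv (i, s * k) (\<Sum>c<n. ob j r c * w c)" using W_all[OF that(1) jr(2)] by simp
    also have "\<dots> = (\<Sum>c<n. ob j r c * partial_deriv (i, s * k) (w c))"
      using jr that(2) supp[of j k r _ i] by (auto simp add: partial_deriv_sum partial_deriv_mult)
    finally show "(\<Sum>c<n. ob j r c * partial_deriv (i, s * k) (w c)) = 0" by simp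
  qed
  have comm: "partial_deriv (i, s * k) (nab w j) = nab (\<lambda>c. partial_deriv (i, s * (k + 1)) (w c)) j +
      (if k = - 1 then time_shift (- s) (const_apply n (a (Some i)) w j) else 0)" for i k w j
  proof -
    have "s * k - - s = s * (k + 1)" "s * (k + 1) = 0 \<longleftrightarrow> k = - 1"
      using s by (auto simp: algebra_simps)
    then show ?thesis
      unfolding nab_def partial_time_shift partial_symbolic_entry_apply
      by (simp add: time_shift_add partial_symbolic_entry_apply)
  qed
  \<comment> \<open>\<open>nab\<close> is semilinear: a coefficient passes through it at the price
    of a shift, so a relation among images yields one among the original vectors.\<close>
  have nab_lin: "(\<Sum>j<l. d j * nab (u j) k) = time_shift (- s) (\<Sum>b<n. symbolic_entry a k b * (\<Sum>j<l. time_shift s (d j) * u j b))"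
    for l d u k
  proof -
    have "(\<Sum>b<n. symbolic_entry a k b * (\<Sum>j<l. time_shift s (d j) * u j b))
        = (\<Sum>j<l. time_shift s (d j) * (\<Sum>b<n. symbolic_entry a k b * u j b))"
      by (simp add: sum_distrib_left mult.left_commute) (rule sum.swap)
    then show ?thesis
      by (simp add: nab_def time_shift_sum time_shift_mult time_shift_inverse)
  qed
  have partial_all: "\<forall>w\<in>W. (\<lambda>c. partial_deriv (i, s * int k) (w c)) \<in> W" for i k
  proof (induction "m - k" arbitrary: k)
    case 0
    then show ?case using partial_large by simp
  next
    case (Suc d)
    then have "d = m - Suc k" by simp
    from Suc.hyps(1)[OF this] have IH: "\<forall>w\<in>W. (\<lambda>c. partial_deriv (i, s * (int k + 1)) (w c)) \<in> W"
      by (simp add: algebra_simps)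
    show ?case
    proof
      fix w assume w: "w \<in> W"
      \<comment> \<open>The rule \<open>comm\<close> covers only the image of \<open>nab\<close>. A
        multiple of \<open>w\<close> is therefore written as a combination of images and
        differentiated by the product rule, and the multiplier is cancelled at the end.\<close>
      have "\<exists>b d u (l::nat). b \<noteq> 0 \<and> (\<forall>j<l. u j \<in> W) \<and> (\<forall>c<n. b * w c = (\<Sum>j<l. d j * nab (u j) c))"
      proof (rule semilinear_image_spans[of W nab n w, OF W_nab _ w])
        fix d u and l :: nat assume *: "\<And>c. c < n \<Longrightarrow> (\<Sum>j<l. d j * nab (u j) c) = 0"
        have "(\<Sum>j<l. time_shift s (d j) * u j c) = 0" if "c < n" for c
          by (rule inj[rule_format, OF _ that]) (use * in \<open>simp add: nab_lin time_shift_eq_0_iff\<close>)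
        then show "\<exists>d'. (\<forall>c<n. (\<Sum>j<l. d' j * u j c) = 0) \<and> (\<forall>j<l. d' j = 0 \<longrightarrow> d j = 0)"
          by (intro exI[of _ "\<lambda>j. time_shift s (d j)"]) (simp add: time_shift_eq_0_iff)
      qed
      then obtain b d u and l :: nat where "b \<noteq> 0 \<and> (\<forall>j<l. u j \<in> W) \<and> (\<forall>c<n. b * w c = (\<Sum>j<l. d j * nab (u j) c))"
        by (elim exE)
      then have b: "b \<noteq> 0" and u: "\<And>j. j < l \<Longrightarrow> u j \<in> W"
        and eq: "\<And>c. c < n \<Longrightarrow> b * w c = (\<Sum>j<l. d j * nab (u j) c)" by simp_all
      let ?dk = "partial_deriv (i, s * int k)"
      have nabu: "(\<lambda>c. ?dk (nab (u j) c)) \<in> W" if "j < l" for j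
        unfolding comm using W_nab[OF IH[rule_format, OF u[OF that]]] by simp
      let ?rhs = "\<lambda>c. ((\<Sum>j<l. ?dk (d j) * nab (u j) c) + (\<Sum>j<l. d j * ?dk (nab (u j) c))) - ?dk b * w c"
      have rhs: "?rhs \<in> W"
        unfolding W_def
        by (intro kernel_upto_diff kernel_upto_add kernel_upto_sum kernel_upto_scale)
          (use nabu W_nab u w in \<open>auto simp: W_def\<close>)
      have "b * ?dk (w c) = ?rhs c" if "c < n" for c
      proof -
        have "?dk b * w c + b * ?dk (w c) = (\<Sum>j<l. ?dk (d j) * nab (u j) c) + (\<Sum>j<l. d j * ?dk (nab (u j) c))"
          using arg_cong[OF eq[OF that], of "?dk"]
          unfolding partial_deriv_mult partial_deriv_sum sum.distrib .
        then show ?thesis by (simp only: eq_diff_eq add.commute[of "?dk b * w c"])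
      qed
      then have "(\<lambda>c. b * ?dk (w c)) \<in> W \<longleftrightarrow> ?rhs \<in> W"
        unfolding W_def by (rule kernel_upto_cong)
      with rhs have "(\<lambda>c. b * ?dk (w c)) \<in> W" by simp
      then show "(\<lambda>c. ?dk (w c)) \<in> W"
        unfolding W_def by (rule kernel_upto_scaleD[OF _ b])
    qed
  qed
  have partial_0: "(\<lambda>c. partial_deriv (i, 0) (w c)) \<in> W" if "w \<in> W" for w i
    using partial_all[of i 0] that by simp
  have A_i: "(\<lambda>k. time_shift (- s) (const_apply n (a (Some i)) w k)) \<in> W" if w: "w \<in> W" for w i
  proof -
    \<comment> \<open>At \<open>k = - 1\<close> both terms lie in \<open>W\<close>: the rows do not
      involve that variable, and \<open>nab\<close> preserves \<open>W\<close>. Their difference is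
      the extra summand of \<open>comm\<close>.\<close>
    have "(\<lambda>c. partial_deriv (i, s * (- 1)) (nab w c) - nab (\<lambda>c. partial_deriv (i, 0) (w c)) c) \<in> W"
      using partial_large[of "nab w" "- 1" i] partial_0[OF w] w W_nab
      unfolding W_def by (intro kernel_upto_diff) auto
    then show ?thesis by (subst (asm) comm) simp
  qed
  have A_0: "(\<lambda>k. time_shift (- s) (const_apply n (a None) w k)) \<in> W" if w: "w \<in> W" for w
  proof -
    \<comment> \<open>The shift contained in \<open>nab\<close> moves the coordinates of
      \<open>A(p)\<close> from \<open>(i, 0)\<close> to \<open>(i, - s)\<close>.\<close>
    have "(\<lambda>k. nab w k - (\<Sum>i\<in>UNIV. coord_fn (i, - s) * time_shift (- s) (const_apply n (a (Some i)) w k))) \<in> W"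
      using w W_nab A_i unfolding W_def
      by (intro kernel_upto_diff kernel_upto_sum kernel_upto_scale) auto
    then show ?thesis
      by (simp add: nab_def symbolic_entry_apply time_shift_add time_shift_sum time_shift_mult time_shift_coord)
  qed
  have C_i: "const_apply n (c (Some i)) w r = 0" if w: "w \<in> W" and r: "r < ny" for w r i
  proof -
    have eq: "(\<Sum>l<n. symbolic_entry c r l * u l) = 0" if "u \<in> W" for u
      using W_all[OF that r, of 0] r by (simp add: ob_0)
    show ?thesis
      using partial_symbolic_entry_apply[of i 0 c r w n] eq[OF w] eq[OF partial_0[OF w, of i]] by simp
  qed
  have C_0: "const_apply n (c None) w r = 0" if w: "w \<in> W" and r: "r < ny" for w r
    using W_all[OF w r, of 0] r C_i[OF w r] by (simp add: ob_0 symbolic_entry_apply)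
  show ?thesis
  proof (rule that[of W])
    show "v \<in> W" using m by (simp add: W_def)
    show "(\<lambda>k. time_shift (- s) (const_apply n (a i) w k)) \<in> W" if "w \<in> W" for w i
      using A_0 A_i that by (cases i) auto
    show "const_apply n (c i) w r = 0" if "w \<in> W" "r < ny" for w i r
      using C_0 C_i that by (cases i) auto
  qed
qed

section \<open>Rank defects and quotients\<close>

lemma mult_unit_vec_col:
  "A \<in> carrier_mat n m \<Longrightarrow> j < m \<Longrightarrow> A *\<^sub>v unit_vec m j = col A j" for A :: "'a::semiring_1 mat"
  by (intro eq_vecI) auto

text \<open>Independence of the set of columns does not see repetitions, so two equal columns are
  treated apart, by a difference of unit vectors.\<close>

lemma (in vec_space) rank_deficient_kernel:
  assumes A: "A \<in> carrier_mat n nc" and rank: "rank A \<noteq> nc"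
  shows "\<exists>v\<in>carrier_vec nc. v \<noteq> 0\<^sub>v nc \<and> A *\<^sub>v v = 0\<^sub>v n"
proof (cases "distinct (cols A)")
  case True
  with lin_indpt_full_rank[OF A] rank have "lin_dep (set (cols A))" by blast
  from lin_depE[OF A this True] show ?thesis by blast
next
  case False
  then obtain i j where ij: "i < nc" "j < nc" "i \<noteq> j" "col A i = col A j"
    using A by (auto simp: distinct_conv_nth)
  define v where "v = unit_vec nc i - (unit_vec nc j :: 'a Matrix.vec)"
  have "v $ i \<noteq> 0" using ij by (simp add: v_def)
  then have "v \<noteq> 0\<^sub>v nc" using ij by auto
  moreover have "A *\<^sub>v v = 0\<^sub>v n"
  proof -
    have "A *\<^sub>v v = A *\<^sub>v unit_vec nc i - A *\<^sub>v unit_vec nc j"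
      unfolding v_def by (rule mult_minus_distrib_mat_vec[OF A]) auto
    also have "\<dots> = 0\<^sub>v n" using ij A by (simp add: mult_unit_vec_col[OF A])
    finally show ?thesis .
  qed
  ultimately show ?thesis by (intro bexI[of _ v]) (simp_all add: v_def)
qed

text \<open>A maximal independent set of columns has fewer than \<open>n\<close> elements; a vector
  orthogonal to it annihilates its span and thereby all columns.\<close>

lemma (in vec_space) rank_deficient_left_kernel:
  assumes A: "A \<in> carrier_mat n nc" and rank: "rank A \<noteq> n"
  shows "\<exists>v\<in>carrier_vec n. v \<noteq> 0\<^sub>v n \<and> (\<forall>c\<in>set (cols A). v \<bullet> c = 0)"
proof -
  have colsA: "set (cols A) \<subseteq> carrier_vec n" using A cols_dim by blast
  obtain S where S: "maximal S (\<lambda>T. T \<subseteq> set (cols A) \<and> lin_indpt T)"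
    using maximal_exists_superset[of "set (cols A)" "\<lambda>T. T \<subseteq> set (cols A) \<and> lin_indpt T" "{}"]
    by (auto simp: lin_dep_def)
  then have Scols: "S \<subseteq> set (cols A)" and li: "lin_indpt S" by (auto simp: maximal_def)
  have Sn: "S \<subseteq> carrier_vec n" using Scols colsA by blast
  have fin: "finite S" using Scols finite_subset by blast
  have "card S = rank A" using rank_card_indpt[OF A S] by simp
  moreover have "card S \<le> n" using li_le_dim(2)[OF fin_dim _ li] Sn by (simp add: dim_is_n)
  ultimately have card: "card S < n" using rank by simp
  obtain cs where cs: "set cs = S" "distinct cs" using finite_distinct_list[OF fin] by blast
  have len: "length cs < n" using cs card distinct_card by fastforce
  \<comment> \<open>The chosen columns as rows, filled up with at least one zero row, which makes
    \<open>Q\<close> singular.\<close>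
  define Q where "Q = Matrix.mat n n (\<lambda>(i, j). if i < length cs then (cs ! i) $ j else 0)"
  have Q: "Q \<in> carrier_mat n n" by (simp add: Q_def)
  have "transpose_mat Q *\<^sub>v unit_vec n (length cs) = 0\<^sub>v n"
    using len by (auto simp: Q_def)
  moreover have "unit_vec n (length cs) \<noteq> (0\<^sub>v n :: 'a Matrix.vec)"
  proof
    assume "unit_vec n (length cs) = (0\<^sub>v n :: 'a Matrix.vec)"
    then have "unit_vec n (length cs) $ length cs = (0\<^sub>v n :: 'a Matrix.vec) $ length cs" by simp
    with len show False by simp
  qed
  ultimately have "det (transpose_mat Q) = 0"
    using Q by (subst det_0_iff_vec_prod_zero[of _ n]) (auto intro!: exI[of _ "unit_vec n (length cs)"])
  then have "det Q = 0" using det_transpose[OF Q] by simp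
  then obtain v where v: "v \<in> carrier_vec n" "v \<noteq> 0\<^sub>v n" "Q *\<^sub>v v = 0\<^sub>v n"
    using det_0_iff_vec_prod_zero[OF Q] by blast
  have "v \<bullet> s = 0" if "s \<in> S" for s
  proof -
    have "s \<in> set cs" using that cs(1) by simp
    then obtain i where i: "i < length cs" "s = cs ! i" by (metis in_set_conv_nth)
    have "s \<in> carrier_vec n" using that Sn by blast
    moreover have "Matrix.row Q i = s"
      using i len \<open>s \<in> carrier_vec n\<close> by (auto simp: Q_def)
    moreover have "(Q *\<^sub>v v) $ i = 0" using v i len by simp
    ultimately show ?thesis using i len v(1) Q comm_scalar_prod[of v n s] by simp
  qed
  then have "v \<in> orthogonal_complement (span S)"
    using v(1) by (simp add: in_orthogonal_complement_span[OF Sn]) (simp add: orthogonal_complement_def)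
  moreover have "c \<in> span S" if c: "c \<in> set (cols A)" for c
  proof (cases "c \<in> S")
    case True
    then show ?thesis using in_own_span[OF Sn] by blast
  next
    case False
    have "lin_dep (S \<union> {c})"
    proof (rule ccontr)
      assume "lin_indpt (S \<union> {c})"
      then have "S = S \<union> {c}" using S c Scols unfolding maximal_def by blast
      with False show False by blast
    qed
    then show ?thesis using lin_dep_iff_in_span[OF _ li _ False] Sn c colsA by auto
  qed
  ultimately show ?thesis using v by (auto simp: orthogonal_complement_def)
qed

lemma clear_denominators:
  "\<exists>m w. m \<noteq> 0 \<and> (\<forall>c<n. to_fract m * f c = to_fract (w c))" for f :: "nat \<Rightarrow> 'a::idom fract"
proof (induction n)
  case 0
  show ?case by (intro exI[of _ 1]) simp
next
  case (Suc n)
  then obtain m w where m: "m \<noteq> 0" and w: "\<And>c. c < n \<Longrightarrow> to_fract m * f c = to_fract (w c)" by blast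
  obtain a b where ab: "f n = Fraction_Field.Fract a b" "b \<noteq> 0" by (metis Fract_cases)
  show ?case
  proof (intro exI[of _ "b * m"] exI[of _ "\<lambda>c. if c < n then b * w c else m * a"] conjI allI impI)
    fix c assume "c < Suc n"
    then consider "c < n" | "c = n" by linarith
    then show "to_fract (b * m) * f c = to_fract (if c < n then b * w c else m * a)"
    proof cases
      case 1
      then show ?thesis using w[OF 1] by (simp add: mult.assoc)
    next
      case 2
      then show ?thesis using ab by (simp add: to_fract_def eq_fract mult_ac)
    qed
  qed (use m ab in simp)
qed

text \<open>A common denominator carries a kernel vector from the quotient field into the
  ring.\<close>

lemma fract_kernel_vector:
  fixes L :: "'a::idom Matrix.vec set"
  assumes v: "v \<in> carrier_vec n" "v \<noteq> 0\<^sub>v n" and L: "\<And>x. x \<in> L \<Longrightarrow> x \<in> carrier_vec n \<and> map_vec to_fract x \<bullet> v = 0"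
  shows "\<exists>w. (\<exists>c<n. w c \<noteq> 0) \<and> (\<forall>x\<in>L. (\<Sum>c<n. x $ c * w c) = 0)"
proof -
  obtain m w where m: "m \<noteq> 0" and w: "\<And>c. c < n \<Longrightarrow> to_fract m * v $ c = to_fract (w c)"
    using clear_denominators[of n "\<lambda>c. v $ c"] by blast
  obtain c where "c < n" "v $ c \<noteq> 0" using v eq_vecI[of v "0\<^sub>v n"] by auto
  then have "w c \<noteq> 0" using w[of c] m by auto
  moreover have "(\<Sum>c<n. x $ c * w c) = 0" if x: "x \<in> L" for x
  proof -
    have "to_fract (\<Sum>c<n. x $ c * w c) = (\<Sum>c<n. to_fract (x $ c) * (to_fract m * v $ c))"
      by (simp add: w)
    also have "\<dots> = to_fract m * (map_vec to_fract x \<bullet> v)"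
      using L[OF x, THEN conjunct1] v(1)
      by (simp add: scalar_prod_def atLeast0LessThan sum_distrib_left mult.left_commute)
    also have "\<dots> = 0" using L[OF x] by simp
    finally show ?thesis by (simp only: to_fract_eq_0_iff)
  qed
  ultimately show ?thesis using \<open>c < n\<close> by blast
qed

lemma meromorphic_rank_rows_kernel:
  assumes L: "set L \<subseteq> carrier_vec n" and rank: "meromorphic_rank (mat_of_rows n L) \<noteq> n"
  shows "\<exists>w. (\<exists>c<n. w c \<noteq> 0) \<and> (\<forall>x\<in>set L. (\<Sum>c<n. x $ c * w c) = 0)"
proof -
  let ?M = "map_mat to_fract (mat_of_rows n L)"
  have M: "?M \<in> carrier_mat (length L) n" by simp
  have "vec_space.rank (length L) ?M \<noteq> n"
    using rank by (simp add: meromorphic_rank_def to_fract_def[abs_def])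
  from vec_space.rank_deficient_kernel[OF M this]
  obtain v where v: "v \<in> carrier_vec n" "v \<noteq> 0\<^sub>v n" "?M *\<^sub>v v = 0\<^sub>v (length L)" by blast
  show ?thesis
  proof (rule fract_kernel_vector[OF v(1,2)])
    fix x assume "x \<in> set L"
    then obtain i where i: "i < length L" "x = L ! i" by (auto simp: in_set_conv_nth)
    have x: "x \<in> carrier_vec n" using \<open>x \<in> set L\<close> L by blast
    have "(?M *\<^sub>v v) $ i = 0" using v i by simp
    moreover have "Matrix.row ?M i = map_vec to_fract x"
      using i x by (auto simp: mat_of_rows_def)
    ultimately show "x \<in> carrier_vec n \<and> map_vec to_fract x \<bullet> v = 0" using x i by simp
  qed
qed

lemma meromorphic_rank_cols_kernel:
  assumes L: "set L \<subseteq> carrier_vec n" and rank: "meromorphic_rank (mat_of_cols n L) \<noteq> n"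
  shows "\<exists>w. (\<exists>c<n. w c \<noteq> 0) \<and> (\<forall>x\<in>set L. (\<Sum>c<n. x $ c * w c) = 0)"
proof -
  let ?M = "map_mat to_fract (mat_of_cols n L)"
  have M: "?M \<in> carrier_mat n (length L)" by simp
  have "vec_space.rank n ?M \<noteq> n"
    using rank by (simp add: meromorphic_rank_def to_fract_def[abs_def])
  from vec_space.rank_deficient_left_kernel[OF M this]
  obtain v where v: "v \<in> carrier_vec n" "v \<noteq> 0\<^sub>v n" "\<forall>c\<in>set (cols ?M). v \<bullet> c = 0" by blast
  show ?thesis
  proof (rule fract_kernel_vector[OF v(1,2)])
    fix x assume "x \<in> set L"
    then obtain i where i: "i < length L" "x = L ! i" by (auto simp: in_set_conv_nth)
    have x: "x \<in> carrier_vec n" using \<open>x \<in> set L\<close> L by blast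
    have "col ?M i = map_vec to_fract x"
      using i x by (auto simp: mat_of_cols_def)
    moreover have "col ?M i \<in> set (cols ?M)" using i by (auto simp: cols_def)
    ultimately have "v \<bullet> map_vec to_fract x = 0" using v(3) by auto
    then show "x \<in> carrier_vec n \<and> map_vec to_fract x \<bullet> v = 0"
      using x v(1) comm_scalar_prod[of v n "map_vec to_fract x"] by simp
  qed
qed

section \<open>Factoring out a real subspace by a pair of matrices\<close>

lemma mat_eq_by_vec:
  fixes A B :: "'a::comm_ring_1 mat"
  assumes "A \<in> carrier_mat n m" "B \<in> carrier_mat n m" "\<And>x. x \<in> carrier_vec m \<Longrightarrow> A *\<^sub>v x = B *\<^sub>v x"
  shows "A = B"
proof (rule eq_matI)
  fix i j assume "i < dim_row B" "j < dim_col B"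
  then have ij: "i < n" "j < m" using assms by auto
  have "col A j = col B j"
    using assms(3)[of "unit_vec m j"] ij mult_unit_vec_col[OF assms(1)] mult_unit_vec_col[OF assms(2)] by simp
  then have "col A j $ i = col B j $ i" by simp
  then show "A $$ (i, j) = B $$ (i, j)" using ij assms(1,2) by simp
qed (use assms in auto)

text \<open>For a coordinate \<open>k\<close> with \<open>y $ k \<noteq> 0\<close>, \<open>T\<close>
  subtracts the multiple of \<open>y\<close> that cancels coordinate \<open>k\<close> and deletes
  this coordinate; \<open>S\<close> inserts a zero there. The error is the subtracted
  multiple.\<close>

lemma line_projection:
  fixes y :: "real Matrix.vec"
  assumes y: "y \<in> carrier_vec m" "y \<noteq> 0\<^sub>v m"
  shows "\<exists>S T. S \<in> carrier_mat m (m - 1) \<and> T \<in> carrier_mat (m - 1) m \<and> m > 0 \<and>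
    (\<forall>x\<in>carrier_vec m. \<exists>c. x - S *\<^sub>v (T *\<^sub>v x) = c \<cdot>\<^sub>v y)"
proof -
  obtain k where k: "k < m" "y $ k \<noteq> 0" using y eq_vecI[of y "0\<^sub>v m"] by auto
  define up where "up i = (if i < k then i else Suc i)" for i
  define S :: "real mat" where "S = Matrix.mat m (m - 1) (\<lambda>(j, i). if j = up i then 1 else 0)"
  define T where "T = Matrix.mat (m - 1) m (\<lambda>(i, j). (if j = up i then 1 else 0) - (if j = k then y $ up i / y $ k else 0))"
  have up: "up i < m" "up i \<noteq> k" if "i < m - 1" for i using that k by (auto simp: up_def)
  have T: "(T *\<^sub>v x) $ i = x $ up i - x $ k / y $ k * y $ up i" if "x \<in> carrier_vec m" "i < m - 1" for x i
  proof -
    have "(T *\<^sub>v x) $ i = (\<Sum>j<m. ((if j = up i then 1 else 0) - (if j = k then y $ up i / y $ k else 0)) * x $ j)"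
      using that by (simp add: T_def scalar_prod_def atLeast0LessThan)
    also have "\<dots> = (\<Sum>j<m. (if j = up i then x $ j else 0)) - (\<Sum>j<m. (if j = k then y $ up i / y $ k * x $ j else 0))"
      by (simp add: left_diff_distrib sum_subtractf if_distrib[of "\<lambda>a. a * _"] cong: if_cong)
    also have "\<dots> = x $ up i - x $ k / y $ k * y $ up i" using up[OF that(2)] k by simp
    finally show ?thesis .
  qed
  have Sup: "(S *\<^sub>v z) $ up i = z $ i" if "z \<in> carrier_vec (m - 1)" "i < m - 1" for z i
  proof -
    have "(S *\<^sub>v z) $ up i = (\<Sum>l<m - 1. (if up i = up l then 1 else 0) * z $ l)"
      using that up by (simp add: S_def scalar_prod_def atLeast0LessThan)
    also have "\<dots> = (\<Sum>l<m - 1. if l = i then z $ l else 0)"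
      by (rule sum.cong) (auto simp: up_def split: if_splits)
    finally show ?thesis using that by simp
  qed
  have Sk: "(S *\<^sub>v z) $ k = 0" if "z \<in> carrier_vec (m - 1)" for z
  proof -
    have "(S *\<^sub>v z) $ k = (\<Sum>l<m - 1. (if k = up l then 1 else 0) * z $ l)"
      using that k by (simp add: S_def scalar_prod_def atLeast0LessThan)
    also have "\<dots> = 0" using up by (intro sum.neutral) auto
    finally show ?thesis .
  qed
  have proj: "x - S *\<^sub>v (T *\<^sub>v x) = (x $ k / y $ k) \<cdot>\<^sub>v y" if x: "x \<in> carrier_vec m" for x
  proof (rule eq_vecI)
    have Tx: "T *\<^sub>v x \<in> carrier_vec (m - 1)" by (rule carrier_vecI) (simp add: T_def)
    have dimS: "dim_vec (S *\<^sub>v (T *\<^sub>v x)) = m" by (simp add: S_def)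
    show "dim_vec (x - S *\<^sub>v (T *\<^sub>v x)) = dim_vec (x $ k / y $ k \<cdot>\<^sub>v y)" using y dimS by simp
    fix j assume "j < dim_vec (x $ k / y $ k \<cdot>\<^sub>v y)"
    then have j: "j < m" using y by simp
    show "(x - S *\<^sub>v (T *\<^sub>v x)) $ j = (x $ k / y $ k \<cdot>\<^sub>v y) $ j"
    proof (cases "j = k")
      case True
      then show ?thesis using Sk[OF Tx] k y dimS by simp
    next
      case False
      define i where "i = (if j < k then j else j - 1)"
      have i: "i < m - 1" "j = up i" using False j k by (auto simp: i_def up_def)
      show ?thesis using Sup[OF Tx i(1)] T[OF x i(1)] j y dimS by (simp add: i(2)[symmetric])
    qed
  qed
  show ?thesis
  proof (rule exI[of _ S], rule exI[of _ T], intro conjI ballI)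
    show "S \<in> carrier_mat m (m - 1)" "T \<in> carrier_mat (m - 1) m" by (simp_all add: S_def T_def)
    show "m > 0" using k by simp
    show "\<exists>c. x - S *\<^sub>v (T *\<^sub>v x) = c \<cdot>\<^sub>v y" if "x \<in> carrier_vec m" for x
      using proj[OF that] by (rule exI)
  qed
qed

text \<open>
  \<open>T\<close> is a factor map onto a complement: among all pairs \<open>(S, T)\<close> with \<open>x - S T x \<in> N\<close> one through a space
  of minimal dimension satisfies \<open>T N = 0\<close>, since otherwise a line in \<open>T N\<close> could be factored out.
\<close>

lemma quotient_matrices:
  fixes N :: "real Matrix.vec set"
  assumes N: "N \<subseteq> carrier_vec n" "\<And>x y. x \<in> N \<Longrightarrow> y \<in> N \<Longrightarrow> x + y \<in> N" "\<And>c x. x \<in> N \<Longrightarrow> c \<cdot>\<^sub>v x \<in> N"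
    and x0: "x0 \<in> N" "x0 \<noteq> 0\<^sub>v n"
  shows "\<exists>m S T. m < n \<and> S \<in> carrier_mat n m \<and> T \<in> carrier_mat m n \<and>
    (\<forall>x\<in>carrier_vec n. x - S *\<^sub>v (T *\<^sub>v x) \<in> N) \<and> (\<forall>x\<in>N. T *\<^sub>v x = 0\<^sub>v m)"
proof -
  define Q where "Q m \<longleftrightarrow> (\<exists>S T. S \<in> carrier_mat n m \<and> T \<in> carrier_mat m n \<and>
    (\<forall>x\<in>carrier_vec n. x - S *\<^sub>v (T *\<^sub>v x) \<in> N))" for m
  have zero: "0\<^sub>v n \<in> N"
  proof -
    have "0 \<cdot>\<^sub>v x0 = 0\<^sub>v n" using x0 N(1) by (intro eq_vecI) auto
    then show ?thesis using N(3)[OF x0(1), of 0] by simp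
  qed
  have "Q n"
    unfolding Q_def using zero by (intro exI[of _ "1\<^sub>m n"]) simp
  define m where "m = (LEAST m. Q m)"
  have m: "Q m" "\<And>l. l < m \<Longrightarrow> \<not> Q l"
    unfolding m_def by (rule LeastI, fact) (rule not_less_Least)
  then obtain S T where ST: "S \<in> carrier_mat n m" "T \<in> carrier_mat m n"
    "\<And>x. x \<in> carrier_vec n \<Longrightarrow> x - S *\<^sub>v (T *\<^sub>v x) \<in> N" by (auto simp: Q_def)
  have kill: "T *\<^sub>v x = 0\<^sub>v m" if x: "x \<in> N" for x
  proof (rule ccontr)
    assume nz: "T *\<^sub>v x \<noteq> 0\<^sub>v m"
    define y where "y = T *\<^sub>v x"
    have xn: "x \<in> carrier_vec n" using x N(1) by blast
    have y: "y \<in> carrier_vec m" using ST(2) xn by (simp add: y_def)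
    obtain S' T' where S'T': "S' \<in> carrier_mat m (m - 1)" "T' \<in> carrier_mat (m - 1) m" "m > 0"
      "\<forall>z\<in>carrier_vec m. \<exists>c. z - S' *\<^sub>v (T' *\<^sub>v z) = c \<cdot>\<^sub>v y"
      using line_projection[OF y] nz by (auto simp: y_def)
    \<comment> \<open>\<open>S y\<close> is \<open>x\<close> minus its own error, and both lie in
      \<open>N\<close>. Hence the additional error of the two-stage factorisation stays in
      \<open>N\<close>.\<close>
    have Sy: "S *\<^sub>v y \<in> N"
    proof -
      have "x + (-1) \<cdot>\<^sub>v (x - S *\<^sub>v (T *\<^sub>v x)) \<in> N" by (intro N x ST xn)
      also have "x + (-1) \<cdot>\<^sub>v (x - S *\<^sub>v (T *\<^sub>v x)) = S *\<^sub>v y"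
        using xn ST(1) by (intro eq_vecI) (auto simp: y_def)
      finally show ?thesis .
    qed
    have "z - (S * S') *\<^sub>v ((T' * T) *\<^sub>v z) \<in> N" if z: "z \<in> carrier_vec n" for z :: "real Matrix.vec"
    proof -
      have Tz: "T *\<^sub>v z \<in> carrier_vec m" using ST(2) z by simp
      obtain c where c: "T *\<^sub>v z - S' *\<^sub>v (T' *\<^sub>v (T *\<^sub>v z)) = c \<cdot>\<^sub>v y" using S'T'(4) Tz by blast
      have "S *\<^sub>v (T *\<^sub>v z) - S *\<^sub>v (S' *\<^sub>v (T' *\<^sub>v (T *\<^sub>v z))) = c \<cdot>\<^sub>v (S *\<^sub>v y)"
        using c ST(1) S'T' Tz y by (simp add: mult_minus_distrib_mat_vec[symmetric] mult_mat_vec)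
      moreover have "(S * S') *\<^sub>v ((T' * T) *\<^sub>v z) = S *\<^sub>v (S' *\<^sub>v (T' *\<^sub>v (T *\<^sub>v z)))"
        using ST(1,2) S'T'(1,2) z Tz assoc_mult_mat_vec[of S n m S' "m - 1"] assoc_mult_mat_vec[of T' "m - 1" m T n]
        by (metis mult_mat_vec_carrier)
      moreover have "z - S *\<^sub>v (S' *\<^sub>v (T' *\<^sub>v (T *\<^sub>v z))) =
          (z - S *\<^sub>v (T *\<^sub>v z)) + (S *\<^sub>v (T *\<^sub>v z) - S *\<^sub>v (S' *\<^sub>v (T' *\<^sub>v (T *\<^sub>v z))))"
        using z ST(1) by (intro eq_vecI) auto
      ultimately show ?thesis using N ST(3)[OF z] Sy by simp
    qed
    moreover have "S * S' \<in> carrier_mat n (m - 1)" "T' * T \<in> carrier_mat (m - 1) n"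
      using ST S'T' by simp_all
    ultimately have "Q (m - 1)" unfolding Q_def by blast
    with m(2)[of "m - 1"] S'T'(3) show False by simp
  qed
  have "m \<le> n" unfolding m_def by (rule Least_le) fact
  \<comment> \<open>The line through \<open>x0\<close> alone already gives a factorisation through
    dimension \<open>n - 1\<close>.\<close>
  moreover have "m \<noteq> n"
  proof
    assume mn: "m = n"
    obtain S' T' where S'T': "S' \<in> carrier_mat n (n - 1)" "T' \<in> carrier_mat (n - 1) n" "n > 0"
      "\<forall>z\<in>carrier_vec n. \<exists>c. z - S' *\<^sub>v (T' *\<^sub>v z) = c \<cdot>\<^sub>v x0"
      using line_projection[of x0 n] x0 N(1) by blast
    have "Q (n - 1)"
      unfolding Q_def
    proof (rule exI[of _ S'], rule exI[of _ T'], intro conjI ballI S'T'(1,2))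
      fix z :: "real Matrix.vec" assume "z \<in> carrier_vec n"
      then obtain c where "z - S' *\<^sub>v (T' *\<^sub>v z) = c \<cdot>\<^sub>v x0" using S'T'(4) by blast
      then show "z - S' *\<^sub>v (T' *\<^sub>v z) \<in> N" using N(3)[OF x0(1)] by simp
    qed
    with m(2)[of "n - 1"] S'T'(3) mn show False by simp
  qed
  ultimately show ?thesis using ST kill by (rule_tac exI[of _ m], rule_tac exI[of _ S], rule_tac exI[of _ T]) simp
qed

text \<open>The linear span without a rule for zero, which arises by scaling with 0 once
  \<open>X\<close> is non-empty.\<close>

inductive_set linear_closure :: "real Matrix.vec set \<Rightarrow> real Matrix.vec set" for X where
  base: "x \<in> X \<Longrightarrow> x \<in> linear_closure X"
| add: "x \<in> linear_closure X \<Longrightarrow> y \<in> linear_closure X \<Longrightarrow> x + y \<in> linear_closure X"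
| smult: "x \<in> linear_closure X \<Longrightarrow> c \<cdot>\<^sub>v x \<in> linear_closure X"

lemma linear_closure_carrier: "x \<in> linear_closure X \<Longrightarrow> X \<subseteq> carrier_vec n \<Longrightarrow> x \<in> carrier_vec n"
  by (induction rule: linear_closure.induct) auto

text \<open>A matrix \<open>B\<close> that vanishes on the span of \<open>X\<close> also vanishes on
  every error \<open>x - S (T x)\<close>, so \<open>B = B * S * T\<close>. This applies to
  \<open>C i\<close> and, by invariance of the span, to \<open>T * A i\<close>.\<close>

lemma unobservable_reduction:
  fixes A C :: "'i \<Rightarrow> real mat"
  assumes A: "\<And>i. A i \<in> carrier_mat n n" and C: "\<And>i. C i \<in> carrier_mat ny n"
    and X: "X \<subseteq> carrier_vec n" "\<And>x i. x \<in> X \<Longrightarrow> A i *\<^sub>v x \<in> X" "\<And>x i. x \<in> X \<Longrightarrow> C i *\<^sub>v x = 0\<^sub>v ny"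
    and x0: "x0 \<in> X" "x0 \<noteq> 0\<^sub>v n"
  shows "\<exists>m S T. m < n \<and> S \<in> carrier_mat n m \<and> T \<in> carrier_mat m n \<and>
    (\<forall>i. T * A i = T * A i * S * T) \<and> (\<forall>i. C i = C i * S * T)"
proof -
  let ?N = "linear_closure X"
  have N: "?N \<subseteq> carrier_vec n" using linear_closure_carrier X(1) by blast
  have NA: "A i *\<^sub>v x \<in> ?N" if "x \<in> ?N" for x i
    using that
  proof induction
    case (add x y)
    then show ?case
      using linear_closure_carrier[OF _ X(1)] mult_add_distrib_mat_vec[OF A, of x y i] linear_closure.add by simp
  next
    case (smult x c)
    then show ?case
      using linear_closure_carrier[OF _ X(1)] mult_mat_vec[OF A, of x i c] linear_closure.smult by simp
  qed (use X linear_closure.base in blast)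
  have NC: "C i *\<^sub>v x = 0\<^sub>v ny" if "x \<in> ?N" for x i
    using that
  proof induction
    case (add x y)
    then show ?case
      using linear_closure_carrier[OF _ X(1)] mult_add_distrib_mat_vec[OF C, of x y i] by simp
  next
    case (smult x c)
    then show ?case
      using linear_closure_carrier[OF _ X(1)] mult_mat_vec[OF C, of x i c] by (auto intro!: eq_vecI)
  qed (use X in blast)
  have "\<exists>m S T. m < n \<and> S \<in> carrier_mat n m \<and> T \<in> carrier_mat m n \<and>
    (\<forall>x\<in>carrier_vec n. x - S *\<^sub>v (T *\<^sub>v x) \<in> ?N) \<and> (\<forall>x\<in>?N. T *\<^sub>v x = 0\<^sub>v m)"
    by (rule quotient_matrices[OF N _ _ linear_closure.base[OF x0(1)] x0(2)])
      (auto intro: linear_closure.intros)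
  then obtain m S T where m: "m < n" and S: "S \<in> carrier_mat n m" and T: "T \<in> carrier_mat m n"
    and ST: "\<And>x. x \<in> carrier_vec n \<Longrightarrow> x - S *\<^sub>v (T *\<^sub>v x) \<in> ?N" and TN: "\<And>x. x \<in> ?N \<Longrightarrow> T *\<^sub>v x = 0\<^sub>v m"
    by blast
  have factor: "B = B * S * T" if B: "B \<in> carrier_mat k n" and BN: "\<And>x. x \<in> ?N \<Longrightarrow> B *\<^sub>v x = 0\<^sub>v k" for B k
  proof (rule mat_eq_by_vec[OF B])
    show "B * S * T \<in> carrier_mat k n" using B S T by simp
    fix x :: "real Matrix.vec" assume x: "x \<in> carrier_vec n"
    have e1: "(B * S * T) *\<^sub>v x = B *\<^sub>v (S *\<^sub>v (T *\<^sub>v x))"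
      using assoc_mult_mat_vec[of "B * S" k m T n x] assoc_mult_mat_vec[of B k n S m "T *\<^sub>v x"] B S T x
      by (metis mult_carrier_mat mult_mat_vec_carrier)
    have e2: "B *\<^sub>v x - B *\<^sub>v (S *\<^sub>v (T *\<^sub>v x)) = 0\<^sub>v k"
      using BN[OF ST[OF x]] mult_minus_distrib_mat_vec[OF B x, of "S *\<^sub>v (T *\<^sub>v x)"] S T x by simp
    have e3: "a = b" if "a - b = 0\<^sub>v k" "a \<in> carrier_vec k" "b \<in> carrier_vec k" for a b :: "real Matrix.vec"
    proof (rule eq_vecI)
      fix i assume "i < dim_vec b"
      then have "(a - b) $ i = 0" using that by simp
      then show "a $ i = b $ i" using that(2,3) \<open>i < dim_vec b\<close> by simp
    qed (use that in auto)
    show "B *\<^sub>v x = (B * S * T) *\<^sub>v x"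
      unfolding e1 by (rule e3[OF e2]) (use B S T x in auto)
  qed
  have "T * A i = T * A i * S * T" for i
  proof (rule factor)
    show "T * A i \<in> carrier_mat m n" using T A by simp
    show "T * A i *\<^sub>v x = 0\<^sub>v m" if "x \<in> ?N" for x
      using TN[OF NA[OF that]] assoc_mult_mat_vec[OF T A, of x] that N by auto
  qed
  moreover have "C i = C i * S * T" for i
    by (rule factor[OF C NC])
  ultimately show ?thesis using m S T by blast
qed

section \<open>Reducibility of structurally deficient representations\<close>

lemma mult_mat_vec_evaluate:
  assumes "A \<in> carrier_mat m n"
  shows "A *\<^sub>v Matrix.vec n (\<lambda>k. evaluate (u k) y)
    = Matrix.vec m (\<lambda>k. evaluate (const_apply n (\<lambda>k l. A $$ (k, l)) u k) y)"
  using assms by (intro eq_vecI) (auto simp: const_apply_def scalar_prod_def atLeast0LessThan)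

lemma analytic_fun_nonzero:
  assumes "F \<noteq> 0"
  obtains y where "evaluate F y \<noteq> 0"
  using assms by (metis evaluate_inject zero_analytic_fun.rep_eq ext)

text \<open>A single point suffices: constant matrices commute with evaluation there, and it is
  chosen so that one entry of \<open>w\<close> survives.\<close>

lemma ct_kernel_reduction:
  fixes A C :: "'p::finite option \<Rightarrow> real mat"
  assumes A: "\<And>i. A i \<in> carrier_mat n n" and C: "\<And>i. C i \<in> carrier_mat ny n"
    and ob_0: "\<And>r k. r < ny \<Longrightarrow> k < n \<Longrightarrow> ob 0 r k = symbolic_entry (\<lambda>i r k. C i $$ (r, k)) r k"
    and ob_Suc: "\<And>j r k. r < ny \<Longrightarrow> k < n \<Longrightarrow>
      ob (Suc j) r k = const_fn e * time_deriv (ob j r k) + (\<Sum>l<n. ob j r l * symbolic_entry (\<lambda>i k l. A i $$ (k, l)) l k)"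
    and e: "e \<noteq> 0"
    and w: "w \<in> kernel_upto n ny ob n" "l < n" "w l \<noteq> 0"
  shows "\<exists>m S T. m < n \<and> S \<in> carrier_mat n m \<and> T \<in> carrier_mat m n \<and>
    (\<forall>i. T * A i = T * A i * S * T) \<and> (\<forall>i. C i = C i * S * T)"
proof -
  obtain W where W: "w \<in> W" "\<And>u i. u \<in> W \<Longrightarrow> const_apply n (\<lambda>k l. A i $$ (k, l)) u \<in> W"
    "\<And>u i r. u \<in> W \<Longrightarrow> r < ny \<Longrightarrow> const_apply n (\<lambda>r k. C i $$ (r, k)) u r = 0"
    using ct_kernel_invariant[of ny n ob "\<lambda>i r k. C i $$ (r, k)" e "\<lambda>i k l. A i $$ (k, l)", OF ob_0 ob_Suc e w] by blast
  obtain y where y: "evaluate (w l) y \<noteq> 0" by (rule analytic_fun_nonzero[OF w(3)])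
  let ?ev = "\<lambda>u. Matrix.vec n (\<lambda>k. evaluate (u k) y)"
  show ?thesis
  proof (rule unobservable_reduction[of A n C ny "?ev ` W", OF A C])
    show "?ev ` W \<subseteq> carrier_vec n" by auto
    show "A i *\<^sub>v x \<in> ?ev ` W" if x: "x \<in> ?ev ` W" for x i
    proof -
      obtain u where u: "u \<in> W" "x = ?ev u" using x by blast
      have "A i *\<^sub>v x = ?ev (const_apply n (\<lambda>k l. A i $$ (k, l)) u)"
        unfolding u(2) by (rule mult_mat_vec_evaluate[OF A])
      then show ?thesis using W(2)[OF u(1)] by blast
    qed
    show "C i *\<^sub>v x = 0\<^sub>v ny" if x: "x \<in> ?ev ` W" for x i
    proof -
      obtain u where u: "u \<in> W" "x = ?ev u" using x by blast
      show ?thesis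
        unfolding u(2) mult_mat_vec_evaluate[OF C] using W(3)[OF u(1)] by (intro eq_vecI) auto
    qed
    show "?ev w \<in> ?ev ` W" using W(1) by blast
    have "?ev w $ l \<noteq> 0\<^sub>v n $ l" using y w(2) by simp
    then show "?ev w \<noteq> 0\<^sub>v n" by metis
  qed
qed

text \<open>A shift of the function is compensated by moving the point of evaluation.\<close>

lemma evaluate_time_shift:
  "evaluate (time_shift (- s) F) (y \<circ> (\<lambda>(i, k). (i, k + s))) = evaluate F y"
proof -
  have "y \<circ> (\<lambda>(i, k). (i, k + s)) \<circ> (\<lambda>(i, k). (i, k + - s)) = y" by (auto simp: fun_eq_iff)
  then show ?thesis by (simp only: time_shift.rep_eq)
qed

lemma evaluate_symbolic_entry:
  "evaluate (symbolic_entry m j k) (\<lambda>(i, l). vec_nth q i) = m None j k + (\<Sum>i\<in>UNIV. m (Some i) j k * vec_nth q i)"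
  by (simp add: symbolic_entry_def)

text \<open>Evaluation is a ring homomorphism and commutes with determinants, so regularity at one
  point makes the symbolic determinant a non-zero ring element; over an integral domain the kernel
  is then trivial.\<close>

lemma symbolic_entry_kernel_trivial:
  fixes a :: "'p::finite option \<Rightarrow> nat \<Rightarrow> nat \<Rightarrow> real" and u :: "nat \<Rightarrow> ('p \<times> 'k::zero) analytic_fun"
  assumes det: "det (Matrix.mat n n (\<lambda>(k, l). a None k l + (\<Sum>i\<in>UNIV. a (Some i) k l * vec_nth q i))) \<noteq> 0"
    and u: "\<And>k. k < n \<Longrightarrow> (\<Sum>l<n. symbolic_entry a k l * u l) = 0" and l: "l < n"
  shows "u l = 0"
proof -
  let ?ev = "\<lambda>F :: ('p \<times> 'k) analytic_fun. evaluate F (\<lambda>(i, l). vec_nth q i)"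
  define M :: "('p \<times> 'k) analytic_fun mat" where "M = Matrix.mat n n (\<lambda>(k, l). symbolic_entry a k l)"
  have M: "M \<in> carrier_mat n n" by (simp add: M_def)
  interpret comm_ring_hom ?ev by unfold_locales simp_all
  have "map_mat ?ev M = Matrix.mat n n (\<lambda>(k, l). a None k l + (\<Sum>i\<in>UNIV. a (Some i) k l * vec_nth q i))"
    by (rule eq_matI) (auto simp: M_def evaluate_symbolic_entry)
  then have "?ev (det M) \<noteq> 0" using det hom_det[of M] by simp
  then have "det M \<noteq> 0" by auto
  moreover have "M *\<^sub>v Matrix.vec n u = 0\<^sub>v n"
    using u by (intro eq_vecI) (auto simp: M_def scalar_prod_def atLeast0LessThan)
  ultimately have "Matrix.vec n u = 0\<^sub>v n"
    using det_0_iff_vec_prod_zero[OF M] by (metis vec_carrier)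
  then have "Matrix.vec n u $ l = 0\<^sub>v n $ l" by simp
  with l show ?thesis by simp
qed

lemma dt_kernel_reduction:
  fixes A C :: "'p::finite option \<Rightarrow> real mat"
  assumes A: "\<And>i. A i \<in> carrier_mat n n" and C: "\<And>i. C i \<in> carrier_mat ny n"
    and ob_0: "\<And>r k. r < ny \<Longrightarrow> k < n \<Longrightarrow> ob 0 r k = symbolic_entry (\<lambda>i r k. C i $$ (r, k)) r k"
    and ob_Suc: "\<And>j r k. r < ny \<Longrightarrow> k < n \<Longrightarrow>
      ob (Suc j) r k = (\<Sum>l<n. time_shift s (ob j r l) * symbolic_entry (\<lambda>i k l. A i $$ (k, l)) l k)"
    and s: "s = 1 \<or> s = - 1"
    and det: "det (affine_mat A q) \<noteq> 0"
    and w: "w \<in> kernel_upto n ny ob n" "l < n" "w l \<noteq> 0"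
  shows "\<exists>m S T. m < n \<and> S \<in> carrier_mat n m \<and> T \<in> carrier_mat m n \<and>
    (\<forall>i. T * A i = T * A i * S * T) \<and> (\<forall>i. C i = C i * S * T)"
proof -
  have det': "det (Matrix.mat n n (\<lambda>(k, l). A None $$ (k, l) + (\<Sum>i\<in>UNIV. A (Some i) $$ (k, l) * vec_nth q i))) \<noteq> 0"
    using det A[of None] by (simp add: affine_mat_def)
  have inj: "\<forall>u :: nat \<Rightarrow> ('p \<times> int) analytic_fun.
      (\<forall>k<n. (\<Sum>l<n. symbolic_entry (\<lambda>i k l. A i $$ (k, l)) k l * u l) = 0) \<longrightarrow> (\<forall>l<n. u l = 0)"
    by (intro allI impI, rule symbolic_entry_kernel_trivial[OF det']) simp_all
  obtain W where W: "w \<in> W" "\<And>u i. u \<in> W \<Longrightarrow> (\<lambda>k. time_shift (- s) (const_apply n (\<lambda>k l. A i $$ (k, l)) u k)) \<in> W"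
    "\<And>u i r. u \<in> W \<Longrightarrow> r < ny \<Longrightarrow> const_apply n (\<lambda>r k. C i $$ (r, k)) u r = 0"
    using dt_kernel_invariant[of ny n ob "\<lambda>i r k. C i $$ (r, k)" s "\<lambda>i k l. A i $$ (k, l)", OF ob_0 ob_Suc s inj w]
    by blast
  obtain y0 where y0: "evaluate (w l) y0 \<noteq> 0" by (rule analytic_fun_nonzero[OF w(3)])
  define ev where "ev u y = Matrix.vec n (\<lambda>k. evaluate (u k) y)" for u :: "nat \<Rightarrow> ('p \<times> int) analytic_fun" and y
  define X where "X = {ev u y | u y. u \<in> W}"
  show ?thesis
  proof (rule unobservable_reduction[of A n C ny X, OF A C])
    show "X \<subseteq> carrier_vec n" by (auto simp: X_def ev_def)
    show "A i *\<^sub>v x \<in> X" if x: "x \<in> X" for x i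
    proof -
      obtain u y where u: "u \<in> W" "x = ev u y" using x by (auto simp: X_def)
      have "A i *\<^sub>v x = ev (const_apply n (\<lambda>k l. A i $$ (k, l)) u) y"
        unfolding u(2) ev_def by (rule mult_mat_vec_evaluate[OF A])
      also have "\<dots> = ev (\<lambda>k. time_shift (- s) (const_apply n (\<lambda>k l. A i $$ (k, l)) u k)) (y \<circ> (\<lambda>(i, k). (i, k + s)))"
        by (simp only: ev_def evaluate_time_shift)
      finally show ?thesis using W(2)[OF u(1)] unfolding X_def by blast
    qed
    show "C i *\<^sub>v x = 0\<^sub>v ny" if x: "x \<in> X" for x i
    proof -
      obtain u y where u: "u \<in> W" "x = ev u y" using x by (auto simp: X_def)
      show ?thesis
        unfolding u(2) ev_def mult_mat_vec_evaluate[OF C] using W(3)[OF u(1)] by (intro eq_vecI) auto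
    qed
    show "ev w y0 \<in> X" using W(1) by (auto simp: X_def)
    have "ev w y0 $ l \<noteq> 0\<^sub>v n $ l" using y0 w(2) by (simp add: ev_def)
    then show "ev w y0 \<noteq> 0\<^sub>v n" by metis
  qed
qed

section \<open>Structural defects translated into reductions of the coefficient matrices\<close>

lemma symbolic_mat_index:
  assumes "M None \<in> carrier_mat m n" "j < m" "k < n"
  shows "symbolic_mat M $$ (j, k) = symbolic_entry (\<lambda>i j k. M i $$ (j, k)) j k"
  using assms by (simp add: symbolic_mat_def symbolic_entry_def)

lemma symbolic_mat_carrier: "M None \<in> carrier_mat m n \<Longrightarrow> symbolic_mat M \<in> carrier_mat m n"
  by (simp add: symbolic_mat_def)

lemma symbolic_mat_index_transpose:
  assumes M: "\<And>i. M i \<in> carrier_mat m n" and jk: "j < m" "k < n"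
  shows "symbolic_mat M $$ (j, k) = symbolic_entry (\<lambda>i k j. transpose_mat (M i) $$ (k, j)) k j"
  using symbolic_mat_index[of M, OF M jk] jk
  by (simp add: symbolic_entry_def M[THEN carrier_matD(1)] M[THEN carrier_matD(2)])

lemma mat_mult_index:
  "A \<in> carrier_mat m n \<Longrightarrow> B \<in> carrier_mat n k \<Longrightarrow> i < m \<Longrightarrow> j < k \<Longrightarrow>
    (A * B) $$ (i, j) = (\<Sum>l<n. A $$ (i, l) * B $$ (l, j))" for A :: "'a::semiring_0 mat"
  by (simp add: scalar_prod_def atLeast0LessThan)

lemma rows_rank_kernel:
  assumes M: "\<And>j. M j \<in> carrier_mat ny n"
    and rank: "meromorphic_rank (mat_of_rows n (concat (map (\<lambda>j. Matrix.rows (M j)) [0..<k]))) \<noteq> n"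
  obtains w l where "w \<in> kernel_upto n ny (\<lambda>j r c. M j $$ (r, c)) k" "l < n" "w l \<noteq> 0"
proof -
  let ?L = "concat (map (\<lambda>j. Matrix.rows (M j)) [0..<k])"
  have row: "Matrix.row (M j) r \<in> set ?L" if "j < k" "r < ny" for j r
    using that M[of j] by (auto simp: Matrix.rows_def intro!: bexI[of _ j] imageI)
  have "set ?L \<subseteq> carrier_vec n"
    by (auto simp: Matrix.rows_def M[THEN carrier_matD(2)] intro!: carrier_vecI)
  from meromorphic_rank_rows_kernel[OF this rank] obtain w
    where w: "\<exists>c<n. w c \<noteq> 0" "\<And>x. x \<in> set ?L \<Longrightarrow> (\<Sum>c<n. x $ c * w c) = 0" by blast
  have "(\<Sum>c<n. M j $$ (r, c) * w c) = 0" if "j < k" "r < ny" for j r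
    using w(2)[OF row[OF that]] M[of j] that by simp
  then have "w \<in> kernel_upto n ny (\<lambda>j r c. M j $$ (r, c)) k" by (simp add: kernel_upto_def)
  with w(1) show ?thesis using that by blast
qed

lemma cols_rank_kernel:
  assumes M: "\<And>j. M j \<in> carrier_mat n nu"
    and rank: "meromorphic_rank (mat_of_cols n (concat (map (\<lambda>j. cols (M j)) [0..<k]))) \<noteq> n"
  obtains w l where "w \<in> kernel_upto n nu (\<lambda>j r c. M j $$ (c, r)) k" "l < n" "w l \<noteq> 0"
proof -
  let ?L = "concat (map (\<lambda>j. cols (M j)) [0..<k])"
  have col: "col (M j) r \<in> set ?L" if "j < k" "r < nu" for j r
    using that M[of j] by (auto simp: cols_def intro!: bexI[of _ j] imageI)
  have "set ?L \<subseteq> carrier_vec n"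
    by (auto simp: cols_def M[THEN carrier_matD(1)] intro!: carrier_vecI)
  from meromorphic_rank_cols_kernel[OF this rank] obtain w
    where w: "\<exists>c<n. w c \<noteq> 0" "\<And>x. x \<in> set ?L \<Longrightarrow> (\<Sum>c<n. x $ c * w c) = 0" by blast
  have "(\<Sum>c<n. M j $$ (c, r) * w c) = 0" if "j < k" "r < nu" for j r
    using w(2)[OF col[OF that]] M[of j] that by simp
  then have "w \<in> kernel_upto n nu (\<lambda>j r c. M j $$ (c, r)) k" by (simp add: kernel_upto_def)
  with w(1) show ?thesis using that by blast
qed

text \<open>\<open>T\<close> is a factor map: the equations read \<open>T A = (T A S) T\<close> and
  \<open>C = (C S) T\<close>, where the matrices in parentheses belong to the quotient.\<close>

definition observation_reducible :: "'p::finite lpv_ssa \<Rightarrow> bool" where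
  "observation_reducible \<Sigma> \<longleftrightarrow> (\<exists>m S T. m < state_dim \<Sigma> \<and> S \<in> carrier_mat (state_dim \<Sigma>) m \<and> T \<in> carrier_mat m (state_dim \<Sigma>) \<and>
    (\<forall>i. T * A_coeff \<Sigma> i = T * A_coeff \<Sigma> i * S * T) \<and> (\<forall>i. C_coeff \<Sigma> i = C_coeff \<Sigma> i * S * T))"

text \<open>Dually, the range of \<open>S\<close> is invariant under each coefficient of
  \<open>A\<close> and contains the range of each coefficient of \<open>B\<close>.\<close>

definition reachability_reducible :: "'p::finite lpv_ssa \<Rightarrow> bool" where
  "reachability_reducible \<Sigma> \<longleftrightarrow> (\<exists>m S T. m < state_dim \<Sigma> \<and> S \<in> carrier_mat (state_dim \<Sigma>) m \<and> T \<in> carrier_mat m (state_dim \<Sigma>) \<and>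
    (\<forall>i. A_coeff \<Sigma> i * S = S * (T * A_coeff \<Sigma> i * S)) \<and> (\<forall>i. B_coeff \<Sigma> i = S * (T * B_coeff \<Sigma> i)))"

text \<open>Transposition exchanges the roles: the inclusion is the transpose of \<open>T\<close>,
  and its companion the transpose of \<open>S\<close>.\<close>

lemma reachability_reducibleI:
  assumes \<Sigma>: "is_lpv_ssa nu ny \<Sigma>"
    and "\<exists>m S T. m < state_dim \<Sigma> \<and> S \<in> carrier_mat (state_dim \<Sigma>) m \<and> T \<in> carrier_mat m (state_dim \<Sigma>) \<and>
      (\<forall>i. T * transpose_mat (A_coeff \<Sigma> i) = T * transpose_mat (A_coeff \<Sigma> i) * S * T) \<and>
      (\<forall>i. transpose_mat (B_coeff \<Sigma> i) = transpose_mat (B_coeff \<Sigma> i) * S * T)"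
  shows "reachability_reducible \<Sigma>"
proof -
  let ?n = "state_dim \<Sigma>"
  obtain m S T where m: "m < ?n" and S: "S \<in> carrier_mat ?n m" and T: "T \<in> carrier_mat m ?n"
    and TA: "\<And>i. T * transpose_mat (A_coeff \<Sigma> i) = T * transpose_mat (A_coeff \<Sigma> i) * S * T"
    and TB: "\<And>i. transpose_mat (B_coeff \<Sigma> i) = transpose_mat (B_coeff \<Sigma> i) * S * T"
    using assms(2) by blast
  have A: "A_coeff \<Sigma> i \<in> carrier_mat ?n ?n" and B: "B_coeff \<Sigma> i \<in> carrier_mat ?n nu" for i
    using \<Sigma> by (auto simp: is_lpv_ssa_def)
  have "A_coeff \<Sigma> i * transpose_mat T = transpose_mat T * (transpose_mat S * A_coeff \<Sigma> i * transpose_mat T)" for i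
  proof -
    have e1: "transpose_mat (T * transpose_mat (A_coeff \<Sigma> i)) = A_coeff \<Sigma> i * transpose_mat T"
      using transpose_mult[OF T, of "transpose_mat (A_coeff \<Sigma> i)" ?n] A[of i] by simp
    have TA_carrier: "T * transpose_mat (A_coeff \<Sigma> i) \<in> carrier_mat m ?n" using T A[of i] by simp
    then have TAS_carrier: "T * transpose_mat (A_coeff \<Sigma> i) * S \<in> carrier_mat m m" using S by (rule mult_carrier_mat)
    have "transpose_mat (T * transpose_mat (A_coeff \<Sigma> i)) = transpose_mat (T * transpose_mat (A_coeff \<Sigma> i) * S * T)"
      by (rule arg_cong[OF TA])
    also have "\<dots> = transpose_mat T * (transpose_mat S * transpose_mat (T * transpose_mat (A_coeff \<Sigma> i)))"
      unfolding transpose_mult[OF TAS_carrier T] transpose_mult[OF TA_carrier S] ..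
    finally have "A_coeff \<Sigma> i * transpose_mat T = transpose_mat T * (transpose_mat S * (A_coeff \<Sigma> i * transpose_mat T))"
      unfolding e1 .
    also have "transpose_mat S * (A_coeff \<Sigma> i * transpose_mat T) = transpose_mat S * A_coeff \<Sigma> i * transpose_mat T"
      by (rule assoc_mult_mat[symmetric]) (use A[of i] S T in auto)
    finally show ?thesis .
  qed
  moreover have "B_coeff \<Sigma> i = transpose_mat T * (transpose_mat S * B_coeff \<Sigma> i)" for i
  proof -
    have "B_coeff \<Sigma> i = transpose_mat (transpose_mat (B_coeff \<Sigma> i) * S * T)"
      using TB[of i] by (metis Matrix.transpose_transpose)
    also have "\<dots> = transpose_mat T * (transpose_mat S * B_coeff \<Sigma> i)"
      using transpose_mult[of "transpose_mat (B_coeff \<Sigma> i) * S" nu m T ?n]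
        transpose_mult[of "transpose_mat (B_coeff \<Sigma> i)" nu ?n S m] B[of i] S T by simp
    finally show ?thesis .
  qed
  moreover have "transpose_mat T \<in> carrier_mat ?n m" "transpose_mat S \<in> carrier_mat m ?n"
    using S T by simp_all
  ultimately show ?thesis using m unfolding reachability_reducible_def by blast
qed

lemma ct_unobservable_reducible:
  assumes \<Sigma>: "is_lpv_ssa nu ny \<Sigma>" and "\<not> ct_structurally_observable \<Sigma>"
  shows "observation_reducible \<Sigma>"
proof -
  let ?n = "state_dim \<Sigma>"
  have A: "A_coeff \<Sigma> i \<in> carrier_mat ?n ?n" and C: "C_coeff \<Sigma> i \<in> carrier_mat ny ?n" for i
    using \<Sigma> by (auto simp: is_lpv_ssa_def)
  have SA: "(symbolic_mat (A_coeff \<Sigma>) :: ('a \<times> nat) analytic_fun mat) \<in> carrier_mat ?n ?n" by (rule symbolic_mat_carrier, rule A)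
  have ob: "ct_obs_block \<Sigma> j \<in> carrier_mat ny ?n" for j
    by (induction j) (auto intro!: symbolic_mat_carrier A C add_carrier_mat mult_carrier_mat)
  obtain w l where w: "w \<in> kernel_upto ?n ny (\<lambda>j r c. ct_obs_block \<Sigma> j $$ (r, c)) ?n" "l < ?n" "w l \<noteq> 0"
    using rows_rank_kernel[of "ct_obs_block \<Sigma>" ny ?n ?n, OF ob] assms(2)
    unfolding ct_structurally_observable_def by blast
  show ?thesis
    unfolding observation_reducible_def
  proof (rule ct_kernel_reduction[OF A C _ _ _ w, where e = 1])
    fix j r k assume rk: "r < ny" "k < ?n"
    show "ct_obs_block \<Sigma> 0 $$ (r, k) = symbolic_entry (\<lambda>i r k. C_coeff \<Sigma> i $$ (r, k)) r k"
      using symbolic_mat_index[of "C_coeff \<Sigma>", OF C rk] by simp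
    show "ct_obs_block \<Sigma> (Suc j) $$ (r, k) = const_fn 1 * time_deriv (ct_obs_block \<Sigma> j $$ (r, k)) +
        (\<Sum>l<?n. ct_obs_block \<Sigma> j $$ (r, l) * symbolic_entry (\<lambda>i k l. A_coeff \<Sigma> i $$ (k, l)) l k)"
    proof -
      have one: "const_fn 1 = 1" by transfer simp
      have "ct_obs_block \<Sigma> (Suc j) $$ (r, k) = time_deriv (ct_obs_block \<Sigma> j $$ (r, k)) +
          (ct_obs_block \<Sigma> j * symbolic_mat (A_coeff \<Sigma>)) $$ (r, k)"
        using carrier_matD[OF ob[of j]] carrier_matD[OF SA] rk by simp
      then show ?thesis
        unfolding one using rk
        by (simp add: mat_mult_index[OF ob SA] symbolic_mat_index[of "A_coeff \<Sigma>", OF A])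
    qed
  qed simp
qed

text \<open>Transposed, the column recursion is a row recursion for the transposed coefficients with
  negated time derivative, hence \<open>e = - 1\<close>.\<close>

lemma ct_unreachable_reducible:
  assumes \<Sigma>: "is_lpv_ssa nu ny \<Sigma>" and "\<not> ct_structurally_reachable \<Sigma>"
  shows "reachability_reducible \<Sigma>"
proof -
  let ?n = "state_dim \<Sigma>"
  have A: "A_coeff \<Sigma> i \<in> carrier_mat ?n ?n" and B: "B_coeff \<Sigma> i \<in> carrier_mat ?n nu" for i
    using \<Sigma> by (auto simp: is_lpv_ssa_def)
  have AT: "transpose_mat (A_coeff \<Sigma> i) \<in> carrier_mat ?n ?n" and BT: "transpose_mat (B_coeff \<Sigma> i) \<in> carrier_mat nu ?n" for i
    using A B by simp_all
  have SA: "(symbolic_mat (A_coeff \<Sigma>) :: ('a \<times> nat) analytic_fun mat) \<in> carrier_mat ?n ?n" by (rule symbolic_mat_carrier, rule A)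
  have re: "ct_reach_block \<Sigma> j \<in> carrier_mat ?n nu" for j
    by (induction j) (auto intro!: symbolic_mat_carrier A B add_carrier_mat mult_carrier_mat)
  obtain w l where w: "w \<in> kernel_upto ?n nu (\<lambda>j r c. ct_reach_block \<Sigma> j $$ (c, r)) ?n" "l < ?n" "w l \<noteq> 0"
    using cols_rank_kernel[of "ct_reach_block \<Sigma>" ?n nu ?n, OF re] assms(2)
    unfolding ct_structurally_reachable_def by blast
  show ?thesis
  proof (rule reachability_reducibleI[OF \<Sigma>], rule ct_kernel_reduction[OF AT BT _ _ _ w, where e = "- 1"])
    fix j r k assume rk: "r < nu" "k < ?n"
    show "ct_reach_block \<Sigma> 0 $$ (k, r) = symbolic_entry (\<lambda>i r k. transpose_mat (B_coeff \<Sigma> i) $$ (r, k)) r k"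
      using symbolic_mat_index_transpose[of "B_coeff \<Sigma>", OF B rk(2,1)] by simp
    show "ct_reach_block \<Sigma> (Suc j) $$ (k, r) = const_fn (- 1) * time_deriv (ct_reach_block \<Sigma> j $$ (k, r)) +
        (\<Sum>l<?n. ct_reach_block \<Sigma> j $$ (l, r) * symbolic_entry (\<lambda>i k l. transpose_mat (A_coeff \<Sigma> i) $$ (k, l)) l k)"
    proof -
      have one: "const_fn (- 1) * F = - F" for F :: "('a \<times> nat) analytic_fun" by transfer simp
      have "ct_reach_block \<Sigma> (Suc j) $$ (k, r) = - time_deriv (ct_reach_block \<Sigma> j $$ (k, r)) +
          (symbolic_mat (A_coeff \<Sigma>) * ct_reach_block \<Sigma> j) $$ (k, r)"
        using carrier_matD[OF re[of j]] carrier_matD[OF SA] rk by simp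
      also have "(symbolic_mat (A_coeff \<Sigma>) * ct_reach_block \<Sigma> j) $$ (k, r) =
          (\<Sum>l<?n. ct_reach_block \<Sigma> j $$ (l, r) * symbolic_entry (\<lambda>i k l. transpose_mat (A_coeff \<Sigma> i) $$ (k, l)) l k)"
        unfolding mat_mult_index[OF SA re rk(2,1)]
        by (rule sum.cong) (simp_all add: symbolic_mat_index_transpose[of "A_coeff \<Sigma>", OF A rk(2)] mult.commute)
      finally show ?thesis unfolding one .
    qed
  qed simp
qed

lemma invertible_mat_det_nonzero:
  fixes M :: "'a::field mat"
  assumes "invertible_mat M"
  shows "det M \<noteq> 0"
proof -
  have M: "M \<in> carrier_mat (dim_row M) (dim_row M)"
    using assms unfolding invertible_mat_def square_mat.simps by (intro carrier_matI) simp_all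
  obtain N where MN: "M * N = 1\<^sub>m (dim_row M)" "N * M = 1\<^sub>m (dim_row N)"
    using assms unfolding invertible_mat_def inverts_mat_def by (elim conjE exE)
  have "dim_col N = dim_row M" using arg_cong[OF MN(1), of dim_col] by simp
  moreover have "dim_row N = dim_row M" using arg_cong[OF MN(2), of dim_col] carrier_matD(2)[OF M] by simp
  ultimately have N: "N \<in> carrier_mat (dim_row M) (dim_row M)" by (intro carrier_matI) simp_all
  have "det M * det N = 1" using det_mult[OF M N] MN(1) by simp
  then show ?thesis by auto
qed

text \<open>The non-empty interior supplies a point of \<open>P\<close>, where the matrix is
  invertible.\<close>

lemma dt_regular_det_nonzero:
  assumes "dt_regularity_certificate P \<Sigma>"
  obtains q where "det (affine_mat (A_coeff \<Sigma>) q) \<noteq> 0"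
proof -
  obtain q where "q \<in> P"
    using assms interior_subset[of P] by (auto simp: dt_regularity_certificate_def)
  with assms have "invertible_mat (affine_mat (A_coeff \<Sigma>) q)" by (simp add: dt_regularity_certificate_def)
  then show ?thesis by (intro that[of q] invertible_mat_det_nonzero)
qed

lemma dt_unobservable_reducible:
  assumes \<Sigma>: "is_lpv_ssa nu ny \<Sigma>" and reg: "dt_regularity_certificate P \<Sigma>" and "\<not> dt_structurally_observable \<Sigma>"
  shows "observation_reducible \<Sigma>"
proof -
  let ?n = "state_dim \<Sigma>"
  have A: "A_coeff \<Sigma> i \<in> carrier_mat ?n ?n" and C: "C_coeff \<Sigma> i \<in> carrier_mat ny ?n" for i
    using \<Sigma> by (auto simp: is_lpv_ssa_def)
  have SA: "(symbolic_mat (A_coeff \<Sigma>) :: ('a \<times> int) analytic_fun mat) \<in> carrier_mat ?n ?n" by (rule symbolic_mat_carrier, rule A)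
  have ob: "dt_obs_block \<Sigma> j \<in> carrier_mat ny ?n" for j
    by (induction j) (auto intro!: symbolic_mat_carrier A C mult_carrier_mat)
  obtain q where q: "det (affine_mat (A_coeff \<Sigma>) q) \<noteq> 0" by (rule dt_regular_det_nonzero[OF reg])
  obtain w l where w: "w \<in> kernel_upto ?n ny (\<lambda>j r c. dt_obs_block \<Sigma> j $$ (r, c)) ?n" "l < ?n" "w l \<noteq> 0"
    using rows_rank_kernel[of "dt_obs_block \<Sigma>" ny ?n ?n, OF ob] assms(3)
    unfolding dt_structurally_observable_def by blast
  show ?thesis
    unfolding observation_reducible_def
  proof (rule dt_kernel_reduction[OF A C _ _ _ q w, where s = 1])
    fix j r k assume rk: "r < ny" "k < ?n"
    show "dt_obs_block \<Sigma> 0 $$ (r, k) = symbolic_entry (\<lambda>i r k. C_coeff \<Sigma> i $$ (r, k)) r k"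
      using symbolic_mat_index[of "C_coeff \<Sigma>", OF C rk] by simp
    have "map_mat (time_shift 1) (dt_obs_block \<Sigma> j) \<in> carrier_mat ny ?n" using ob by simp
    from mat_mult_index[OF this SA rk]
    show "dt_obs_block \<Sigma> (Suc j) $$ (r, k) =
        (\<Sum>l<?n. time_shift 1 (dt_obs_block \<Sigma> j $$ (r, l)) * symbolic_entry (\<lambda>i k l. A_coeff \<Sigma> i $$ (k, l)) l k)"
      using ob[of j] rk by (simp add: symbolic_mat_index[of "A_coeff \<Sigma>", OF A])
  qed simp
qed

text \<open>Transposed, the column recursion becomes a row recursion with backward shift, hence
  \<open>s = - 1\<close>; the determinant survives transposition.\<close>

lemma dt_unreachable_reducible:
  assumes \<Sigma>: "is_lpv_ssa nu ny \<Sigma>" and reg: "dt_regularity_certificate P \<Sigma>" and "\<not> dt_structurally_reachable \<Sigma>"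
  shows "reachability_reducible \<Sigma>"
proof -
  let ?n = "state_dim \<Sigma>"
  have A: "A_coeff \<Sigma> i \<in> carrier_mat ?n ?n" and B: "B_coeff \<Sigma> i \<in> carrier_mat ?n nu" for i
    using \<Sigma> by (auto simp: is_lpv_ssa_def)
  have AT: "transpose_mat (A_coeff \<Sigma> i) \<in> carrier_mat ?n ?n" and BT: "transpose_mat (B_coeff \<Sigma> i) \<in> carrier_mat nu ?n" for i
    using A B by simp_all
  have SA: "(symbolic_mat (A_coeff \<Sigma>) :: ('a \<times> int) analytic_fun mat) \<in> carrier_mat ?n ?n" by (rule symbolic_mat_carrier, rule A)
  have re: "dt_reach_block \<Sigma> j \<in> carrier_mat ?n nu" for j
    by (induction j) (auto intro!: symbolic_mat_carrier A B mult_carrier_mat)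
  obtain q where q: "det (affine_mat (A_coeff \<Sigma>) q) \<noteq> 0" by (rule dt_regular_det_nonzero[OF reg])
  have "affine_mat (\<lambda>i. transpose_mat (A_coeff \<Sigma> i)) q = transpose_mat (affine_mat (A_coeff \<Sigma>) q)"
    using A[THEN carrier_matD(1)] A[THEN carrier_matD(2)] by (intro eq_matI) (simp_all add: affine_mat_def)
  moreover have "affine_mat (A_coeff \<Sigma>) q \<in> carrier_mat ?n ?n" using A[of None] by (simp add: affine_mat_def)
  ultimately have qT: "det (affine_mat (\<lambda>i. transpose_mat (A_coeff \<Sigma> i)) q) \<noteq> 0"
    using q det_transpose by metis
  obtain w l where w: "w \<in> kernel_upto ?n nu (\<lambda>j r c. dt_reach_block \<Sigma> j $$ (c, r)) ?n" "l < ?n" "w l \<noteq> 0"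
    using cols_rank_kernel[of "dt_reach_block \<Sigma>" ?n nu ?n, OF re] assms(3)
    unfolding dt_structurally_reachable_def by blast
  show ?thesis
  proof (rule reachability_reducibleI[OF \<Sigma>], rule dt_kernel_reduction[OF AT BT _ _ _ qT w, where s = "- 1"])
    fix j r k assume rk: "r < nu" "k < ?n"
    show "dt_reach_block \<Sigma> 0 $$ (k, r) = symbolic_entry (\<lambda>i r k. transpose_mat (B_coeff \<Sigma> i) $$ (r, k)) r k"
      using symbolic_mat_index_transpose[of "B_coeff \<Sigma>", OF B rk(2,1)] by simp
    have "map_mat (time_shift (- 1)) (dt_reach_block \<Sigma> j) \<in> carrier_mat ?n nu" using re by simp
    note index = mat_mult_index[OF SA this rk(2,1)]
    show "dt_reach_block \<Sigma> (Suc j) $$ (k, r) =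
        (\<Sum>l<?n. time_shift (- 1) (dt_reach_block \<Sigma> j $$ (l, r)) * symbolic_entry (\<lambda>i k l. transpose_mat (A_coeff \<Sigma> i) $$ (k, l)) l k)"
      unfolding dt_reach_block.simps index
      by (rule sum.cong)
        (use rk carrier_matD[OF re[of j]] in \<open>simp_all add: symbolic_mat_index_transpose[of "A_coeff \<Sigma>", OF A rk(2)] mult.commute\<close>)
  qed simp
qed

section \<open>Absolutely continuous functions\<close>

lemma disjoint_intervals_length:
  fixes D :: "(real \<times> real) set"
  assumes fin: "finite D" and le: "\<And>s t. (s, t) \<in> D \<Longrightarrow> s \<le> t"
    and disj: "\<And>I J. I \<in> D \<Longrightarrow> J \<in> D \<Longrightarrow> I \<noteq> J \<Longrightarrow> {fst I<..<snd I} \<inter> {fst J<..<snd J} = {}"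
    and U: "U \<in> lmeasurable" and sub: "\<And>s t. (s, t) \<in> D \<Longrightarrow> {s<..<t} \<subseteq> U"
  shows "(\<Sum>(s, t)\<in>D. t - s) \<le> measure lebesgue U"
proof -
  have fm: "{fst I<..<snd I} \<in> lmeasurable" for I :: "real \<times> real"
    using lmeasurable_box[of "fst I" "snd I"] by (simp add: box_real)
  have "(\<Sum>(s, t)\<in>D. t - s) = (\<Sum>I\<in>D. measure lebesgue {fst I<..<snd I})"
  proof (rule sum.cong[OF refl])
    fix I assume "I \<in> D"
    then have "fst I \<le> snd I" using le[of "fst I" "snd I"] by simp
    then show "(case I of (s, t) \<Rightarrow> t - s) = measure lebesgue {fst I<..<snd I}"
      by (simp add: case_prod_unfold)
  qed
  also have "\<dots> = measure lebesgue (\<Union>I\<in>D. {fst I<..<snd I})"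
  proof (rule measure_finite_Union[symmetric, OF fin])
    show "(\<lambda>I. {fst I<..<snd I}) ` D \<subseteq> sets lebesgue" using fm by blast
    show "disjoint_family_on (\<lambda>I. {fst I<..<snd I}) D"
      unfolding disjoint_family_on_def using disj by blast
    show "emeasure lebesgue {fst I<..<snd I} \<noteq> \<infinity>" for I :: "real \<times> real"
      using fm[of I] unfolding fmeasurable_def by (simp add: less_top)
  qed
  also have "\<dots> \<le> measure lebesgue U"
  proof (rule measure_mono_fmeasurable[OF _ _ U])
    show "(\<Union>I\<in>D. {fst I<..<snd I}) \<subseteq> U" using sub by fastforce
    show "(\<Union>I\<in>D. {fst I<..<snd I}) \<in> sets lebesgue"
      using fm fin by (intro sets.finite_UN) blast+
  qed
  finally show ?thesis .
qed

text \<open>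
  The gauge confines the intervals tagged in the exceptional null set to an open set so small that the
  increments of \<open>f\<close> over them are negligible by absolute continuity.
\<close>

lemma absolutely_continuous_has_integral:
  fixes f g :: "real \<Rightarrow> real"
  assumes ab: "a \<le> b" and ac: "absolutely_continuous_on a b f"
    and E: "negligible E" and der: "\<And>t. t \<in> {a..b} - E \<Longrightarrow> (f has_real_derivative g t) (at t)"
  shows "(g has_integral f b - f a) {a..b}"
proof -
  \<comment> \<open>With value 0 on \<open>E\<close>, a tag in \<open>E\<close> contributes nothing
    but the increment of \<open>f\<close>.\<close>
  define h where "h t = (if t \<in> E then 0 else g t)" for t
  have "(h has_integral f b - f a) {a..b}"
    unfolding has_integral_real
  proof (intro allI impI)
    fix e :: real assume e: "e > 0"
    \<comment> \<open>The summand 1 keeps the denominator positive for \<open>a = b\<close>.\<close>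
    define e' where "e' = e / (2 * (b - a + 1))"
    have e': "e' > 0" using e ab by (simp add: e'_def)
    obtain \<delta> where \<delta>: "\<delta> > 0" and small: "\<And>D. finite D \<Longrightarrow> (\<forall>(s, t)\<in>D. a \<le> s \<and> s \<le> t \<and> t \<le> b) \<Longrightarrow>
        (\<forall>I\<in>D. \<forall>J\<in>D. I \<noteq> J \<longrightarrow> {fst I<..<snd I} \<inter> {fst J<..<snd J} = {}) \<Longrightarrow>
        (\<Sum>(s, t)\<in>D. t - s) < \<delta> \<Longrightarrow> (\<Sum>(s, t)\<in>D. \<bar>f t - f s\<bar>) < e / 2"
      using ac[unfolded absolutely_continuous_on_def, rule_format, of "e / 2"] e by auto
    have "E \<in> sets lebesgue" using E negligible_iff_null_sets by blast
    then obtain U where U: "open U" "E \<subseteq> U" "U - E \<in> lmeasurable" "emeasure lebesgue (U - E) < ennreal \<delta>"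
      using sets_lebesgue_outer_open[OF _ \<delta>] by metis
    have Efm: "E \<in> lmeasurable" "measure lebesgue E = 0"
      using E negligible_iff_measure by blast+
    have Ufm: "U \<in> lmeasurable" and Um: "measure lebesgue U < \<delta>"
    proof -
      have UE: "U = (U - E) \<union> E" using U(2) by blast
      show "U \<in> lmeasurable" using fmeasurable.Un[OF U(3) Efm(1)] UE by simp
      have "measure lebesgue U \<le> measure lebesgue (U - E) + measure lebesgue E"
        using measure_Un_le[of "U - E" lebesgue E] UE U(3) Efm(1) by (metis fmeasurableD)
      moreover have "measure lebesgue (U - E) < \<delta>"
        using U(4) \<delta> U(3) by (metis emeasure_eq_measure2 ennreal_less_iff measure_nonneg)
      ultimately show "measure lebesgue U < \<delta>" using Efm(2) by simp
    qed
    have "\<exists>d>0. \<forall>y. \<bar>y - t\<bar> < d \<longrightarrow> \<bar>f y - f t - g t * (y - t)\<bar> \<le> e' * \<bar>y - t\<bar>" if t: "t \<in> {a..b} - E" for t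
    proof -
      have "(f has_derivative (\<lambda>h. g t * h)) (at t within UNIV)"
        using der[OF t] by (simp add: has_field_derivative_def)
      then obtain d where "d > 0" "\<forall>y\<in>UNIV. norm (y - t) < d \<longrightarrow> norm (f y - f t - g t * (y - t)) \<le> e' * norm (y - t)"
        unfolding has_derivative_within_alt using e' by blast
      then show ?thesis by (intro exI[of _ d]) (simp add: real_norm_def)
    qed
    then obtain d where d: "\<And>t. t \<in> {a..b} - E \<Longrightarrow> d t > 0"
      "\<And>t y. t \<in> {a..b} - E \<Longrightarrow> \<bar>y - t\<bar> < d t \<Longrightarrow> \<bar>f y - f t - g t * (y - t)\<bar> \<le> e' * \<bar>y - t\<bar>"
      by metis
    define \<gamma> where "\<gamma> t = (if t \<in> E then U else if t \<in> {a..b} then ball t (d t) else ball t 1)" for t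
    have gauge: "gauge \<gamma>"
      unfolding gauge_def \<gamma>_def using U(1,2) d(1) by auto
    show "\<exists>\<gamma>. gauge \<gamma> \<and> (\<forall>D. D tagged_division_of {a..b} \<and> \<gamma> fine D \<longrightarrow>
        norm ((\<Sum>(x, k)\<in>D. measure lborel k *\<^sub>R h x) - (f b - f a)) < e)"
    proof (intro exI[of _ \<gamma>] conjI gauge allI impI, elim conjE)
      fix D assume D: "D tagged_division_of {a..b}" and fine: "\<gamma> fine D"
      note Dfin = tagged_division_ofD(1)[OF D]
      have K: "\<exists>s t. k = {s..t} \<and> s \<le> x \<and> x \<le> t \<and> a \<le> s \<and> t \<le> b" if xk: "(x, k) \<in> D" for x k
      proof -
        obtain s t where st: "k = {s..t}"
          using tagged_division_ofD(4)[OF D xk] by auto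
        moreover have "x \<in> k" "k \<subseteq> {a..b}" using tagged_division_ofD(2,3)[OF D xk] by blast+
        ultimately show ?thesis by (intro exI[of _ s] exI[of _ t]) auto
      qed
      define r where "r p = measure lborel (snd p) *\<^sub>R h (fst p) - (f (Sup (snd p)) - f (Inf (snd p)))" for p
      have "(\<Sum>(x, k)\<in>D. measure lborel k *\<^sub>R h x) - (f b - f a) = (\<Sum>p\<in>D. r p)"
        unfolding additive_tagged_division_1[OF ab D, of f, symmetric]
        by (simp add: r_def case_prod_unfold sum_subtractf)
      also have "norm \<dots> \<le> (\<Sum>p\<in>D. norm (r p))" by (rule norm_sum)
      also have "\<dots> = (\<Sum>p\<in>{p\<in>D. fst p \<in> E}. norm (r p)) + (\<Sum>p\<in>{p\<in>D. fst p \<notin> E}. norm (r p))"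
        using Dfin by (subst sum.union_disjoint[symmetric]) (auto intro!: sum.cong)
      also have "(\<Sum>p\<in>{p\<in>D. fst p \<notin> E}. norm (r p)) \<le> (\<Sum>p\<in>{p\<in>D. fst p \<notin> E}. e' * measure lborel (snd p))"
      proof (rule sum_mono, clarsimp)
        fix x k assume xk: "(x, k) \<in> D" "x \<notin> E"
        obtain s t where st: "k = {s..t}" "s \<le> x" "x \<le> t" "a \<le> s" "t \<le> b" using K[OF xk(1)] by blast
        have x: "x \<in> {a..b} - E" using st xk(2) by auto
        have "k \<subseteq> ball x (d x)" using fine xk x unfolding fine_def \<gamma>_def by fastforce
        moreover have "s \<in> k" "t \<in> k" using st by auto
        ultimately have "s \<in> ball x (d x)" "t \<in> ball x (d x)" by blast+
        then have "\<bar>s - x\<bar> < d x" "\<bar>t - x\<bar> < d x" by (simp_all add: dist_real_def abs_minus_commute)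
        from d(2)[OF x this(1)] d(2)[OF x this(2)]
        have "\<bar>f s - f x - g x * (s - x)\<bar> \<le> e' * (x - s)" "\<bar>f t - f x - g x * (t - x)\<bar> \<le> e' * (t - x)"
          using st by simp_all
        then have "\<bar>(t - s) * g x - (f t - f s)\<bar> \<le> e' * (t - s)"
          by (simp add: abs_le_iff algebra_simps)
        moreover have "r (x, k) = (t - s) * g x - (f t - f s)"
          using st xk(2) by (simp add: r_def h_def)
        ultimately show "\<bar>r (x, k)\<bar> \<le> e' * measure lborel k" using st by simp
      qed
      also have "(\<Sum>p\<in>{p\<in>D. fst p \<notin> E}. e' * measure lborel (snd p)) \<le> (\<Sum>p\<in>D. e' * measure lborel (snd p))"
        by (rule sum_mono2[OF Dfin]) (use e' in auto)
      also have "\<dots> = e' * (b - a)"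
        using additive_content_tagged_division[of D a b] D ab
        by (simp add: sum_distrib_left[symmetric] case_prod_unfold)
      also have "\<dots> \<le> e / 2"
        using e ab by (simp add: e'_def field_simps)
      also have "(\<Sum>p\<in>{p\<in>D. fst p \<in> E}. norm (r p)) < e / 2"
      proof -
        \<comment> \<open>Degenerate intervals contribute nothing; without them distinct intervals
          are told apart by their midpoints.\<close>
        define DE where "DE = {p\<in>D. fst p \<in> E \<and> measure lborel (snd p) \<noteq> 0}"
        define \<iota> :: "real \<times> real set \<Rightarrow> real \<times> real" where "\<iota> p = (Inf (snd p), Sup (snd p))" for p
        have DE: "\<exists>s t. snd p = {s..t} \<and> s \<le> fst p \<and> fst p \<le> t \<and> a \<le> s \<and> t \<le> b \<and> s < t \<and> \<iota> p = (s, t) \<and> {s..t} \<subseteq> U"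
          if p: "p \<in> DE" for p
        proof -
          have pD: "(fst p, snd p) \<in> D" "fst p \<in> E" "measure lborel (snd p) \<noteq> 0" using p by (auto simp: DE_def)
          obtain s t where st: "snd p = {s..t}" "s \<le> fst p" "fst p \<le> t" "a \<le> s" "t \<le> b" using K[OF pD(1)] by blast
          moreover have "s < t" using st pD(3) by (cases "s = t") auto
          moreover have "snd p \<subseteq> U" using fine pD unfolding fine_def \<gamma>_def by fastforce
          ultimately show ?thesis by (intro exI[of _ s] exI[of _ t]) (auto simp: \<iota>_def)
        qed
        have disj: "{fst (\<iota> p)<..<snd (\<iota> p)} \<inter> {fst (\<iota> q)<..<snd (\<iota> q)} = {}" if "p \<in> DE" "q \<in> DE" "p \<noteq> q" for p q
        proof -
          have "interior (snd p) \<inter> interior (snd q) = {}"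
            using tagged_division_ofD(5)[OF D, of "fst p" "snd p" "fst q" "snd q"] that by (auto simp: DE_def)
          then show ?thesis using DE[OF that(1)] DE[OF that(2)] by (auto simp: interior_atLeastAtMost_real)
        qed
        have inj: "inj_on \<iota> DE"
        proof (rule inj_onI, rule ccontr)
          fix p q assume pq: "p \<in> DE" "q \<in> DE" "\<iota> p = \<iota> q" "p \<noteq> q"
          obtain s t where "\<iota> p = (s, t)" "s < t" using DE[OF pq(1)] by blast
          then have "(s + t) / 2 \<in> {fst (\<iota> p)<..<snd (\<iota> p)} \<inter> {fst (\<iota> q)<..<snd (\<iota> q)}"
            using pq(3) by auto
          with disj[OF pq(1,2,4)] show False by blast
        qed
        have fin: "finite (\<iota> ` DE)" using Dfin by (simp add: DE_def)
        have intervals: "a \<le> fst I \<and> fst I \<le> snd I \<and> snd I \<le> b \<and> {fst I<..<snd I} \<subseteq> U" if I: "I \<in> \<iota> ` DE" for I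
        proof -
          obtain p where p: "p \<in> DE" "I = \<iota> p" using I by blast
          obtain s t where "\<iota> p = (s, t)" "a \<le> s" "t \<le> b" "s < t" "{s..t} \<subseteq> U" using DE[OF p(1)] by blast
          then show ?thesis unfolding p(2) by auto
        qed
        have disj': "\<forall>I\<in>\<iota> ` DE. \<forall>J\<in>\<iota> ` DE. I \<noteq> J \<longrightarrow> {fst I<..<snd I} \<inter> {fst J<..<snd J} = {}"
          using disj by blast
        have "(\<Sum>(s, t)\<in>\<iota> ` DE. t - s) \<le> measure lebesgue U"
        proof (rule disjoint_intervals_length[OF fin _ _ Ufm])
          show "s \<le> t" if "(s, t) \<in> \<iota> ` DE" for s t using intervals[OF that] by simp
          show "{s<..<t} \<subseteq> U" if "(s, t) \<in> \<iota> ` DE" for s t using intervals[OF that] by simp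
        qed (use disj' in blast)
        with Um have "(\<Sum>(s, t)\<in>\<iota> ` DE. t - s) < \<delta>" by simp
        moreover have "\<forall>(s, t)\<in>\<iota> ` DE. a \<le> s \<and> s \<le> t \<and> t \<le> b"
        proof
          fix I assume "I \<in> \<iota> ` DE"
          from intervals[OF this] show "case I of (s, t) \<Rightarrow> a \<le> s \<and> s \<le> t \<and> t \<le> b" by (simp add: case_prod_unfold)
        qed
        ultimately have "(\<Sum>(s, t)\<in>\<iota> ` DE. \<bar>f t - f s\<bar>) < e / 2"
          using small[OF fin _ disj'] by blast
        also have "(\<Sum>(s, t)\<in>\<iota> ` DE. \<bar>f t - f s\<bar>) = (\<Sum>p\<in>DE. norm (r p))"
          unfolding sum.reindex[OF inj] by (rule sum.cong) (auto simp: DE_def \<iota>_def r_def h_def)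
        also have "\<dots> = (\<Sum>p\<in>{p\<in>D. fst p \<in> E}. norm (r p))"
        proof (rule sum.mono_neutral_left)
          show "\<forall>p\<in>{p \<in> D. fst p \<in> E} - DE. norm (r p) = 0"
          proof
            fix p assume "p \<in> {p \<in> D. fst p \<in> E} - DE"
            then have p: "(fst p, snd p) \<in> D" "fst p \<in> E" "measure lborel (snd p) = 0" by (auto simp: DE_def)
            obtain s t where st: "snd p = {s..t}" "s \<le> fst p" "fst p \<le> t" using K[OF p(1)] by blast
            then have "s = t" using p(3) by simp
            with st p show "norm (r p) = 0" by (simp add: r_def)
          qed
        qed (use Dfin in \<open>auto simp: DE_def\<close>)
        finally show ?thesis .
      qed
      finally show "norm ((\<Sum>(x, k)\<in>D. measure lborel k *\<^sub>R h x) - (f b - f a)) < e" by simp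
    qed
  qed
  then show ?thesis
    by (rule has_integral_spike[OF E, rotated]) (simp add: h_def)
qed

section \<open>Linear integral equations\<close>

text \<open>Boundedness replaces the one-sided limits of \<open>piecewise_continuous\<close>. The
  class is closed under sums and products, contains all continuous functions, and still ensures
  integrability and continuity almost everywhere.\<close>

definition locally_tame :: "(real \<Rightarrow> real) \<Rightarrow> bool" where
  "locally_tame f \<longleftrightarrow> (\<forall>T\<ge>0. finite {t \<in> {0..T}. \<not> continuous (at t within {0..}) f} \<and> (\<exists>B. \<forall>t\<in>{0..T}. \<bar>f t\<bar> \<le> B))"

lemma locally_tame_const: "locally_tame (\<lambda>t. c)"
  by (auto simp: locally_tame_def intro!: exI[of _ "\<bar>c\<bar>"])

lemma locally_tame_discontinuities:
  assumes "locally_tame f" "locally_tame g" "T \<ge> 0"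
    and "\<And>t. continuous (at t within {0..}) f \<Longrightarrow> continuous (at t within {0..}) g \<Longrightarrow> continuous (at t within {0..}) h"
  shows "finite {t \<in> {0..T}. \<not> continuous (at t within {0..}) h}"
proof (rule finite_subset)
  show "{t \<in> {0..T}. \<not> continuous (at t within {0..}) h} \<subseteq>
    {t \<in> {0..T}. \<not> continuous (at t within {0..}) f} \<union> {t \<in> {0..T}. \<not> continuous (at t within {0..}) g}"
    using assms(4) by blast
  show "finite ({t \<in> {0..T}. \<not> continuous (at t within {0..}) f} \<union> {t \<in> {0..T}. \<not> continuous (at t within {0..}) g})"
    using assms(1-3) by (simp add: locally_tame_def)
qed

lemma locally_tame_add:
  assumes f: "locally_tame f" and g: "locally_tame g"
  shows "locally_tame (\<lambda>t. f t + g t)"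
  unfolding locally_tame_def
proof (intro allI impI conjI)
  fix T :: real assume T: "T \<ge> 0"
  show "finite {t \<in> {0..T}. \<not> continuous (at t within {0..}) (\<lambda>t. f t + g t)}"
    by (rule locally_tame_discontinuities[OF f g T]) (rule continuous_add)
  obtain B C where "\<And>t. t \<in> {0..T} \<Longrightarrow> \<bar>f t\<bar> \<le> B" "\<And>t. t \<in> {0..T} \<Longrightarrow> \<bar>g t\<bar> \<le> C"
    using f g T unfolding locally_tame_def by meson
  then have "\<bar>f t + g t\<bar> \<le> B + C" if "t \<in> {0..T}" for t
    using that abs_triangle_ineq[of "f t" "g t"] by fastforce
  then show "\<exists>B. \<forall>t\<in>{0..T}. \<bar>f t + g t\<bar> \<le> B" by blast
qed

lemma locally_tame_mult:
  assumes f: "locally_tame f" and g: "locally_tame g"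
  shows "locally_tame (\<lambda>t. f t * g t)"
  unfolding locally_tame_def
proof (intro allI impI conjI)
  fix T :: real assume T: "T \<ge> 0"
  show "finite {t \<in> {0..T}. \<not> continuous (at t within {0..}) (\<lambda>t. f t * g t)}"
    by (rule locally_tame_discontinuities[OF f g T]) (rule continuous_mult)
  obtain B C where BC: "\<And>t. t \<in> {0..T} \<Longrightarrow> \<bar>f t\<bar> \<le> B" "\<And>t. t \<in> {0..T} \<Longrightarrow> \<bar>g t\<bar> \<le> C"
    using f g T unfolding locally_tame_def by meson
  have "\<bar>f t * g t\<bar> \<le> B * C" if t: "t \<in> {0..T}" for t
    unfolding abs_mult by (rule mult_mono[OF BC(1)[OF t] BC(2)[OF t]]) (use BC(1)[OF t] in linarith)+
  then show "\<exists>B. \<forall>t\<in>{0..T}. \<bar>f t * g t\<bar> \<le> B" by blast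
qed

lemma locally_tame_sum:
  assumes "\<And>i. i \<in> S \<Longrightarrow> locally_tame (f i)"
  shows "locally_tame (\<lambda>t. \<Sum>i\<in>S. f i t)"
  using assms
  by (induction S rule: infinite_finite_induct) (simp_all add: locally_tame_const locally_tame_add)

lemma locally_tame_continuous:
  assumes "continuous_on {0..} f"
  shows "locally_tame f"
  unfolding locally_tame_def
proof (intro allI impI conjI)
  fix T :: real assume T: "T \<ge> 0"
  have "{t \<in> {0..T}. \<not> continuous (at t within {0..}) f} = {}"
    using assms by (auto simp: continuous_on_eq_continuous_within)
  then show "finite {t \<in> {0..T}. \<not> continuous (at t within {0..}) f}" by (simp only: finite.emptyI)
  have "compact (f ` {0..T})"
    by (rule compact_continuous_image[OF continuous_on_subset[OF assms] compact_Icc]) auto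
  then have "bounded (f ` {0..T})" by (rule compact_imp_bounded)
  then show "\<exists>B. \<forall>t\<in>{0..T}. \<bar>f t\<bar> \<le> B" unfolding bounded_iff by auto
qed

text \<open>The one-sided limits bound \<open>f\<close> on either side of \<open>t\<close> but say
  nothing about \<open>f t\<close>, which enters the bound separately.\<close>

lemma piecewise_continuous_locally_bounded:
  fixes f :: "real \<Rightarrow> real"
  assumes f: "piecewise_continuous f" and t: "t \<ge> 0"
  shows "\<exists>d>0. \<exists>B. \<forall>s\<ge>0. \<bar>s - t\<bar> < d \<longrightarrow> \<bar>f s\<bar> \<le> B"
proof -
  have lim: "\<exists>d>0. \<forall>s\<in>A. \<bar>s - t\<bar> < d \<longrightarrow> s \<noteq> t \<longrightarrow> \<bar>f s\<bar> \<le> \<bar>l\<bar> + 1" if "(f \<longlongrightarrow> l) (at t within A)" for A l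
  proof -
    have "\<forall>\<^sub>F s in at t within A. dist (f s) l < 1" using that by (rule tendstoD) simp
    then obtain d where d: "d > 0" "\<And>s. s \<in> A \<Longrightarrow> s \<noteq> t \<Longrightarrow> dist s t < d \<Longrightarrow> dist (f s) l < 1"
      unfolding eventually_at by blast
    have "\<bar>f s\<bar> \<le> \<bar>l\<bar> + 1" if "s \<in> A" "\<bar>s - t\<bar> < d" "s \<noteq> t" for s
      using d(2)[of s] that by (simp add: dist_real_def)
    with d(1) show ?thesis by blast
  qed
  show ?thesis
  proof (cases "continuous (at t within {0..}) f")
    case True
    then have "(f \<longlongrightarrow> f t) (at t within {0..})" by (simp add: continuous_within)
    from lim[OF this] obtain d where "d > 0" "\<And>s. s \<ge> 0 \<Longrightarrow> \<bar>s - t\<bar> < d \<Longrightarrow> s \<noteq> t \<Longrightarrow> \<bar>f s\<bar> \<le> \<bar>f t\<bar> + 1" by auto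
    then show ?thesis by (intro exI[of _ d] conjI exI[of _ "\<bar>f t\<bar> + 1"]) (metis abs_ge_zero le_add_same_cancel1 zero_le_one)+
  next
    case False
    then obtain l where "(f \<longlongrightarrow> l) (at t within {t<..})" using f t unfolding piecewise_continuous_def by blast
    from lim[OF this] obtain d where d: "d > 0" "\<And>s. s > t \<Longrightarrow> \<bar>s - t\<bar> < d \<Longrightarrow> \<bar>f s\<bar> \<le> \<bar>l\<bar> + 1" by auto
    obtain d' B' where d': "d' > 0" "\<And>s. 0 \<le> s \<Longrightarrow> s < t \<Longrightarrow> \<bar>s - t\<bar> < d' \<Longrightarrow> \<bar>f s\<bar> \<le> B'"
    proof (cases "t > 0")
      case True
      obtain l' where "(f \<longlongrightarrow> l') (at t within {..<t})" using f t True \<open>\<not> continuous (at t within {0..}) f\<close> unfolding piecewise_continuous_def by blast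
      from lim[OF this] obtain d' where "d' > 0" "\<And>s. s < t \<Longrightarrow> \<bar>s - t\<bar> < d' \<Longrightarrow> \<bar>f s\<bar> \<le> \<bar>l'\<bar> + 1" by auto
      then show ?thesis using that[of d' "\<bar>l'\<bar> + 1"] by blast
    next
      case False
      then show ?thesis using that[of 1 0] by simp
    qed
    define B where "B = max (\<bar>l\<bar> + 1) (max B' \<bar>f t\<bar>)"
    have "\<bar>f s\<bar> \<le> B" if s: "s \<ge> 0" "\<bar>s - t\<bar> < min d d'" for s
    proof -
      consider "s > t" | "s = t" | "s < t" by linarith
      then show ?thesis
      proof cases
        case 1
        then show ?thesis using d(2)[of s] s by (simp add: B_def)
      next
        case 2
        then show ?thesis by (simp add: B_def)
      next
        case 3
        then show ?thesis using d'(2)[of s] s by (simp add: B_def)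
      qed
    qed
    then show ?thesis using d(1) d'(1) by (intro exI[of _ "min d d'"]) auto
  qed
qed

text \<open>Compactness turns the local bounds into one on \<open>{0..T}\<close>, namely the sum
  over a finite subcover.\<close>

lemma piecewise_continuous_locally_tame:
  assumes f: "piecewise_continuous f"
  shows "locally_tame f"
  unfolding locally_tame_def
proof (intro allI impI conjI)
  fix T :: real assume T: "T \<ge> 0"
  show "finite {t \<in> {0..T}. \<not> continuous (at t within {0..}) f}"
    using f T unfolding piecewise_continuous_def by blast
  obtain d B where d: "\<And>t. t \<ge> 0 \<Longrightarrow> d t > 0" "\<And>t s. t \<ge> 0 \<Longrightarrow> s \<ge> 0 \<Longrightarrow> \<bar>s - t\<bar> < d t \<Longrightarrow> \<bar>f s\<bar> \<le> B t"
    using piecewise_continuous_locally_bounded[OF f] by metis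
  obtain C where C: "C \<subseteq> {0..T}" "finite C" "{0..T} \<subseteq> (\<Union>t\<in>C. ball t (d t))"
  proof (rule compactE_image[OF compact_Icc[of 0 T]])
    show "{0..T} \<subseteq> (\<Union>t\<in>{0..T}. ball t (d t))" using d(1) by force
  qed auto
  have "\<bar>f s\<bar> \<le> (\<Sum>t\<in>C. \<bar>B t\<bar>)" if s: "s \<in> {0..T}" for s
  proof -
    obtain t where t: "t \<in> C" "s \<in> ball t (d t)" using C(3) s by blast
    have "\<bar>f s\<bar> \<le> B t"
      by (rule d(2)) (use t s C(1) in \<open>auto simp: dist_real_def abs_minus_commute\<close>)
    also have "\<dots> \<le> \<bar>B t\<bar>" by simp
    also have "\<dots> \<le> (\<Sum>t\<in>C. \<bar>B t\<bar>)" by (rule member_le_sum[OF t(1)]) (use C(2) in auto)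
    finally show ?thesis .
  qed
  then show "\<exists>B. \<forall>t\<in>{0..T}. \<bar>f t\<bar> \<le> B" by blast
qed

lemma piecewise_continuous_component:
  fixes p :: "real \<Rightarrow> real ^ 'p::finite"
  assumes p: "piecewise_continuous p"
  shows "piecewise_continuous (\<lambda>t. vec_nth (p t) i)"
  unfolding piecewise_continuous_def
proof (intro conjI allI impI)
  have cont: "continuous F (\<lambda>t. vec_nth (p t) i)" if "continuous F p" for F
    using that unfolding continuous_def by (rule tendsto_vec_nth)
  fix T :: real assume T: "T \<ge> 0"
  have "finite {t \<in> {0..T}. \<not> continuous (at t within {0..}) p}" using p T by (simp add: piecewise_continuous_def)
  then show "finite {t \<in> {0..T}. \<not> continuous (at t within {0..}) (\<lambda>t. vec_nth (p t) i)}"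
    by (rule rev_finite_subset) (use cont in blast)
next
  have cont: "continuous F (\<lambda>t. vec_nth (p t) i)" if "continuous F p" for F
    using that unfolding continuous_def by (rule tendsto_vec_nth)
  fix t :: real assume t: "t \<ge> 0" "\<not> continuous (at t within {0..}) (\<lambda>t. vec_nth (p t) i)"
  then have nc: "\<not> continuous (at t within {0..}) p" using cont by blast
  show "\<exists>l. ((\<lambda>t. vec_nth (p t) i) \<longlongrightarrow> l) (at_right t)"
    using p t nc tendsto_vec_nth unfolding piecewise_continuous_def by metis
  show "\<exists>l. ((\<lambda>t. vec_nth (p t) i) \<longlongrightarrow> l) (at_left t)" if "t > 0"
    using p t nc that tendsto_vec_nth unfolding piecewise_continuous_def by metis
qed

lemma locally_tame_integrable:
  assumes f: "locally_tame f" and T: "T \<ge> 0"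
  shows "f integrable_on {0..T}"
proof -
  define D where "D = {t \<in> {0..T}. \<not> continuous (at t within {0..}) f}"
  have fin: "finite D" using f T by (simp add: locally_tame_def D_def)
  obtain B where B: "\<And>t. t \<in> {0..T} \<Longrightarrow> \<bar>f t\<bar> \<le> B" using f T unfolding locally_tame_def by meson
  have cont: "continuous_on ({0..T} - D) f"
    unfolding continuous_on_eq_continuous_within
  proof
    fix t assume "t \<in> {0..T} - D"
    then have "continuous (at t within {0..}) f" by (simp add: D_def)
    then show "continuous (at t within {0..T} - D) f" by (rule continuous_within_subset) auto
  qed
  have meas: "{0..T} - D \<in> sets lebesgue" using fin by (simp add: finite_imp_closed borel_closed)
  have "f integrable_on ({0..T} - D)"
  proof (rule measurable_bounded_by_integrable_imp_integrable_real[where g = "\<lambda>_. B"])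
    show "f \<in> borel_measurable (lebesgue_on ({0..T} - D))"
      by (rule continuous_imp_measurable_on_sets_lebesgue[OF cont meas])
    have "(\<lambda>_. B) integrable_on {0..T}" by (rule integrable_const_ivl)
    then show "(\<lambda>_. B) integrable_on ({0..T} - D)"
      by (rule integrable_spike_set) (use fin in \<open>auto intro!: negligible_finite elim: finite_subset[rotated]\<close>)
  qed (use B meas in auto)
  then show ?thesis
    by (rule integrable_spike_set) (use fin in \<open>auto intro!: negligible_finite elim: finite_subset[rotated]\<close>)
qed

lemma integral_form_continuous:
  fixes g h :: "real \<Rightarrow> real"
  assumes "\<And>t. t \<ge> 0 \<Longrightarrow> (g has_integral h t) {0..t}"
  shows "continuous_on {0..} h"
  unfolding continuous_on_eq_continuous_within
proof
  fix t :: real assume t: "t \<in> {0..}"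
  have eq: "integral {0..s} g = h s" if "s \<ge> 0" for s using assms[OF that] by (rule integral_unique)
  have "g integrable_on {0..t + 1}" using assms[of "t + 1"] t by (auto simp: integrable_on_def)
  then have "continuous_on {0..t + 1} (\<lambda>s. integral {0..s} g)" by (rule indefinite_integral_continuous_1)
  then have "continuous_on {0..t + 1} h" by (rule continuous_on_eq) (simp add: eq)
  then have "continuous (at t within {0..t + 1}) h" using t by (simp add: continuous_on_eq_continuous_within)
  moreover have "at t within {0..t + 1} = at t within {0..}"
    by (rule at_within_nhd[of t "{..<t + 1}"]) auto
  ultimately show "continuous (at t within {0..}) h" by simp
qed

section \<open>Picard iteration for linear Volterra equations\<close>

lemma monomial_has_integral:
  fixes K M :: real
  assumes "t \<ge> 0"
  shows "((\<lambda>s. K * (M * (K * s) ^ k / fact k)) has_integral M * (K * t) ^ Suc k / fact (Suc k)) {0..t}"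
proof -
  have "((\<lambda>s. K * (M * (K * s) ^ k / fact k)) has_integral
      M * (K * t) ^ Suc k / fact (Suc k) - M * (K * 0) ^ Suc k / fact (Suc k)) {0..t}"
  proof (rule fundamental_theorem_of_calculus[OF assms])
    fix x
    have "((\<lambda>s. M * (K * s) ^ Suc k / fact (Suc k)) has_real_derivative
        M * (real (Suc k) * (K * x) ^ k * K) / fact (Suc k)) (at x within {0..t})"
      by (rule derivative_eq_intros refl | simp)+
    moreover have "M * (real (Suc k) * (K * x) ^ k * K) / fact (Suc k) = K * (M * (K * x) ^ k / fact k)"
      unfolding fact_Suc by (simp add: field_simps del: of_nat_Suc)
    ultimately show "((\<lambda>s. M * (K * s) ^ Suc k / fact (Suc k)) has_vector_derivative
        K * (M * (K * x) ^ k / fact k)) (at x within {0..t})"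
      by (simp only: has_real_derivative_iff_has_vector_derivative)
  qed
  then show ?thesis by simp
qed

text \<open>The constant \<open>real n * L\<close> bounds the absolute row sums of \<open>a\<close>;
  integrating the majorant of order \<open>k\<close> gives exactly the one of order
  \<open>Suc k\<close>.\<close>

lemma picard_step_bound:
  fixes a :: "nat \<Rightarrow> nat \<Rightarrow> real \<Rightarrow> real"
  assumes L: "\<And>i j t. i < n \<Longrightarrow> j < n \<Longrightarrow> t \<in> {0..T} \<Longrightarrow> \<bar>a i j t\<bar> \<le> L"
    and z: "\<And>j t. j < n \<Longrightarrow> t \<in> {0..T} \<Longrightarrow> \<bar>z j t\<bar> \<le> M * (real n * L * t) ^ k / fact k"
    and w: "((\<lambda>s. \<Sum>j<n. a i j s * z j s) has_integral w) {0..t}"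
    and i: "i < n" and t: "t \<in> {0..T}"
  shows "\<bar>w\<bar> \<le> M * (real n * L * t) ^ Suc k / fact (Suc k)"
proof -
  let ?b = "\<lambda>s. real n * L * (M * (real n * L * s) ^ k / fact k)"
  have b: "(?b has_integral M * (real n * L * t) ^ Suc k / fact (Suc k)) {0..t}"
    by (rule monomial_has_integral) (use t in simp)
  have le: "\<bar>\<Sum>j<n. a i j s * z j s\<bar> \<le> ?b s" if "s \<in> {0..t}" for s
  proof -
    have s: "s \<in> {0..T}" using that t by simp
    have "\<bar>\<Sum>j<n. a i j s * z j s\<bar> \<le> (\<Sum>j<n. \<bar>a i j s * z j s\<bar>)" by (rule sum_abs)
    also have "\<dots> \<le> (\<Sum>j<n. L * (M * (real n * L * s) ^ k / fact k))"
    proof (rule sum_mono)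
      fix j assume "j \<in> {..<n}"
      then have j: "j < n" by simp
      show "\<bar>a i j s * z j s\<bar> \<le> L * (M * (real n * L * s) ^ k / fact k)"
        unfolding abs_mult by (rule mult_mono[OF L[OF i j s] z[OF j s]]) (use L[OF i j s] in linarith)+
    qed
    finally show ?thesis by simp
  qed
  have "w \<le> M * (real n * L * t) ^ Suc k / fact (Suc k)"
    by (rule has_integral_le[OF w b]) (use le in \<open>simp add: abs_le_iff\<close>)
  moreover have "- w \<le> M * (real n * L * t) ^ Suc k / fact (Suc k)"
    by (rule has_integral_le[OF has_integral_neg[OF w] b]) (use le in \<open>simp add: abs_le_iff\<close>)
  ultimately show ?thesis by simp
qed

lemma matrix_bound:
  fixes a :: "nat \<Rightarrow> nat \<Rightarrow> real \<Rightarrow> real"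
  assumes a: "\<And>i j. i < n \<Longrightarrow> j < n \<Longrightarrow> locally_tame (a i j)" and T: "T \<ge> 0"
  shows "\<exists>L\<ge>0. \<forall>i<n. \<forall>j<n. \<forall>t\<in>{0..T}. \<bar>a i j t\<bar> \<le> L"
proof -
  have "\<exists>B. \<forall>t\<in>{0..T}. \<bar>a i j t\<bar> \<le> B" if "i < n" "j < n" for i j
    using a[OF that] T by (simp add: locally_tame_def)
  then obtain B where B: "\<And>i j t. i < n \<Longrightarrow> j < n \<Longrightarrow> t \<in> {0..T} \<Longrightarrow> \<bar>a i j t\<bar> \<le> B i j" by metis
  define L where "L = (\<Sum>i<n. \<Sum>j<n. \<bar>B i j\<bar>)"
  have "\<bar>a i j t\<bar> \<le> L" if ij: "i < n" "j < n" and t: "t \<in> {0..T}" for i j t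
  proof -
    have "\<bar>a i j t\<bar> \<le> \<bar>B i j\<bar>" using B[OF ij t] by linarith
    also have "\<dots> \<le> (\<Sum>j<n. \<bar>B i j\<bar>)" by (rule member_le_sum) (use ij in auto)
    also have "\<dots> \<le> L" unfolding L_def by (rule member_le_sum) (use ij in \<open>auto intro: sum_nonneg\<close>)
    finally show ?thesis .
  qed
  moreover have "L \<ge> 0" unfolding L_def by (intro sum_nonneg) auto
  ultimately show ?thesis by blast
qed

text \<open>Being its own integral, \<open>z\<close> is continuous and hence bounded by some
  \<open>M\<close>; iterating the Picard estimate bounds it by terms of an exponential series, which
  tend to 0.\<close>

lemma linear_integral_equation_unique:
  fixes a :: "nat \<Rightarrow> nat \<Rightarrow> real \<Rightarrow> real"
  assumes a: "\<And>i j. i < n \<Longrightarrow> j < n \<Longrightarrow> locally_tame (a i j)"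
    and z: "\<And>i t. i < n \<Longrightarrow> t \<ge> 0 \<Longrightarrow> ((\<lambda>s. \<Sum>j<n. a i j s * z j s) has_integral z i t) {0..t}"
    and i: "i < n" and T: "T \<ge> 0"
  shows "z i T = 0"
proof -
  have "\<exists>L\<ge>0. \<forall>i<n. \<forall>j<n. \<forall>t\<in>{0..T}. \<bar>a i j t\<bar> \<le> L" by (rule matrix_bound[OF a T])
  then obtain L where L: "\<And>i j t. i < n \<Longrightarrow> j < n \<Longrightarrow> t \<in> {0..T} \<Longrightarrow> \<bar>a i j t\<bar> \<le> L" by blast
  have tame: "locally_tame (z j)" if "j < n" for j
    by (rule locally_tame_continuous, rule integral_form_continuous[OF z[OF that]])
  \<comment> \<open>The bound for matrices is applied to a matrix whose rows all equal
    \<open>z\<close>.\<close>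
  have "\<exists>M\<ge>0. \<forall>i<n. \<forall>j<n. \<forall>t\<in>{0..T}. \<bar>z j t\<bar> \<le> M" by (rule matrix_bound[of n "\<lambda>i. z", OF tame T])
  then obtain M where M: "\<And>j t. j < n \<Longrightarrow> t \<in> {0..T} \<Longrightarrow> \<bar>z j t\<bar> \<le> M" using i by blast
  have "\<bar>z i t\<bar> \<le> M * (real n * L * t) ^ k / fact k" if "i < n" "t \<in> {0..T}" for i t k
    using that
  proof (induction k arbitrary: i t)
    case 0
    then show ?case using M[of i t] by simp
  next
    case (Suc k)
    show ?case
      by (rule picard_step_bound[where a = a and z = z and n = n and T = T and i = i, OF L Suc.IH z])
        (use Suc.prems in auto)
  qed
  then have "\<bar>z i T\<bar> \<le> M * ((real n * L * T) ^ k / fact k)" for k using i T by simp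
  moreover have "(\<lambda>k. M * ((real n * L * T) ^ k / fact k)) \<longlonglongrightarrow> M * 0"
    using summable_LIMSEQ_zero[OF summable_exp[of "real n * L * T"]]
    by (intro tendsto_mult tendsto_const) (simp add: divide_inverse mult.commute)
  ultimately have "\<bar>z i T\<bar> \<le> M * 0" by (intro LIMSEQ_le_const[of _ "M * 0" "\<bar>z i T\<bar>"]) auto
  then show ?thesis by simp
qed

text \<open>\<open>D k\<close> is the increment of the Picard iteration in step \<open>k\<close>,
  and the solution is the sum of the increments; dominated convergence passes to the limit under the
  integral.\<close>

lemma linear_integral_equation_exists:
  fixes a :: "nat \<Rightarrow> nat \<Rightarrow> real \<Rightarrow> real" and f :: "nat \<Rightarrow> real \<Rightarrow> real"
  assumes a: "\<And>i j. i < n \<Longrightarrow> j < n \<Longrightarrow> locally_tame (a i j)" and f: "\<And>i. i < n \<Longrightarrow> locally_tame (f i)"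
  shows "\<exists>x. \<forall>i<n. \<forall>t\<ge>0. ((\<lambda>s. (\<Sum>j<n. a i j s * x j s) + f i s) has_integral x i t) {0..t}"
proof -
  define D where "D = rec_nat (\<lambda>i t. integral {0..t} (f i)) (\<lambda>k Dk i t. integral {0..t} (\<lambda>s. \<Sum>j<n. a i j s * Dk j s))"
  have D_0: "D 0 i t = integral {0..t} (f i)" for i t by (simp add: D_def)
  have D_Suc: "D (Suc k) i t = integral {0..t} (\<lambda>s. \<Sum>j<n. a i j s * D k j s)" for k i t by (simp add: D_def)
  have int_0: "(f i has_integral D 0 i t) {0..t}" if "i < n" "t \<ge> 0" for i t
    unfolding D_0 by (rule integrable_integral, rule locally_tame_integrable[OF f]) (use that in auto)
  have tame: "\<forall>i<n. locally_tame (D k i)" for k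
  proof (induction k)
    case 0
    show ?case
    proof (intro allI impI)
      fix i assume i: "i < n"
      show "locally_tame (D 0 i)"
        by (rule locally_tame_continuous, rule integral_form_continuous[OF int_0[OF i]])
    qed
  next
    case (Suc k)
    show ?case
    proof (intro allI impI)
      fix i assume i: "i < n"
      have "locally_tame (\<lambda>s. \<Sum>j<n. a i j s * D k j s)"
        using Suc a[OF i] by (intro locally_tame_sum locally_tame_mult) auto
      then have "((\<lambda>s. \<Sum>j<n. a i j s * D k j s) has_integral D (Suc k) i t) {0..t}" if "t \<ge> 0" for t
        unfolding D_Suc by (intro integrable_integral locally_tame_integrable that)
      then show "locally_tame (D (Suc k) i)"
        by (intro locally_tame_continuous) (rule integral_form_continuous)
    qed
  qed
  have int_Suc: "((\<lambda>s. \<Sum>j<n. a i j s * D k j s) has_integral D (Suc k) i t) {0..t}" if i: "i < n" and t: "t \<ge> 0" for i k t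
  proof -
    have "locally_tame (\<lambda>s. \<Sum>j<n. a i j s * D k j s)"
      using tame[of k] a[OF i] by (intro locally_tame_sum locally_tame_mult) auto
    then show ?thesis unfolding D_Suc by (intro integrable_integral locally_tame_integrable t)
  qed
  \<comment> \<open>A summable majorant, uniform in the component and in time on
    \<open>{0..T}\<close>, gives convergence as well as domination.\<close>
  have bound: "\<exists>e. summable e \<and> (\<forall>k. \<forall>j<n. \<forall>t\<in>{0..T}. \<bar>D k j t\<bar> \<le> e k)" if T: "T \<ge> 0" for T
  proof -
    have "\<exists>L\<ge>0. \<forall>i<n. \<forall>j<n. \<forall>t\<in>{0..T}. \<bar>a i j t\<bar> \<le> L" by (rule matrix_bound[OF a T])
    then obtain L where L0: "L \<ge> 0" and L: "\<And>i j t. i < n \<Longrightarrow> j < n \<Longrightarrow> t \<in> {0..T} \<Longrightarrow> \<bar>a i j t\<bar> \<le> L" by blast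
    have "\<exists>M\<ge>0. \<forall>i<n. \<forall>j<n. \<forall>t\<in>{0..T}. \<bar>D 0 j t\<bar> \<le> M"
      by (rule matrix_bound[of n "\<lambda>i. D 0", OF _ T]) (use tame[of 0] in blast)
    then obtain M where M0: "M \<ge> 0" and M: "\<And>j t. j < n \<Longrightarrow> t \<in> {0..T} \<Longrightarrow> \<bar>D 0 j t\<bar> \<le> M" by blast
    have D: "\<bar>D k i t\<bar> \<le> M * (real n * L * t) ^ k / fact k" if "i < n" "t \<in> {0..T}" for i t k
      using that
    proof (induction k arbitrary: i t)
      case 0
      then show ?case using M[of i t] by simp
    next
      case (Suc k)
      show ?case
        by (rule picard_step_bound[where a = a and z = "D k" and n = n and T = T and i = i, OF L Suc.IH int_Suc])
          (use Suc.prems in auto)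
    qed
    have "\<bar>D k j t\<bar> \<le> M * (inverse (fact k) * (real n * L * T) ^ k)" if jt: "j < n" "t \<in> {0..T}" for k j t
    proof -
      have "(real n * L * t) ^ k \<le> (real n * L * T) ^ k"
        using L0 jt(2) by (intro power_mono mult_left_mono) auto
      then have "M * (real n * L * t) ^ k / fact k \<le> M * (real n * L * T) ^ k / fact k"
        using M0 by (intro divide_right_mono mult_left_mono) auto
      with D[OF jt, of k] show ?thesis by (simp add: divide_inverse mult_ac)
    qed
    moreover have "summable (\<lambda>k. M * (inverse (fact k) * (real n * L * T) ^ k))"
      by (intro summable_mult summable_exp)
    ultimately show ?thesis by (intro exI[of _ "\<lambda>k. M * (inverse (fact k) * (real n * L * T) ^ k)"]) auto
  qed
  have summ: "summable (\<lambda>k. D k j t)" if j: "j < n" and t: "t \<ge> 0" for j t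
  proof -
    obtain e where e: "summable e" "\<forall>k. \<forall>j<n. \<forall>s\<in>{0..t}. \<bar>D k j s\<bar> \<le> e k" using bound[OF t] by blast
    show ?thesis
      by (rule summable_comparison_test[OF _ e(1)]) (use e(2) j t in \<open>auto intro!: exI[of _ 0]\<close>)
  qed
  define S where "S N j t = (\<Sum>k<N. D k j t)" for N j t
  define x where "x j t = (\<Sum>k. D k j t)" for j t
  have lim: "(\<lambda>N. S N j t) \<longlonglongrightarrow> x j t" if "j < n" "t \<ge> 0" for j t
    unfolding S_def x_def by (rule summable_LIMSEQ[OF summ[OF that]])
  \<comment> \<open>Integration raises the index of an increment by one, so the partial sum inside
    has one term fewer than the one outside; both have the same limit.\<close>
  have int_S: "((\<lambda>s. (\<Sum>j<n. a i j s * S N j s) + f i s) has_integral S (Suc N) i t) {0..t}" if i: "i < n" and t: "t \<ge> 0" for N i t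
  proof -
    have "((\<lambda>s. (\<Sum>k<N. \<Sum>j<n. a i j s * D k j s) + f i s) has_integral (\<Sum>k<N. D (Suc k) i t) + D 0 i t) {0..t}"
      by (intro has_integral_add has_integral_sum int_0 int_Suc i t) auto
    moreover have "(\<Sum>k<N. \<Sum>j<n. a i j s * D k j s) = (\<Sum>j<n. a i j s * S N j s)" for s
      unfolding S_def sum_distrib_left by (rule sum.swap)
    moreover have "(\<Sum>k<N. D (Suc k) i t) + D 0 i t = S (Suc N) i t"
      unfolding S_def sum.lessThan_Suc_shift by simp
    ultimately show ?thesis by simp
  qed
  have "((\<lambda>s. (\<Sum>j<n. a i j s * x j s) + f i s) has_integral x i t) {0..t}" if i: "i < n" and t: "t \<ge> 0" for i t
  proof -
    obtain e where e: "summable e" "\<forall>k. \<forall>j<n. \<forall>s\<in>{0..t}. \<bar>D k j s\<bar> \<le> e k" using bound[OF t] by blast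
    have e0: "e k \<ge> 0" for k
      using e(2)[rule_format, OF i, of t k] t by (auto intro: order_trans[OF abs_ge_zero])
    have "\<exists>L\<ge>0. \<forall>i<n. \<forall>j<n. \<forall>s\<in>{0..t}. \<bar>a i j s\<bar> \<le> L" by (rule matrix_bound[OF a t])
    then obtain L where L0: "L \<ge> 0" and L: "\<And>j s. j < n \<Longrightarrow> s \<in> {0..t} \<Longrightarrow> \<bar>a i j s\<bar> \<le> L" using i by blast
    obtain F where F: "\<And>s. s \<in> {0..t} \<Longrightarrow> \<bar>f i s\<bar> \<le> F"
      using f[OF i] t unfolding locally_tame_def by meson
    have S_bound: "\<bar>S N j s\<bar> \<le> suminf e" if "j < n" "s \<in> {0..t}" for N j s
    proof -
      have "\<bar>S N j s\<bar> \<le> (\<Sum>k<N. \<bar>D k j s\<bar>)" unfolding S_def by (rule sum_abs)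
      also have "\<dots> \<le> (\<Sum>k<N. e k)" using e(2) that by (intro sum_mono) auto
      also have "\<dots> \<le> suminf e" by (rule sum_le_suminf[OF e(1)]) (use e0 in auto)
      finally show ?thesis .
    qed
    have dom: "norm ((\<Sum>j<n. a i j s * S N j s) + f i s) \<le> real n * (L * suminf e) + F" if s: "s \<in> {0..t}" for N s
    proof -
      have "\<bar>\<Sum>j<n. a i j s * S N j s\<bar> \<le> (\<Sum>j<n. \<bar>a i j s * S N j s\<bar>)" by (rule sum_abs)
      also have "\<dots> \<le> (\<Sum>j<n. L * suminf e)"
      proof (rule sum_mono)
        fix j assume "j \<in> {..<n}"
        then have j: "j < n" by simp
        show "\<bar>a i j s * S N j s\<bar> \<le> L * suminf e"
          unfolding abs_mult by (rule mult_mono[OF L[OF j s] S_bound[OF j s] L0]) simp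
      qed
      finally have "\<bar>\<Sum>j<n. a i j s * S N j s\<bar> \<le> real n * (L * suminf e)" by simp
      moreover have "\<bar>f i s\<bar> \<le> F" by (rule F[OF s])
      ultimately show ?thesis by (simp only: real_norm_def)
    qed
    show ?thesis
    proof (rule has_integral_dominated_convergence[where f = "\<lambda>N s. (\<Sum>j<n. a i j s * S N j s) + f i s"
          and y = "\<lambda>N. S (Suc N) i t" and h = "\<lambda>_. real n * (L * suminf e) + F"])
      show "((\<lambda>s. (\<Sum>j<n. a i j s * S N j s) + f i s) has_integral S (Suc N) i t) {0..t}" for N
        by (rule int_S[OF i t])
      show "(\<lambda>_. real n * (L * suminf e) + F) integrable_on {0..t}" by (rule integrable_const_ivl)
      show "\<forall>s\<in>{0..t}. norm ((\<Sum>j<n. a i j s * S N j s) + f i s) \<le> real n * (L * suminf e) + F" for N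
        using dom by blast
      show "\<forall>s\<in>{0..t}. (\<lambda>N. (\<Sum>j<n. a i j s * S N j s) + f i s) \<longlonglongrightarrow> (\<Sum>j<n. a i j s * x j s) + f i s"
        by (intro ballI tendsto_add tendsto_sum tendsto_mult tendsto_const lim) auto
      show "(\<lambda>N. S (Suc N) i t) \<longlonglongrightarrow> x i t" by (rule LIMSEQ_Suc[OF lim[OF i t]])
    qed
  qed
  then show ?thesis by blast
qed

section \<open>From the integral form back to absolute continuity and derivatives\<close>

lemma integral_form_lipschitz:
  fixes g h :: "real \<Rightarrow> real"
  assumes g: "\<And>t. t \<ge> 0 \<Longrightarrow> (g has_integral h t) {0..t}" and B: "\<And>t. t \<in> {0..T} \<Longrightarrow> \<bar>g t\<bar> \<le> B"
    and st: "0 \<le> s" "s \<le> t" "t \<le> T"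
  shows "\<bar>h t - h s\<bar> \<le> B * (t - s)"
proof -
  have c: "((\<lambda>_. B) has_integral B * (t - s)) {s..t}"
    using has_integral_const_real[of B s t] st by (simp add: mult.commute)
  have gB: "\<bar>g r\<bar> \<le> B" if "r \<in> {s..t}" for r using B[of r] that st by simp
  have "g integrable_on {s..t}"
    by (rule integrable_subinterval_real[of g 0 t]) (use g[of t] st in \<open>auto simp: integrable_on_def\<close>)
  then obtain d where d: "(g has_integral d) {s..t}" by (auto simp: integrable_on_def)
  have "(g has_integral h s + d) {0..t}"
    by (rule has_integral_combine[OF st(1,2) g d]) (use st in auto)
  moreover have "(g has_integral h t) {0..t}" by (rule g) (use st in linarith)
  ultimately have "h t = h s + d" by (rule has_integral_unique[symmetric])
  moreover have "d \<le> B * (t - s)"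
    by (rule has_integral_le[OF d c]) (use gB in \<open>simp add: abs_le_iff\<close>)
  moreover have "- d \<le> B * (t - s)"
    by (rule has_integral_le[OF has_integral_neg[OF d] c]) (use gB in \<open>simp add: abs_le_iff\<close>)
  ultimately show ?thesis by (simp add: abs_le_iff)
qed

lemma lipschitz_absolutely_continuous:
  assumes lip: "\<And>s t. a \<le> s \<Longrightarrow> s \<le> t \<Longrightarrow> t \<le> b \<Longrightarrow> \<bar>h t - h s\<bar> \<le> B * (t - s)"
  shows "absolutely_continuous_on a b h"
  unfolding absolutely_continuous_on_def
proof (intro allI impI)
  fix e :: real assume e: "e > 0"
  \<comment> \<open>\<open>B\<close> need not be positive, but the quotient \<open>e / C\<close> has
    to be.\<close>
  define C where "C = max B 1"
  have C: "C > 0" "B \<le> C" by (auto simp: C_def)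
  show "\<exists>\<delta>>0. \<forall>D. finite D \<and> (\<forall>(s, t)\<in>D. a \<le> s \<and> s \<le> t \<and> t \<le> b) \<and>
        (\<forall>I\<in>D. \<forall>J\<in>D. I \<noteq> J \<longrightarrow> {fst I<..<snd I} \<inter> {fst J<..<snd J} = {}) \<and>
        (\<Sum>(s, t)\<in>D. t - s) < \<delta> \<longrightarrow> (\<Sum>(s, t)\<in>D. \<bar>h t - h s\<bar>) < e"
  proof (intro exI[of _ "e / C"] conjI allI impI)
    show "e / C > 0" using e C by simp
    fix D assume D: "finite D \<and> (\<forall>(s, t)\<in>D. a \<le> s \<and> s \<le> t \<and> t \<le> b) \<and>
        (\<forall>I\<in>D. \<forall>J\<in>D. I \<noteq> J \<longrightarrow> {fst I<..<snd I} \<inter> {fst J<..<snd J} = {}) \<and>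
        (\<Sum>(s, t)\<in>D. t - s) < e / C"
    have "(\<Sum>I\<in>D. \<bar>h (snd I) - h (fst I)\<bar>) \<le> (\<Sum>I\<in>D. C * (snd I - fst I))"
    proof (rule sum_mono)
      fix I assume "I \<in> D"
      then have I: "a \<le> fst I" "fst I \<le> snd I" "snd I \<le> b" using D by (auto simp: case_prod_unfold)
      have "\<bar>h (snd I) - h (fst I)\<bar> \<le> B * (snd I - fst I)" by (rule lip[OF I])
      also have "\<dots> \<le> C * (snd I - fst I)" using C(2) I(2) by (intro mult_right_mono) auto
      finally show "\<bar>h (snd I) - h (fst I)\<bar> \<le> C * (snd I - fst I)" .
    qed
    also have "\<dots> = C * (\<Sum>(s, t)\<in>D. t - s)" by (simp add: sum_distrib_left case_prod_unfold)
    also have "\<dots> < C * (e / C)" using D C(1) by (intro mult_strict_left_mono) auto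
    also have "\<dots> = e" using C(1) by simp
    finally show "(\<Sum>(s, t)\<in>D. \<bar>h t - h s\<bar>) < e" by (simp add: case_prod_unfold)
  qed
qed

lemma integral_form_derivative:
  fixes g h :: "real \<Rightarrow> real"
  assumes g: "\<And>t. t \<ge> 0 \<Longrightarrow> (g has_integral h t) {0..t}" and t: "t > 0"
    and cont: "continuous (at t within {0..}) g"
  shows "(h has_real_derivative g t) (at t)"
proof -
  have eq: "integral {0..s} g = h s" if "s \<ge> 0" for s using g[OF that] by (rule integral_unique)
  have "g integrable_on {0..t + 1}" using g[of "t + 1"] t by (auto simp: integrable_on_def)
  moreover have "continuous (at t within {0..t + 1} - {}) g"
    by (rule continuous_within_subset[OF cont]) auto
  ultimately have "((\<lambda>u. integral {0..u} g) has_vector_derivative g t) (at t within ({0..t + 1} - {}))"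
    using t by (intro integral_has_vector_derivative_continuous_at) auto
  moreover have "at t within ({0..t + 1} - {}) = at t"
    using t by (intro at_within_interior) (auto simp: interior_atLeastAtMost_real)
  ultimately have "((\<lambda>u. integral {0..u} g) has_real_derivative g t) (at t)"
    by (simp add: has_real_derivative_iff_has_vector_derivative)
  then show ?thesis
    by (rule has_field_derivative_transform_within_open[where S = "{0<..}"]) (use t eq in auto)
qed

lemma locally_tame_discontinuities_null:
  assumes "locally_tame g"
  shows "AE t in lebesgue. t \<ge> 0 \<longrightarrow> continuous (at t within {0..}) g"
proof -
  define N where "N = (\<Union>n. {t \<in> {0..real n}. \<not> continuous (at t within {0..}) g})"
  have "negligible N"
    unfolding N_def using assms by (intro negligible_Union_nat negligible_finite) (simp add: locally_tame_def)
  then have "N \<in> null_sets lebesgue" by (simp add: negligible_iff_null_sets)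
  moreover have "{t \<in> space lebesgue. \<not> (t \<ge> 0 \<longrightarrow> continuous (at t within {0..}) g)} \<subseteq> N"
  proof
    fix t assume t: "t \<in> {t \<in> space lebesgue. \<not> (t \<ge> 0 \<longrightarrow> continuous (at t within {0..}) g)}"
    obtain n where "t \<le> real n" using real_arch_simple by blast
    with t show "t \<in> N" by (auto simp: N_def)
  qed
  ultimately show ?thesis by (rule AE_I')
qed

section \<open>Morphisms of representations\<close>

lemma affine_mat_carrier: "M None \<in> carrier_mat m n \<Longrightarrow> affine_mat M q \<in> carrier_mat m n"
  by (simp add: affine_mat_def)

lemma affine_mat_index:
  assumes "M None \<in> carrier_mat m n" "j < m" "k < n"
  shows "affine_mat M q $$ (j, k) = M None $$ (j, k) + (\<Sum>i\<in>UNIV. M (Some i) $$ (j, k) * vec_nth q i)"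
  using assms by (simp add: affine_mat_def)

lemma affine_mat_mult_left:
  fixes F :: "'p::finite option \<Rightarrow> real mat"
  assumes M: "M \<in> carrier_mat k m" and F: "\<And>i. F i \<in> carrier_mat m n"
  shows "affine_mat (\<lambda>i. M * F i) q = M * affine_mat F q"
proof (rule eq_matI)
  fix i j assume "i < dim_row (M * affine_mat F q)" "j < dim_col (M * affine_mat F q)"
  then have ij: "i < k" "j < n" using M F[of None] by (auto simp: affine_mat_def)
  have "affine_mat (\<lambda>i. M * F i) q $$ (i, j) = (\<Sum>l<m. M $$ (i, l) * F None $$ (l, j)) +
      (\<Sum>r\<in>UNIV. (\<Sum>l<m. M $$ (i, l) * F (Some r) $$ (l, j)) * vec_nth q r)"
    using affine_mat_index[of "\<lambda>i. M * F i", OF mult_carrier_mat[OF M F] ij] by (simp only: mat_mult_index[OF M F ij])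
  also have "(\<Sum>r\<in>UNIV. (\<Sum>l<m. M $$ (i, l) * F (Some r) $$ (l, j)) * vec_nth q r)
      = (\<Sum>l<m. M $$ (i, l) * (\<Sum>r\<in>UNIV. F (Some r) $$ (l, j) * vec_nth q r))"
    unfolding sum_distrib_right sum_distrib_left mult.assoc by (rule sum.swap)
  also have "(\<Sum>l<m. M $$ (i, l) * F None $$ (l, j)) + \<dots> = (\<Sum>l<m. M $$ (i, l) * affine_mat F q $$ (l, j))"
    unfolding sum.distrib[symmetric] by (rule sum.cong) (use ij in \<open>simp_all add: affine_mat_index[of F, OF F] distrib_left\<close>)
  also have "\<dots> = (M * affine_mat F q) $$ (i, j)"
    by (rule mat_mult_index[OF M affine_mat_carrier[of F, OF F] ij, symmetric])
  finally show "affine_mat (\<lambda>i. M * F i) q $$ (i, j) = (M * affine_mat F q) $$ (i, j)" .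
qed (use M F[of None] in \<open>auto simp: affine_mat_def\<close>)

lemma affine_mat_mult_right:
  fixes F :: "'p::finite option \<Rightarrow> real mat"
  assumes M: "M \<in> carrier_mat n k" and F: "\<And>i. F i \<in> carrier_mat m n"
  shows "affine_mat (\<lambda>i. F i * M) q = affine_mat F q * M"
proof (rule eq_matI)
  fix i j assume "i < dim_row (affine_mat F q * M)" "j < dim_col (affine_mat F q * M)"
  then have ij: "i < m" "j < k" using M F[of None] by (auto simp: affine_mat_def)
  have "affine_mat (\<lambda>i. F i * M) q $$ (i, j) = (\<Sum>l<n. F None $$ (i, l) * M $$ (l, j)) +
      (\<Sum>r\<in>UNIV. (\<Sum>l<n. F (Some r) $$ (i, l) * M $$ (l, j)) * vec_nth q r)"
    using affine_mat_index[of "\<lambda>i. F i * M", OF mult_carrier_mat[OF F M] ij] by (simp only: mat_mult_index[OF F M ij])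
  also have "(\<Sum>r\<in>UNIV. (\<Sum>l<n. F (Some r) $$ (i, l) * M $$ (l, j)) * vec_nth q r)
      = (\<Sum>r\<in>UNIV. \<Sum>l<n. F (Some r) $$ (i, l) * vec_nth q r * M $$ (l, j))"
    unfolding sum_distrib_right by (simp only: mult_ac)
  also have "\<dots> = (\<Sum>l<n. (\<Sum>r\<in>UNIV. F (Some r) $$ (i, l) * vec_nth q r) * M $$ (l, j))"
    unfolding sum_distrib_right by (rule sum.swap)
  also have "(\<Sum>l<n. F None $$ (i, l) * M $$ (l, j)) + \<dots> = (\<Sum>l<n. affine_mat F q $$ (i, l) * M $$ (l, j))"
    unfolding sum.distrib[symmetric] by (rule sum.cong) (use ij in \<open>simp_all add: affine_mat_index[of F, OF F] distrib_right\<close>)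
  also have "\<dots> = (affine_mat F q * M) $$ (i, j)"
    by (rule mat_mult_index[OF affine_mat_carrier[of F, OF F] M ij, symmetric])
  finally show "affine_mat (\<lambda>i. F i * M) q $$ (i, j) = (affine_mat F q * M) $$ (i, j)" .
qed (use M F[of None] in \<open>auto simp: affine_mat_def\<close>)

text \<open>\<open>M\<close> maps states to states with the same input and output, so one notion
  covers a factor map and the inclusion of a subspace.\<close>

definition lpv_morphism :: "real mat \<Rightarrow> 'p::finite lpv_ssa \<Rightarrow> 'p lpv_ssa \<Rightarrow> bool" where
  "lpv_morphism M \<Sigma>\<^sub>1 \<Sigma>\<^sub>2 \<longleftrightarrow> M \<in> carrier_mat (state_dim \<Sigma>\<^sub>2) (state_dim \<Sigma>\<^sub>1) \<and>
     (\<forall>i. M * A_coeff \<Sigma>\<^sub>1 i = A_coeff \<Sigma>\<^sub>2 i * M \<and> M * B_coeff \<Sigma>\<^sub>1 i = B_coeff \<Sigma>\<^sub>2 i \<and> C_coeff \<Sigma>\<^sub>1 i = C_coeff \<Sigma>\<^sub>2 i * M)"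

locale lpv_pair =
  fixes nu ny :: nat and M :: "real mat" and \<Sigma>\<^sub>1 \<Sigma>\<^sub>2 :: "'p::finite lpv_ssa"
  assumes \<Sigma>\<^sub>1: "is_lpv_ssa nu ny \<Sigma>\<^sub>1" and \<Sigma>\<^sub>2: "is_lpv_ssa nu ny \<Sigma>\<^sub>2" and morphism: "lpv_morphism M \<Sigma>\<^sub>1 \<Sigma>\<^sub>2"
begin

abbreviation "n\<^sub>1 \<equiv> state_dim \<Sigma>\<^sub>1"
abbreviation "n\<^sub>2 \<equiv> state_dim \<Sigma>\<^sub>2"

lemma M_carrier: "M \<in> carrier_mat n\<^sub>2 n\<^sub>1"
  using morphism by (simp add: lpv_morphism_def)

lemma coeff_carriers:
  "A_coeff \<Sigma>\<^sub>1 i \<in> carrier_mat n\<^sub>1 n\<^sub>1" "A_coeff \<Sigma>\<^sub>2 i \<in> carrier_mat n\<^sub>2 n\<^sub>2"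
  "B_coeff \<Sigma>\<^sub>1 i \<in> carrier_mat n\<^sub>1 nu" "B_coeff \<Sigma>\<^sub>2 i \<in> carrier_mat n\<^sub>2 nu"
  "C_coeff \<Sigma>\<^sub>1 i \<in> carrier_mat ny n\<^sub>1" "C_coeff \<Sigma>\<^sub>2 i \<in> carrier_mat ny n\<^sub>2"
  using \<Sigma>\<^sub>1 \<Sigma>\<^sub>2 by (auto simp: is_lpv_ssa_def)

lemma affine_carriers:
  "affine_mat (A_coeff \<Sigma>\<^sub>1) q \<in> carrier_mat n\<^sub>1 n\<^sub>1"
  "affine_mat (A_coeff \<Sigma>\<^sub>2) q \<in> carrier_mat n\<^sub>2 n\<^sub>2"
  "affine_mat (B_coeff \<Sigma>\<^sub>1) q \<in> carrier_mat n\<^sub>1 nu" "affine_mat (B_coeff \<Sigma>\<^sub>2) q \<in> carrier_mat n\<^sub>2 nu"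
  "affine_mat (C_coeff \<Sigma>\<^sub>1) q \<in> carrier_mat ny n\<^sub>1" "affine_mat (C_coeff \<Sigma>\<^sub>2) q \<in> carrier_mat ny n\<^sub>2"
  by (rule affine_mat_carrier, rule coeff_carriers)+

lemma rhs_morphism:
  assumes "x \<in> carrier_vec n\<^sub>1" "u \<in> carrier_vec nu"
  shows "M *\<^sub>v (affine_mat (A_coeff \<Sigma>\<^sub>1) q *\<^sub>v x + affine_mat (B_coeff \<Sigma>\<^sub>1) q *\<^sub>v u)
    = affine_mat (A_coeff \<Sigma>\<^sub>2) q *\<^sub>v (M *\<^sub>v x) + affine_mat (B_coeff \<Sigma>\<^sub>2) q *\<^sub>v u"
proof -
  have "M * affine_mat (A_coeff \<Sigma>\<^sub>1) q = affine_mat (\<lambda>i. A_coeff \<Sigma>\<^sub>2 i * M) q"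
    using affine_mat_mult_left[where F = "A_coeff \<Sigma>\<^sub>1", OF M_carrier coeff_carriers(1)] morphism by (simp add: lpv_morphism_def)
  then have A: "M * affine_mat (A_coeff \<Sigma>\<^sub>1) q = affine_mat (A_coeff \<Sigma>\<^sub>2) q * M"
    using affine_mat_mult_right[where F = "A_coeff \<Sigma>\<^sub>2", OF M_carrier coeff_carriers(2)] by simp
  have B: "M * affine_mat (B_coeff \<Sigma>\<^sub>1) q = affine_mat (B_coeff \<Sigma>\<^sub>2) q"
    using affine_mat_mult_left[where F = "B_coeff \<Sigma>\<^sub>1", OF M_carrier coeff_carriers(3)] morphism by (simp add: lpv_morphism_def)
  have "M *\<^sub>v (affine_mat (A_coeff \<Sigma>\<^sub>1) q *\<^sub>v x + affine_mat (B_coeff \<Sigma>\<^sub>1) q *\<^sub>v u)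
    = M *\<^sub>v (affine_mat (A_coeff \<Sigma>\<^sub>1) q *\<^sub>v x) + M *\<^sub>v (affine_mat (B_coeff \<Sigma>\<^sub>1) q *\<^sub>v u)"
    by (rule mult_add_distrib_mat_vec[OF M_carrier mult_mat_vec_carrier[OF affine_carriers(1) assms(1)]
      mult_mat_vec_carrier[OF affine_carriers(3) assms(2)]])
  also have "M *\<^sub>v (affine_mat (A_coeff \<Sigma>\<^sub>1) q *\<^sub>v x) = (M * affine_mat (A_coeff \<Sigma>\<^sub>1) q) *\<^sub>v x"
    by (rule assoc_mult_mat_vec[OF M_carrier affine_carriers(1) assms(1), symmetric])
  also have "\<dots> = affine_mat (A_coeff \<Sigma>\<^sub>2) q *\<^sub>v (M *\<^sub>v x)"
    unfolding A by (rule assoc_mult_mat_vec[OF affine_carriers(2) M_carrier assms(1)])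
  also have "M *\<^sub>v (affine_mat (B_coeff \<Sigma>\<^sub>1) q *\<^sub>v u) = (M * affine_mat (B_coeff \<Sigma>\<^sub>1) q) *\<^sub>v u"
    by (rule assoc_mult_mat_vec[OF M_carrier affine_carriers(3) assms(2), symmetric])
  finally show ?thesis unfolding B .
qed

lemma output_morphism:
  assumes "x \<in> carrier_vec n\<^sub>1"
  shows "affine_mat (C_coeff \<Sigma>\<^sub>1) q *\<^sub>v x = affine_mat (C_coeff \<Sigma>\<^sub>2) q *\<^sub>v (M *\<^sub>v x)"
proof -
  have C: "C_coeff \<Sigma>\<^sub>1 = (\<lambda>i. C_coeff \<Sigma>\<^sub>2 i * M)" using morphism by (auto simp: lpv_morphism_def)
  have "affine_mat (C_coeff \<Sigma>\<^sub>1) q = affine_mat (C_coeff \<Sigma>\<^sub>2) q * M"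
    unfolding C by (rule affine_mat_mult_right[where F = "C_coeff \<Sigma>\<^sub>2", OF M_carrier coeff_carriers(6)])
  then show ?thesis using assoc_mult_mat_vec[OF affine_carriers(6) M_carrier assms] by simp
qed

lemma mult_zero_vec_morphism: "M *\<^sub>v 0\<^sub>v n\<^sub>1 = 0\<^sub>v n\<^sub>2"
  using M_carrier by (intro eq_vecI) auto

lemma dt_state_morphism:
  assumes u: "u \<in> dt_inputs nu"
  shows "dt_state \<Sigma>\<^sub>1 (0\<^sub>v n\<^sub>1) u p t \<in> carrier_vec n\<^sub>1 \<and>
    dt_state \<Sigma>\<^sub>2 (0\<^sub>v n\<^sub>2) u p t = M *\<^sub>v dt_state \<Sigma>\<^sub>1 (0\<^sub>v n\<^sub>1) u p t"
proof (induction t)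
  case 0
  show ?case by (simp add: mult_zero_vec_morphism)
next
  case (Suc t)
  have ut: "u t \<in> carrier_vec nu" using u by (simp add: dt_inputs_def)
  have "dt_state \<Sigma>\<^sub>1 (0\<^sub>v n\<^sub>1) u p (Suc t) \<in> carrier_vec n\<^sub>1"
    unfolding dt_state.simps
    by (intro add_carrier_vec mult_mat_vec_carrier[OF affine_carriers(1) conjunct1[OF Suc]] mult_mat_vec_carrier[OF affine_carriers(3) ut])
  moreover have "dt_state \<Sigma>\<^sub>2 (0\<^sub>v n\<^sub>2) u p (Suc t) = M *\<^sub>v dt_state \<Sigma>\<^sub>1 (0\<^sub>v n\<^sub>1) u p (Suc t)"
    unfolding dt_state.simps conjunct2[OF Suc] by (rule rhs_morphism[OF conjunct1[OF Suc] ut, symmetric])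
  ultimately show ?case by blast
qed

lemma dt_io_map_morphism:
  "dt_io_map nu P \<Sigma>\<^sub>1 (0\<^sub>v n\<^sub>1) = dt_io_map nu P \<Sigma>\<^sub>2 (0\<^sub>v n\<^sub>2)"
  unfolding dt_io_map_def
proof (rule restrict_ext, clarify)
  fix u p assume u: "u \<in> dt_inputs nu"
  show "(\<lambda>t. affine_mat (C_coeff \<Sigma>\<^sub>1) (p t) *\<^sub>v dt_state \<Sigma>\<^sub>1 (0\<^sub>v n\<^sub>1) u p t)
      = (\<lambda>t. affine_mat (C_coeff \<Sigma>\<^sub>2) (p t) *\<^sub>v dt_state \<Sigma>\<^sub>2 (0\<^sub>v n\<^sub>2) u p t)"
    using dt_state_morphism[OF u] output_morphism by auto
qed

end

section \<open>Trajectories\<close>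

definition state_rhs :: "'p::finite lpv_ssa \<Rightarrow> (real \<Rightarrow> real Matrix.vec) \<Rightarrow> (real \<Rightarrow> real ^ 'p) \<Rightarrow> (real \<Rightarrow> real Matrix.vec) \<Rightarrow> real \<Rightarrow> real Matrix.vec" where
  "state_rhs \<Sigma> u p x t = affine_mat (A_coeff \<Sigma>) (p t) *\<^sub>v x t + affine_mat (B_coeff \<Sigma>) (p t) *\<^sub>v u t"

text \<open>The state equation as a Volterra equation; the missing constant term encodes the zero
  initial state. Values at negative times are left free, which makes the notion stable under
  matrices.\<close>

definition integral_trajectory :: "'p::finite lpv_ssa \<Rightarrow> (real \<Rightarrow> real Matrix.vec) \<Rightarrow> (real \<Rightarrow> real ^ 'p) \<Rightarrow> (real \<Rightarrow> real Matrix.vec) \<Rightarrow> bool" where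
  "integral_trajectory \<Sigma> u p x \<longleftrightarrow> (\<forall>t\<ge>0. x t \<in> carrier_vec (state_dim \<Sigma>)) \<and>
     (\<forall>i<state_dim \<Sigma>. \<forall>t\<ge>0. ((\<lambda>s. state_rhs \<Sigma> u p x s $ i) has_integral x t $ i) {0..t})"

lemma (in lpv_pair) integral_trajectory_morphism:
  assumes u: "u \<in> ct_inputs nu" and x: "integral_trajectory \<Sigma>\<^sub>1 u p x"
  shows "integral_trajectory \<Sigma>\<^sub>2 u p (\<lambda>t. M *\<^sub>v x t)"
  unfolding integral_trajectory_def
proof (intro conjI allI impI)
  have xc: "x t \<in> carrier_vec n\<^sub>1" and uc: "u t \<in> carrier_vec nu" if "t \<ge> 0" for t
    using x u that by (auto simp: integral_trajectory_def ct_inputs_def)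
  show "M *\<^sub>v x t \<in> carrier_vec n\<^sub>2" if "t \<ge> 0" for t
    by (rule mult_mat_vec_carrier[OF M_carrier xc[OF that]])
  have index: "(M *\<^sub>v y) $ i = (\<Sum>j<n\<^sub>1. M $$ (i, j) * y $ j)"
    if "i < n\<^sub>2" "y \<in> carrier_vec n\<^sub>1" for i y
    using that M_carrier by (auto simp: scalar_prod_def atLeast0LessThan)
  fix i and t :: real assume i: "i < n\<^sub>2" and t: "t \<ge> 0"
  have "((\<lambda>s. \<Sum>j<n\<^sub>1. M $$ (i, j) * state_rhs \<Sigma>\<^sub>1 u p x s $ j) has_integral (\<Sum>j<n\<^sub>1. M $$ (i, j) * x t $ j)) {0..t}"
    using x t by (intro has_integral_sum has_integral_mult_right) (auto simp: integral_trajectory_def)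
  moreover have "(\<Sum>j<n\<^sub>1. M $$ (i, j) * state_rhs \<Sigma>\<^sub>1 u p x s $ j) = state_rhs \<Sigma>\<^sub>2 u p (\<lambda>t. M *\<^sub>v x t) s $ i"
    if "s \<in> {0..t}" for s
  proof -
    have s: "s \<ge> 0" using that by simp
    have "state_rhs \<Sigma>\<^sub>1 u p x s \<in> carrier_vec n\<^sub>1"
      unfolding state_rhs_def
      by (intro add_carrier_vec mult_mat_vec_carrier[OF affine_carriers(1) xc[OF s]] mult_mat_vec_carrier[OF affine_carriers(3) uc[OF s]])
    from index[OF i this, symmetric] show ?thesis
      unfolding state_rhs_def using rhs_morphism[OF xc[OF s] uc[OF s]] by simp
  qed
  ultimately have "((\<lambda>s. state_rhs \<Sigma>\<^sub>2 u p (\<lambda>t. M *\<^sub>v x t) s $ i) has_integral (\<Sum>j<n\<^sub>1. M $$ (i, j) * x t $ j)) {0..t}"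
    by (rule has_integral_eq[rotated])
  then show "((\<lambda>s. state_rhs \<Sigma>\<^sub>2 u p (\<lambda>t. M *\<^sub>v x t) s $ i) has_integral (M *\<^sub>v x t) $ i) {0..t}"
    by (simp only: index[OF i xc[OF t]])
qed

locale ct_system =
  fixes nu ny :: nat and P :: "(real ^ 'p::finite) set" and \<Sigma> :: "'p lpv_ssa" and u and p
  assumes \<Sigma>: "is_lpv_ssa nu ny \<Sigma>" and u: "u \<in> ct_inputs nu" and p: "p \<in> ct_schedulings P"
begin

abbreviation "n \<equiv> state_dim \<Sigma>"
abbreviation "drift i j t \<equiv> affine_mat (A_coeff \<Sigma>) (p t) $$ (i, j)"
abbreviation "forcing i t \<equiv> \<Sum>l<nu. affine_mat (B_coeff \<Sigma>) (p t) $$ (i, l) * u t $ l"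

lemma carriers: "A_coeff \<Sigma> i \<in> carrier_mat n n" "B_coeff \<Sigma> i \<in> carrier_mat n nu"
  using \<Sigma> by (auto simp: is_lpv_ssa_def)

lemma affine_entry_tame:
  assumes "F None \<in> carrier_mat k m" "i < k" "j < m"
  shows "locally_tame (\<lambda>t. affine_mat F (p t) $$ (i, j))"
proof -
  have "locally_tame (\<lambda>t. vec_nth (p t) r)" for r
    using p by (intro piecewise_continuous_locally_tame piecewise_continuous_component) (simp add: ct_schedulings_def)
  then have "locally_tame (\<lambda>t. F None $$ (i, j) + (\<Sum>r\<in>UNIV. F (Some r) $$ (i, j) * vec_nth (p t) r))"
    by (intro locally_tame_add locally_tame_sum locally_tame_mult locally_tame_const)
  then show ?thesis by (simp only: affine_mat_index[of F, OF assms])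
qed

lemma drift_tame: "i < n \<Longrightarrow> j < n \<Longrightarrow> locally_tame (drift i j)"
  by (rule affine_entry_tame[of "A_coeff \<Sigma>", OF carriers(1)])

lemma forcing_tame: "i < n \<Longrightarrow> locally_tame (forcing i)"
  using u
  by (intro locally_tame_sum locally_tame_mult affine_entry_tame[of "B_coeff \<Sigma>", OF carriers(2)] piecewise_continuous_locally_tame)
    (auto simp: ct_inputs_def)

lemma state_rhs_index:
  assumes "i < n" "t \<ge> 0" "x t \<in> carrier_vec n"
  shows "state_rhs \<Sigma> u p x t $ i = (\<Sum>j<n. drift i j t * x t $ j) + forcing i t"
proof -
  have "u t \<in> carrier_vec nu" using u assms(2) by (simp add: ct_inputs_def)
  then show ?thesis
    using assms affine_mat_carrier[of "A_coeff \<Sigma>", OF carriers(1), of "p t"] affine_mat_carrier[of "B_coeff \<Sigma>", OF carriers(2), of "p t"]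
    by (auto simp: state_rhs_def scalar_prod_def atLeast0LessThan)
qed

lemma integral_trajectory_iff:
  "integral_trajectory \<Sigma> u p x \<longleftrightarrow> (\<forall>t\<ge>0. x t \<in> carrier_vec n) \<and>
     (\<forall>i<n. \<forall>t\<ge>0. ((\<lambda>s. (\<Sum>j<n. drift i j s * x s $ j) + forcing i s) has_integral x t $ i) {0..t})"
proof -
  have "((\<lambda>s. state_rhs \<Sigma> u p x s $ i) has_integral x t $ i) {0..t} \<longleftrightarrow>
      ((\<lambda>s. (\<Sum>j<n. drift i j s * x s $ j) + forcing i s) has_integral x t $ i) {0..t}"
    if "\<forall>t\<ge>0. x t \<in> carrier_vec n" "i < n" for i t
    by (rule has_integral_cong) (use that state_rhs_index in auto)
  then show ?thesis unfolding integral_trajectory_def by blast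
qed

lemma integral_trajectory_exists: "\<exists>x. integral_trajectory \<Sigma> u p x"
proof -
  have "\<exists>X. \<forall>i<n. \<forall>t\<ge>0. ((\<lambda>s. (\<Sum>j<n. drift i j s * X j s) + forcing i s) has_integral X i t) {0..t}"
    by (rule linear_integral_equation_exists[OF drift_tame forcing_tame])
  then obtain X where X: "\<And>i t. i < n \<Longrightarrow> t \<ge> 0 \<Longrightarrow> ((\<lambda>s. (\<Sum>j<n. drift i j s * X j s) + forcing i s) has_integral X i t) {0..t}"
    by blast
  have "integral_trajectory \<Sigma> u p (\<lambda>t. Matrix.vec n (\<lambda>i. X i t))"
    unfolding integral_trajectory_iff using X by simp
  then show ?thesis by blast
qed

lemma integral_trajectory_unique:
  assumes x: "integral_trajectory \<Sigma> u p x" and y: "integral_trajectory \<Sigma> u p y" and t: "t \<ge> 0"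
  shows "x t = y t"
proof (rule eq_vecI)
  have c: "x t \<in> carrier_vec n" "y t \<in> carrier_vec n" using x y t by (simp_all add: integral_trajectory_def)
  then show "dim_vec (x t) = dim_vec (y t)" by simp
  fix i assume "i < dim_vec (y t)"
  then have i: "i < n" using c by simp
  have "x t $ i - y t $ i = 0"
  proof (rule linear_integral_equation_unique[of n drift "\<lambda>j s. x s $ j - y s $ j", OF drift_tame _ i t])
    fix i and t :: real assume "i < n" "t \<ge> 0"
    then have "((\<lambda>s. ((\<Sum>j<n. drift i j s * x s $ j) + forcing i s) - ((\<Sum>j<n. drift i j s * y s $ j) + forcing i s))
        has_integral x t $ i - y t $ i) {0..t}"
      using x y unfolding integral_trajectory_iff by (intro has_integral_diff) blast+
    then show "((\<lambda>s. \<Sum>j<n. drift i j s * (x s $ j - y s $ j)) has_integral x t $ i - y t $ i) {0..t}"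
      by (simp add: right_diff_distrib sum_subtractf)
  qed
  then show "x t $ i = y t $ i" by simp
qed

text \<open>The fundamental theorem of calculus for absolutely continuous functions with a
  negligible exceptional set.\<close>

lemma trajectory_imp_integral:
  assumes x: "ct_is_trajectory \<Sigma> (0\<^sub>v n) u p x"
  shows "integral_trajectory \<Sigma> u p x"
  unfolding integral_trajectory_def
proof (intro conjI allI impI)
  show "x t \<in> carrier_vec n" if "t \<ge> 0" for t using x that by (simp add: ct_is_trajectory_def)
  fix i and t :: real assume i: "i < n" and t: "t \<ge> 0"
  have "AE s in lebesgue. s > 0 \<longrightarrow> ((\<lambda>s. x s $ i) has_real_derivative state_rhs \<Sigma> u p x s $ i) (at s)"
    using x i unfolding ct_is_trajectory_def state_rhs_def by blast
  then obtain N where N: "{s \<in> space lebesgue. \<not> (s > 0 \<longrightarrow> ((\<lambda>s. x s $ i) has_real_derivative state_rhs \<Sigma> u p x s $ i) (at s))} \<subseteq> N"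
    "emeasure lebesgue N = 0" "N \<in> sets lebesgue"
    by (rule AE_E)
  have "negligible N"
    unfolding negligible_iff_null_sets using N(2,3) by (rule null_setsI)
  \<comment> \<open>The differential equation is only postulated for positive times, so 0 joins the
    exceptional set.\<close>
  then have "negligible (insert 0 N)" by simp
  moreover have "((\<lambda>s. x s $ i) has_real_derivative state_rhs \<Sigma> u p x s $ i) (at s)" if s: "s \<in> {0..t} - insert 0 N" for s
  proof (rule ccontr)
    assume "\<not> ((\<lambda>s. x s $ i) has_real_derivative state_rhs \<Sigma> u p x s $ i) (at s)"
    moreover have "s > 0" using s by simp
    ultimately have "s \<in> N" by (intro subsetD[OF N(1)]) simp
    with s show False by simp
  qed
  moreover have "absolutely_continuous_on 0 t (\<lambda>s. x s $ i)"
    using x i t by (simp add: ct_is_trajectory_def)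
  ultimately have "((\<lambda>s. state_rhs \<Sigma> u p x s $ i) has_integral x t $ i - x 0 $ i) {0..t}"
    by (intro absolutely_continuous_has_integral[OF t])
  moreover have "x 0 $ i = 0" using x i by (simp add: ct_is_trajectory_def)
  ultimately show "((\<lambda>s. state_rhs \<Sigma> u p x s $ i) has_integral x t $ i) {0..t}" by simp
qed

text \<open>The right-hand side is bounded on compact intervals, so the state is Lipschitz there and
  thus absolutely continuous; it is differentiable wherever the right-hand side is
  continuous.\<close>

lemma integral_imp_trajectory:
  assumes x: "integral_trajectory \<Sigma> u p x" and ext: "x \<in> extensional {0..}"
  shows "ct_is_trajectory \<Sigma> (0\<^sub>v n) u p x"
proof -
  let ?g = "\<lambda>i s. (\<Sum>j<n. drift i j s * x s $ j) + forcing i s"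
  have xc: "\<And>t. t \<ge> 0 \<Longrightarrow> x t \<in> carrier_vec n" and
    int: "\<And>i t. i < n \<Longrightarrow> t \<ge> 0 \<Longrightarrow> (?g i has_integral x t $ i) {0..t}"
    using x unfolding integral_trajectory_iff by blast+
  have x_tame: "locally_tame (\<lambda>t. x t $ i)" if "i < n" for i
    by (rule locally_tame_continuous, rule integral_form_continuous[OF int[OF that]])
  have g_tame: "locally_tame (?g i)" if "i < n" for i
    using that by (intro locally_tame_add locally_tame_sum locally_tame_mult drift_tame forcing_tame x_tame) auto
  \<comment> \<open>The integral over the degenerate interval vanishes, which recovers the initial
    value.\<close>
  have x0: "x 0 = 0\<^sub>v n"
  proof (rule eq_vecI)
    fix i assume i: "i < dim_vec (0\<^sub>v n :: real Matrix.vec)"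
    then have "(?g i has_integral x 0 $ i) (cbox 0 0)"
      unfolding box_real by (intro int) simp_all
    from has_integral_unique[OF this has_integral_refl(1)] have "x 0 $ i = 0" .
    then show "x 0 $ i = 0\<^sub>v n $ i" using i by simp
  qed (use xc[of 0] in simp)
  have ac: "absolutely_continuous_on 0 T (\<lambda>t. x t $ i)" if i: "i < n" and T: "T \<ge> 0" for i T
  proof -
    obtain B where B: "\<And>t. t \<in> {0..T} \<Longrightarrow> \<bar>?g i t\<bar> \<le> B"
      using g_tame[OF i] T unfolding locally_tame_def by meson
    show ?thesis
      by (rule lipschitz_absolutely_continuous, rule integral_form_lipschitz[OF int[OF i] B])
  qed
  have "AE t in lebesgue. t > 0 \<longrightarrow> ((\<lambda>s. x s $ i) has_real_derivative state_rhs \<Sigma> u p x t $ i) (at t)" if i: "i < n" for i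
    using locally_tame_discontinuities_null[OF g_tame[OF i]]
  proof eventually_elim
    case (elim t)
    show ?case
    proof
      assume t: "t > 0"
      have "((\<lambda>s. x s $ i) has_real_derivative ?g i t) (at t)"
        by (rule integral_form_derivative[OF int[OF i] t]) (use elim t in auto)
      moreover have "state_rhs \<Sigma> u p x t $ i = ?g i t"
        by (rule state_rhs_index[OF i]) (use t xc in auto)
      ultimately show "((\<lambda>s. x s $ i) has_real_derivative state_rhs \<Sigma> u p x t $ i) (at t)" by simp
    qed
  qed
  then show ?thesis
    unfolding ct_is_trajectory_def state_rhs_def using ext xc x0 ac by blast
qed

text \<open>Resolves the definite description: restricting to \<open>{0..}\<close> makes the
  solution extensional, and any other trajectory satisfies the same integral equation.\<close>

lemma ct_state_eq:
  assumes x: "integral_trajectory \<Sigma> u p x" and t: "t \<ge> 0"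
  shows "ct_state \<Sigma> (0\<^sub>v n) u p t = x t"
proof -
  define y where "y = restrict x {0..}"
  have "integral_trajectory \<Sigma> u p y"
  proof -
    have "((\<lambda>s. (\<Sum>j<n. drift i j s * y s $ j) + forcing i s) has_integral y t $ i) {0..t}" if "i < n" "t \<ge> 0" for i t
    proof -
      have "((\<lambda>s. (\<Sum>j<n. drift i j s * x s $ j) + forcing i s) has_integral x t $ i) {0..t}"
        using x that unfolding integral_trajectory_iff by blast
      then have "((\<lambda>s. (\<Sum>j<n. drift i j s * y s $ j) + forcing i s) has_integral x t $ i) {0..t}"
        by (rule has_integral_eq[rotated]) (simp add: y_def)
      then show ?thesis using that by (simp add: y_def)
    qed
    then show ?thesis using x unfolding integral_trajectory_iff by (simp add: y_def)
  qed
  then have y: "ct_is_trajectory \<Sigma> (0\<^sub>v n) u p y"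
    by (rule integral_imp_trajectory) (simp add: y_def)
  have "ct_state \<Sigma> (0\<^sub>v n) u p = y"
    unfolding ct_state_def
  proof (rule the_equality)
    show "ct_is_trajectory \<Sigma> (0\<^sub>v n) u p y" by (rule y)
    fix z assume z: "ct_is_trajectory \<Sigma> (0\<^sub>v n) u p z"
    have eq: "z t = y t" if "t \<in> {0..}" for t
      by (rule integral_trajectory_unique[OF trajectory_imp_integral[OF z] trajectory_imp_integral[OF y]]) (use that in simp)
    have "z \<in> extensional {0..}" "y \<in> extensional {0..}" using z y by (simp_all add: ct_is_trajectory_def)
    then show "z = y" by (rule extensionalityI) (rule eq)
  qed
  then show ?thesis using t by (simp add: y_def)
qed

end

lemma (in lpv_pair) ct_io_map_morphism:
  "ct_io_map nu P \<Sigma>\<^sub>1 (0\<^sub>v n\<^sub>1) = ct_io_map nu P \<Sigma>\<^sub>2 (0\<^sub>v n\<^sub>2)"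
  unfolding ct_io_map_def
proof (rule restrict_ext, clarify)
  fix u and p :: "real \<Rightarrow> real ^ 'p" assume u: "u \<in> ct_inputs nu" and p: "p \<in> ct_schedulings P"
  interpret s1: ct_system nu ny P \<Sigma>\<^sub>1 u p by unfold_locales (rule \<Sigma>\<^sub>1 u p)+
  interpret s2: ct_system nu ny P \<Sigma>\<^sub>2 u p by unfold_locales (rule \<Sigma>\<^sub>2 u p)+
  obtain x where x: "integral_trajectory \<Sigma>\<^sub>1 u p x" using s1.integral_trajectory_exists by blast
  note Mx = integral_trajectory_morphism[OF u x]
  show "(\<lambda>t\<in>{0..}. affine_mat (C_coeff \<Sigma>\<^sub>1) (p t) *\<^sub>v ct_state \<Sigma>\<^sub>1 (0\<^sub>v n\<^sub>1) u p t)
      = (\<lambda>t\<in>{0..}. affine_mat (C_coeff \<Sigma>\<^sub>2) (p t) *\<^sub>v ct_state \<Sigma>\<^sub>2 (0\<^sub>v n\<^sub>2) u p t)"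
  proof (rule restrict_ext)
    fix t :: real assume "t \<in> {0..}"
    then have t: "t \<ge> 0" by simp
    have "x t \<in> carrier_vec n\<^sub>1" using x t by (simp add: integral_trajectory_def)
    from output_morphism[OF this]
    show "affine_mat (C_coeff \<Sigma>\<^sub>1) (p t) *\<^sub>v ct_state \<Sigma>\<^sub>1 (0\<^sub>v n\<^sub>1) u p t
      = affine_mat (C_coeff \<Sigma>\<^sub>2) (p t) *\<^sub>v ct_state \<Sigma>\<^sub>2 (0\<^sub>v n\<^sub>2) u p t"
      unfolding s1.ct_state_eq[OF x t] s2.ct_state_eq[OF Mx t] .
  qed
qed

section \<open>The smaller representation and the contradiction with minimality\<close>

text \<open>The same formula yields the quotient system if \<open>T\<close> is a factor map and the
  restricted system if \<open>S\<close> is the inclusion of an invariant subspace.\<close>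

definition compression :: "real mat \<Rightarrow> real mat \<Rightarrow> 'p::finite lpv_ssa \<Rightarrow> 'p lpv_ssa" where
  "compression S T \<Sigma> = \<lparr>state_dim = dim_col S, A_coeff = (\<lambda>i. T * A_coeff \<Sigma> i * S),
     B_coeff = (\<lambda>i. T * B_coeff \<Sigma> i), C_coeff = (\<lambda>i. C_coeff \<Sigma> i * S)\<rparr>"

lemma compression_is_lpv_ssa:
  assumes "is_lpv_ssa nu ny \<Sigma>" "S \<in> carrier_mat (state_dim \<Sigma>) m" "T \<in> carrier_mat m (state_dim \<Sigma>)"
  shows "is_lpv_ssa nu ny (compression S T \<Sigma>)" "state_dim (compression S T \<Sigma>) = m"
  using assms by (auto simp: is_lpv_ssa_def compression_def intro!: mult_carrier_mat)

text \<open>The direction of the morphism differs: \<open>T\<close> leads from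
  \<open>\<Sigma>\<close> to the compression, \<open>S\<close> from the compression to
  \<open>\<Sigma>\<close>. Either way the input-output maps from zero agree.\<close>

lemma reducible_smaller_system:
  assumes \<Sigma>: "is_lpv_ssa nu ny \<Sigma>" and red: "observation_reducible \<Sigma> \<or> reachability_reducible \<Sigma>"
  obtains \<Sigma>' where "is_lpv_ssa nu ny \<Sigma>'" "state_dim \<Sigma>' < state_dim \<Sigma>"
    "ct_io_map nu P \<Sigma>' (0\<^sub>v (state_dim \<Sigma>')) = ct_io_map nu P \<Sigma> (0\<^sub>v (state_dim \<Sigma>))"
    "dt_io_map nu P \<Sigma>' (0\<^sub>v (state_dim \<Sigma>')) = dt_io_map nu P \<Sigma> (0\<^sub>v (state_dim \<Sigma>))"
  using red
proof
  assume "observation_reducible \<Sigma>"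
  then obtain m S T where m: "m < state_dim \<Sigma>" and ST: "S \<in> carrier_mat (state_dim \<Sigma>) m" "T \<in> carrier_mat m (state_dim \<Sigma>)"
    and eqs: "\<And>i. T * A_coeff \<Sigma> i = T * A_coeff \<Sigma> i * S * T" "\<And>i. C_coeff \<Sigma> i = C_coeff \<Sigma> i * S * T"
    unfolding observation_reducible_def by blast
  note \<Sigma>' = compression_is_lpv_ssa[OF \<Sigma> ST]
  have "lpv_morphism T \<Sigma> (compression S T \<Sigma>)"
    unfolding lpv_morphism_def \<Sigma>'(2) using ST(2) eqs by (simp add: compression_def)
  then interpret lpv_pair nu ny T \<Sigma> "compression S T \<Sigma>" by unfold_locales (rule \<Sigma> \<Sigma>')+
  show thesis
    by (rule that[OF \<Sigma>'(1)]) (use m \<Sigma>'(2) ct_io_map_morphism dt_io_map_morphism in simp_all)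
next
  assume "reachability_reducible \<Sigma>"
  then obtain m S T where m: "m < state_dim \<Sigma>" and ST: "S \<in> carrier_mat (state_dim \<Sigma>) m" "T \<in> carrier_mat m (state_dim \<Sigma>)"
    and eqs: "\<And>i. A_coeff \<Sigma> i * S = S * (T * A_coeff \<Sigma> i * S)" "\<And>i. B_coeff \<Sigma> i = S * (T * B_coeff \<Sigma> i)"
    unfolding reachability_reducible_def by blast
  note \<Sigma>' = compression_is_lpv_ssa[OF \<Sigma> ST]
  have "lpv_morphism S (compression S T \<Sigma>) \<Sigma>"
    unfolding lpv_morphism_def \<Sigma>'(2) using ST(1) eqs by (simp add: compression_def)
  then interpret lpv_pair nu ny S "compression S T \<Sigma>" \<Sigma> by unfold_locales (rule \<Sigma> \<Sigma>')+
  show thesis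
    by (rule that[OF \<Sigma>'(1)]) (use m \<Sigma>'(2) ct_io_map_morphism dt_io_map_morphism in simp_all)
qed

theorem corollary4:
  fixes P :: "(real ^ 'p::finite) set" and \<Sigma> :: "'p lpv_ssa" and nu ny :: nat
  assumes "affine hull P = UNIV"
    and "is_lpv_ssa nu ny \<Sigma>"
  shows "(ct_regularity_certificate P \<and> ct_minimal nu ny P \<Sigma> (0\<^sub>v (state_dim \<Sigma>))
            \<longrightarrow> ct_jointly_state_minimal \<Sigma>) \<and>
         (dt_regularity_certificate P \<Sigma> \<and> dt_minimal nu ny P \<Sigma> (0\<^sub>v (state_dim \<Sigma>))
            \<longrightarrow> dt_jointly_state_minimal \<Sigma>)"
proof (intro conjI impI)
  assume "ct_regularity_certificate P \<and> ct_minimal nu ny P \<Sigma> (0\<^sub>v (state_dim \<Sigma>))"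
  then have min: "ct_minimal nu ny P \<Sigma> (0\<^sub>v (state_dim \<Sigma>))" by simp
  show "ct_jointly_state_minimal \<Sigma>"
  proof (rule ccontr)
    assume "\<not> ct_jointly_state_minimal \<Sigma>"
    then have "observation_reducible \<Sigma> \<or> reachability_reducible \<Sigma>"
      using ct_unobservable_reducible[OF assms(2)] ct_unreachable_reducible[OF assms(2)]
      unfolding ct_jointly_state_minimal_def by blast
    then obtain \<Sigma>' where \<Sigma>': "is_lpv_ssa nu ny \<Sigma>'" "state_dim \<Sigma>' < state_dim \<Sigma>"
      "ct_io_map nu P \<Sigma>' (0\<^sub>v (state_dim \<Sigma>')) = ct_io_map nu P \<Sigma> (0\<^sub>v (state_dim \<Sigma>))"
      by (rule reducible_smaller_system[OF assms(2)])
    then have "state_dim \<Sigma> \<le> state_dim \<Sigma>'"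
      using min unfolding ct_minimal_def by (metis zero_carrier_vec)
    with \<Sigma>'(2) show False by simp
  qed
next
  assume "dt_regularity_certificate P \<Sigma> \<and> dt_minimal nu ny P \<Sigma> (0\<^sub>v (state_dim \<Sigma>))"
  then have reg: "dt_regularity_certificate P \<Sigma>" and min: "dt_minimal nu ny P \<Sigma> (0\<^sub>v (state_dim \<Sigma>))" by simp_all
  show "dt_jointly_state_minimal \<Sigma>"
  proof (rule ccontr)
    assume "\<not> dt_jointly_state_minimal \<Sigma>"
    then have "observation_reducible \<Sigma> \<or> reachability_reducible \<Sigma>"
      using dt_unobservable_reducible[OF assms(2) reg] dt_unreachable_reducible[OF assms(2) reg]
      unfolding dt_jointly_state_minimal_def by blast
    then obtain \<Sigma>' where \<Sigma>': "is_lpv_ssa nu ny \<Sigma>'" "state_dim \<Sigma>' < state_dim \<Sigma>"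
      "dt_io_map nu P \<Sigma>' (0\<^sub>v (state_dim \<Sigma>')) = dt_io_map nu P \<Sigma> (0\<^sub>v (state_dim \<Sigma>))"
      by (rule reducible_smaller_system[OF assms(2)])
    then have "state_dim \<Sigma> \<le> state_dim \<Sigma>'"
      using min unfolding dt_minimal_def by (metis zero_carrier_vec)
    with \<Sigma>'(2) show False by simp
  qed
qed

end
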